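(* Let $\mu\in\mathscr K(X)$ be a $G$-Kato measure, and let $-\check L_{\rm rel}$ be the linear relation in $C_0(X)$ which is the generator of $(\check R_\alpha)_{\alpha>0}$. Then: (1) The linear relation $-\check L_{\rm rel}$ is $m$-dissipative. (2) The linear relation $-\check L_{\rm rel}$ generates an integrated semigroup $\check{\bf S}_t:C_0(X)\to C_0(X)$, $t\ge0$, via the equation $$\check R_\alpha=\alpha\int_0^\infty e^{-\alpha t}\check{\bf S}_t\,dt,\qquad\alpha>0.$$ (3) It holds $$\check{\bf S}_t=\int_0^t\check{\bf P}_s\,ds,\qquad t\ge0.$$ Both integrals, on the right-hand sides of the equations in (2) and (3), are strong Riemann integrals.
   Context: $X$ is a locally compact separable metric space, $m$ a positive Radon measure on the Borel sets of $X$ with full support, $X_\partial=X\cup\{\partial\}$ the one-point compactification; every function $u$ on $X$ is extended by $u(\partial)=0$. $\mathscr B_b(X)$ denotes the bounded Borel functions on $X$ with the sup norm $\|\cdot\|_\infty$, and $C_0(X)$ the continuous functions vanishing at infinity. $\mathbb X=(\Omega,\mathscr M,\mathscr M_t,(\mathbb P_x)_{x\in X_\partial},(\mathbb X_t)_{0\le t\le\infty},(\theta_t),\zeta)$ is a standard process in the sense of Blumenthal–Getoor (not necessarily symmetric) with state space $X$ and cemetery $\partial$ (with $\mathbb X_\infty=\partial$). It is transient and has a dual standard process $\hat{\mathbb X}$ (duality with respect to $m$) with the same properties. Its transition semigroup ${\bf P}_tu(x)=\mathbb E_x[u(\mathbb X_t)]$ has a jointly measurable density $p_t(x,y)$ with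 respect to $m$, with $p_t(x,y)>0$ for all $t>0$, $x,y\in X$. For $\alpha\ge0$, $G_\alpha(x,y)=\int_0^\infty e^{-\alpha t}p_t(x,y)\,dt$, $G:=G_0\not\equiv\infty$, and $G:X\times X\to(0,\infty]$ is lower semicontinuous. A positive Radon measure $\mu$ on $X$ is $G$-Kato if $G^\mu1:=\int_XG(\cdot,y)\,d\mu(y)\in C_0(X)$; $\mathscr K(X)$ is the set of $G$-Kato measures. Each $\mu\in\mathscr K(X)$ has a unique (up to equivalence) positive continuous additive functional (PCAF) ${\bf A}$ of $\mathbb X$ with Revuz measure $\mu$; it satisfies $\mathbb E_x[\int_0^\infty e^{-\alpha t}u(\mathbb X_t)\,d{\bf A}_t]=\int_XG_\alpha(x,y)u(y)\,d\mu(y)$ for $u\in\mathscr B_b(X)$, $\alpha\ge0$, $x\in X$. Put $\tau_t=\inf\{s\ge0:{\bf A}_s>t\}$ and, for $u\in\mathscr B_b(X)$, $x\in X$, $\check{\bf P}_tu(x)=\mathbb E_x[u(\mathbb X_{\tau_t})]$ and $\check R_\alpha u(x)=\mathbb E_x[\int_0^\infty e^{-\alpha t}u(\mathbb X_{\tau_t})\,dt]$. The operators $\check R_\alpha$, $\alpha>0$, map $C_0(X)$ into $C_0(X)$, satisfy the resolvent equation and $\alpha\|\check R_\alpha\|\le1$, but need not be injective. A linear relation in $C_0(X)$ is a linear subspace of $C_0(X)\times C_0(X)$. $\check L_{\rm rel}=\{(u,v)\in C_0(X)\times C_0(X): \check R_\alpha(v+\alpha u)=u\}$ (independent of $\alpha>0$;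 equivalently the pairs $(u,\check R_\alpha^{-1}\{u\}-\alpha u)$), so that $(\check L_{\rm rel}+\alpha)^{-1}=\check R_\alpha$ for $\alpha>0$; $-\check L_{\rm rel}=\{(u,-v):(u,v)\in\check L_{\rm rel}\}$ is called the generator of $(\check R_\alpha)$. A linear relation $A$ is dissipative if $\|x-sy\|\ge\|x\|$ for all $(x,y)\in A$, $s>0$, and $m$-dissipative if moreover for some (hence every) $s>0$ every $z\in C_0(X)$ is of the form $z=x-sy$ with $(x,y)\in A$. $A$ generates an integrated semigroup if there is a strongly continuous family $(S_t)_{t\ge0}$ of bounded linear operators with $(\alpha-A)^{-1}=\alpha\int_0^\infty e^{-\alpha t}S_t\,dt$ for all sufficiently large $\alpha$ (here for all $\alpha>0$). *)

theory Defs
  imports "HOL-Probability.Probability"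
begin

section \<open>The Banach space of continuous functions vanishing at infinity\<close>

typedef (overloaded) ('a :: topological_space) c0 =
    "{f :: 'a \<Rightarrow>\<^sub>C real. \<forall>e>0. \<exists>K. compact K \<and> (\<forall>x. x \<notin> K \<longrightarrow> \<bar>apply_bcontfun f x\<bar> < e)}"
  morphisms bcontfun_of_c0 Abs_c0
proof
  show "0 \<in> {f :: 'a \<Rightarrow>\<^sub>C real. \<forall>e>0. \<exists>K. compact K \<and> (\<forall>x. x \<notin> K \<longrightarrow> \<bar>apply_bcontfun f x\<bar> < e)}"
    by (auto intro!: exI[of _ "{}"])
qed

setup_lifting type_definition_c0

definition c0_apply :: "'a :: topological_space c0 \<Rightarrow> 'a \<Rightarrow> real" where
  "c0_apply u = apply_bcontfun (bcontfun_of_c0 u)"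

instantiation c0 :: (topological_space) real_vector
begin

lift_definition zero_c0 :: "'a c0" is 0
  by (auto intro!: exI[of _ "{}"])

lift_definition plus_c0 :: "'a c0 \<Rightarrow> 'a c0 \<Rightarrow> 'a c0" is "(+)"
proof -
  fix f g :: "'a \<Rightarrow>\<^sub>C real" and e :: real
  assume f: "\<And>e. 0 < e \<Longrightarrow> \<exists>K. compact K \<and> (\<forall>x. x \<notin> K \<longrightarrow> \<bar>apply_bcontfun f x\<bar> < e)"
    and g: "\<And>e. 0 < e \<Longrightarrow> \<exists>K. compact K \<and> (\<forall>x. x \<notin> K \<longrightarrow> \<bar>apply_bcontfun g x\<bar> < e)"
    and e: "0 < e"
  obtain K where K: "compact K" "\<And>x. x \<notin> K \<Longrightarrow> \<bar>apply_bcontfun f x\<bar> < e / 2"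
    using f e by (meson half_gt_zero)
  obtain L where L: "compact L" "\<And>x. x \<notin> L \<Longrightarrow> \<bar>apply_bcontfun g x\<bar> < e / 2"
    using g e by (meson half_gt_zero)
  show "\<exists>K. compact K \<and> (\<forall>x. x \<notin> K \<longrightarrow> \<bar>apply_bcontfun (f + g) x\<bar> < e)"
  proof (intro exI conjI allI impI)
    show "compact (K \<union> L)"
      using K L by (intro compact_Un)
    fix x assume "x \<notin> K \<union> L"
    then have "\<bar>apply_bcontfun f x\<bar> < e / 2" "\<bar>apply_bcontfun g x\<bar> < e / 2"
      using K L by auto
    then show "\<bar>apply_bcontfun (f + g) x\<bar> < e"
      by simp
  qed
qed

lift_definition uminus_c0 :: "'a c0 \<Rightarrow> 'a c0" is uminus
  by simp

lift_definition scaleR_c0 :: "real \<Rightarrow> 'a c0 \<Rightarrow> 'a c0" is "(*\<^sub>R)"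
proof -
  fix r :: real and f :: "'a \<Rightarrow>\<^sub>C real" and e :: real
  assume f: "\<And>e. 0 < e \<Longrightarrow> \<exists>K. compact K \<and> (\<forall>x. x \<notin> K \<longrightarrow> \<bar>apply_bcontfun f x\<bar> < e)"
    and e: "0 < e"
  have "0 < e / (\<bar>r\<bar> + 1)"
    using e by auto
  then obtain K where K: "compact K" "\<And>x. x \<notin> K \<Longrightarrow> \<bar>apply_bcontfun f x\<bar> < e / (\<bar>r\<bar> + 1)"
    using f by meson
  have "\<bar>apply_bcontfun (r *\<^sub>R f) x\<bar> < e" if "x \<notin> K" for x
  proof -
    have "\<bar>apply_bcontfun (r *\<^sub>R f) x\<bar> \<le> (\<bar>r\<bar> + 1) * \<bar>apply_bcontfun f x\<bar>"
      by (simp add: abs_mult mult_right_mono)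
    also have "\<dots> < e"
      using K(2)[OF that] by (simp add: field_simps)
    finally show ?thesis .
  qed
  then show "\<exists>K. compact K \<and> (\<forall>x. x \<notin> K \<longrightarrow> \<bar>apply_bcontfun (r *\<^sub>R f) x\<bar> < e)"
    using K(1) by blast
qed

definition minus_c0 :: "'a c0 \<Rightarrow> 'a c0 \<Rightarrow> 'a c0" where
  "minus_c0 u v = u + - v"

instance
proof
  fix u v w :: "'a c0" and a b :: real
  show "u + v + w = u + (v + w)" by transfer (rule add.assoc)
  show "u + v = v + u" by transfer (rule add.commute)
  show "0 + u = u" by transfer simp
  show "- u + u = 0" by transfer simp
  show "u - v = u + - v" by (rule minus_c0_def)
  show "a *\<^sub>R (u + v) = a *\<^sub>R u + a *\<^sub>R v" by transfer (rule scaleR_add_right)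
  show "(a + b) *\<^sub>R u = a *\<^sub>R u + b *\<^sub>R u" by transfer (rule scaleR_add_left)
  show "a *\<^sub>R b *\<^sub>R u = (a * b) *\<^sub>R u" by transfer simp
  show "1 *\<^sub>R u = u" by transfer simp
qed

end

instantiation c0 :: (topological_space) real_normed_vector
begin

lift_definition norm_c0 :: "'a c0 \<Rightarrow> real" is norm .

definition dist_c0 :: "'a c0 \<Rightarrow> 'a c0 \<Rightarrow> real" where
  "dist_c0 u v = norm (u - v)"

definition sgn_c0 :: "'a c0 \<Rightarrow> 'a c0" where
  "sgn_c0 u = u /\<^sub>R norm u"

definition uniformity_c0 :: "('a c0 \<times> 'a c0) filter" where
  "uniformity_c0 = (INF e\<in>{0 <..}. principal {(x, y). dist x y < e})"

definition open_c0 :: "'a c0 set \<Rightarrow> bool" where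
  "open_c0 S = (\<forall>x\<in>S. \<forall>\<^sub>F (x', y) in uniformity. x' = x \<longrightarrow> y \<in> S)"

instance
proof
  fix u v :: "'a c0" and a :: real
  show "dist u v = norm (u - v)" by (rule dist_c0_def)
  show "sgn u = u /\<^sub>R norm u" by (rule sgn_c0_def)
  show "uniformity = (INF e\<in>{0 <..}. principal {(x :: 'a c0, y). dist x y < e})"
    by (rule uniformity_c0_def)
  show "open S = (\<forall>x\<in>S. \<forall>\<^sub>F (x', y) in uniformity. x' = x \<longrightarrow> y \<in> S)" for S :: "'a c0 set"
    by (rule open_c0_def)
  show "norm u = 0 \<longleftrightarrow> u = 0" by transfer simp
  show "norm (u + v) \<le> norm u + norm v" by transfer (rule norm_triangle_ineq)
  show "norm (a *\<^sub>R u) = \<bar>a\<bar> * norm u" by transfer simp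
qed

end

lemma bcontfun_of_c0_minus: "bcontfun_of_c0 (u - v) = bcontfun_of_c0 u - bcontfun_of_c0 v"
  unfolding minus_c0_def plus_c0.rep_eq uminus_c0.rep_eq by simp

lemma c0_apply_simps [simp]:
  "c0_apply 0 x = 0"
  "c0_apply (u + v) x = c0_apply u x + c0_apply v x"
  "c0_apply (- u) x = - c0_apply u x"
  "c0_apply (u - v) x = c0_apply u x - c0_apply v x"
  "c0_apply (r *\<^sub>R u) x = r * c0_apply u x"
  by (simp_all add: c0_apply_def bcontfun_of_c0_minus zero_c0.rep_eq plus_c0.rep_eq uminus_c0.rep_eq
        scaleR_c0.rep_eq)

lemma norm_c0_eq_SUP: "norm u = (SUP x. \<bar>c0_apply u x\<bar>)"
  by (simp add: c0_apply_def norm_c0.rep_eq norm_bcontfun_def dist_bcontfun.rep_eq dist_real_def)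

instance c0 :: (metric_space) banach
proof
  fix U :: "nat \<Rightarrow> 'a c0"
  assume U: "Cauchy U"
  have dist_eq: "dist (bcontfun_of_c0 u) (bcontfun_of_c0 v) = dist u v" for u v :: "'a c0"
    unfolding dist_norm by (simp add: norm_c0.rep_eq bcontfun_of_c0_minus)
  have "Cauchy (\<lambda>n. bcontfun_of_c0 (U n))"
    using U by (simp add: Cauchy_def dist_eq)
  then obtain l where l: "(\<lambda>n. bcontfun_of_c0 (U n)) \<longlonglongrightarrow> l"
    using Cauchy_convergent_iff convergent_def by blast
  have "\<exists>K. compact K \<and> (\<forall>x. x \<notin> K \<longrightarrow> \<bar>apply_bcontfun l x\<bar> < e)" if e: "0 < e" for e
  proof -
    obtain n where n: "dist (bcontfun_of_c0 (U n)) l < e / 2"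
      using metric_LIMSEQ_D[OF l, of "e / 2"] e by auto
    have "\<forall>e>0. \<exists>K. compact K \<and> (\<forall>x. x \<notin> K \<longrightarrow> \<bar>apply_bcontfun (bcontfun_of_c0 (U n)) x\<bar> < e)"
      using bcontfun_of_c0[of "U n"] by (rule CollectD)
    with half_gt_zero[OF e] obtain K where K: "compact K"
      "\<And>x. x \<notin> K \<Longrightarrow> \<bar>apply_bcontfun (bcontfun_of_c0 (U n)) x\<bar> < e / 2"
      by blast
    have "\<bar>apply_bcontfun l x\<bar> < e" if "x \<notin> K" for x
      using K(2)[OF that] dist_fun_lt_imp_dist_val_lt[OF n, of x]
      unfolding dist_real_def by linarith
    then show ?thesis
      using K(1) by blast
  qed
  then have "bcontfun_of_c0 (Abs_c0 l) = l"
    by (simp add: Abs_c0_inverse)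
  then have "dist (U n) (Abs_c0 l) = dist (bcontfun_of_c0 (U n)) l" for n
    using dist_eq[of "U n" "Abs_c0 l"] by simp
  moreover have "(\<lambda>n. dist (bcontfun_of_c0 (U n)) l) \<longlonglongrightarrow> 0"
    using l by (rule tendsto_dist_iff[THEN iffD1])
  ultimately have "(\<lambda>n. dist (U n) (Abs_c0 l)) \<longlonglongrightarrow> 0"
    by simp
  then have "U \<longlonglongrightarrow> Abs_c0 l"
    by (rule tendsto_dist_iff[THEN iffD2])
  then show "convergent U"
    by (rule convergentI)
qed


section \<open>Bounded Borel functions and Riemann integrals\<close>

definition bounded_borel :: "('a :: topological_space \<Rightarrow> real) set" where
  "bounded_borel = {u. u \<in> borel_measurable borel \<and> bounded (range u)}"

definition sup_norm :: "('a \<Rightarrow> real) \<Rightarrow> real" where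
  "sup_norm u = (SUP x. \<bar>u x\<bar>)"

text \<open>The set \<open>K\<close> of a tagged pair \<open>(s, K)\<close> is an interval and \<open>measure lborel K\<close> is its length, so the
  condition on \<open>p\<close> says that the mesh of the tagged partition is less than \<open>d\<close>.\<close>

definition has_riemann_integral ::
    "(real \<Rightarrow> 'b :: real_normed_vector) \<Rightarrow> 'b \<Rightarrow> real \<Rightarrow> real \<Rightarrow> bool" where
  "has_riemann_integral f I a b \<longleftrightarrow>
    (\<forall>e>0. \<exists>d>0. \<forall>p. p tagged_division_of {a..b} \<and> (\<forall>(s, K)\<in>p. measure lborel K < d) \<longrightarrow>
      norm ((\<Sum>(s, K)\<in>p. measure lborel K *\<^sub>R f s) - I) < e)"

definition has_improper_riemann_integral :: "(real \<Rightarrow> 'b :: real_normed_vector) \<Rightarrow> 'b \<Rightarrow> bool" where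
  "has_improper_riemann_integral f I \<longleftrightarrow>
    (\<exists>J. (\<forall>T\<ge>0. has_riemann_integral f (J T) 0 T) \<and> (J \<longlongrightarrow> I) at_top)"

text \<open>The Riemann integral of a function with values in the bounded Borel functions, with respect
  to the sup norm.\<close>

definition has_uniform_riemann_integral ::
    "(real \<Rightarrow> 'a :: topological_space \<Rightarrow> real) \<Rightarrow> ('a \<Rightarrow> real) \<Rightarrow> real \<Rightarrow> real \<Rightarrow> bool" where
  "has_uniform_riemann_integral f I a b \<longleftrightarrow>
    (\<forall>s\<in>{a..b}. f s \<in> bounded_borel) \<and> I \<in> bounded_borel \<and>
    (\<forall>e>0. \<exists>d>0. \<forall>p. p tagged_division_of {a..b} \<and> (\<forall>(s, K)\<in>p. measure lborel K < d) \<longrightarrow>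
      sup_norm (\<lambda>x. (\<Sum>(s, K)\<in>p. measure lborel K * f s x) - I x) < e)"


section \<open>Linear relations and integrated semigroups\<close>

definition linear_relation :: "('b :: real_vector \<times> 'b) set \<Rightarrow> bool" where
  "linear_relation A \<longleftrightarrow> subspace A"

definition neg_relation :: "('b :: real_vector \<times> 'b) set \<Rightarrow> ('b \<times> 'b) set" where
  "neg_relation A = {(u, - v) | u v. (u, v) \<in> A}"

definition dissipative :: "('b :: real_normed_vector \<times> 'b) set \<Rightarrow> bool" where
  "dissipative A \<longleftrightarrow> (\<forall>(x, y)\<in>A. \<forall>s>0. norm (x - s *\<^sub>R y) \<ge> norm x)"

definition m_dissipative :: "('b :: real_normed_vector \<times> 'b) set \<Rightarrow> bool" where
  "m_dissipative A \<longleftrightarrow>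
    dissipative A \<and> (\<exists>s>0. \<forall>z. \<exists>(x, y)\<in>A. z = x - s *\<^sub>R y)"

text \<open>The relation \<open>(\<alpha> - A)\<inverse>\<close>.\<close>

definition resolvent_relation :: "('b :: real_vector \<times> 'b) set \<Rightarrow> real \<Rightarrow> ('b \<times> 'b) set" where
  "resolvent_relation A \<alpha> = {(\<alpha> *\<^sub>R x - y, x) | x y. (x, y) \<in> A}"

text \<open>The condition on \<open>\<alpha>\<close> says that \<open>(\<alpha> - A)\<inverse>\<close> is (the graph of) the everywhere defined operator
  that maps \<open>z\<close> to \<open>\<alpha> \<integral>\<^sub>0\<^sup>\<infinity> e\<^sup>-\<^sup>\<alpha>\<^sup>t S\<^sub>t z dt\<close>. Only the values of \<open>S\<close> at \<open>t \<ge> 0\<close> matter.\<close>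

definition generates_integrated_semigroup ::
    "('b :: real_normed_vector \<times> 'b) set \<Rightarrow> (real \<Rightarrow> 'b \<Rightarrow>\<^sub>L 'b) \<Rightarrow> real \<Rightarrow> bool" where
  "generates_integrated_semigroup A S \<alpha>\<^sub>0 \<longleftrightarrow>
    (\<forall>z. continuous_on {0..} (\<lambda>t. blinfun_apply (S t) z)) \<and>
    (\<forall>\<alpha>>\<alpha>\<^sub>0. \<forall>z. \<exists>I.
      has_improper_riemann_integral (\<lambda>t. exp (- \<alpha> * t) *\<^sub>R blinfun_apply (S t) z) I \<and>
      {x. (z, x) \<in> resolvent_relation A \<alpha>} = {\<alpha> *\<^sub>R I})"


section \<open>Standard processes\<close>

text \<open>The one-point compactification of the state space is realised on the type \<open>'x option\<close>, the
  cemetery being \<open>None\<close>; if the state space is compact, \<open>None\<close> is an isolated point.\<close>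

abbreviation cemetery_topology :: "'x :: topological_space option topology" where
  "cemetery_topology \<equiv> Alexandroff_compactification euclidean"

definition cemetery_borel :: "'x :: topological_space option measure" where
  "cemetery_borel = sigma UNIV {U. openin cemetery_topology U}"

definition extend0 :: "('x \<Rightarrow> 'c :: zero) \<Rightarrow> 'x option \<Rightarrow> 'c" where
  "extend0 u z = (case z of None \<Rightarrow> 0 | Some x \<Rightarrow> u x)"

text \<open>The time set \<open>[0, \<infinity>]\<close> is the type \<open>ennreal\<close>, and the sample space is a whole type.\<close>

definition lifetime :: "(ennreal \<Rightarrow> 'w \<Rightarrow> 'x option) \<Rightarrow> 'w \<Rightarrow> ennreal" where
  "lifetime X \<omega> = Inf {t. X t \<omega> = None}"

definition raw_filtration ::
    "(ennreal \<Rightarrow> 'w \<Rightarrow> 'x :: topological_space option) \<Rightarrow> ennreal \<Rightarrow> 'w measure" where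
  "raw_filtration X t = sigma UNIV {X s -` B | s B. s \<le> t \<and> B \<in> sets cemetery_borel}"

text \<open>The completion of \<open>raw_filtration X t\<close> in \<open>raw_filtration X \<infinity>\<close> with respect to the measures
  \<open>P\<^sub>\<nu>(\<Lambda>) = \<integral> P\<^sub>x(\<Lambda>) d\<nu>(x)\<close>, \<open>\<nu>\<close> running through the initial distributions.\<close>

definition augmented_filtration ::
    "(ennreal \<Rightarrow> 'w \<Rightarrow> 'x :: topological_space option) \<Rightarrow> ('x option \<Rightarrow> 'w measure) \<Rightarrow>
      ennreal \<Rightarrow> 'w measure" where
  "augmented_filtration X P t = sigma UNIV {\<Lambda>.
    \<forall>\<nu>. prob_space \<nu> \<and> sets \<nu> = sets cemetery_borel \<longrightarrow>
      (\<exists>\<Lambda>'\<in>sets (raw_filtration X t). \<exists>N\<in>sets (raw_filtration X \<infinity>).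
        (\<Lambda> - \<Lambda>') \<union> (\<Lambda>' - \<Lambda>) \<subseteq> N \<and> (\<integral>\<^sup>+ x. emeasure (P x) N \<partial>\<nu>) = 0)}"

definition almost_surely ::
    "'w measure \<Rightarrow> ('z \<Rightarrow> 'w measure) \<Rightarrow> ('w \<Rightarrow> bool) \<Rightarrow> bool" where
  "almost_surely M P Q \<longleftrightarrow>
    (\<exists>N\<in>sets M. (\<forall>x. emeasure (P x) N = 0) \<and> (\<forall>\<omega>. \<omega> \<notin> N \<longrightarrow> Q \<omega>))"

text \<open>A standard process in the sense of Blumenthal and Getoor. The (simple) Markov property is
  \<open>strong_Markov\<close> for constant \<open>T\<close>. Completeness of the filtration \<open>F\<close> enters through
  \<open>augmented\<close> and \<open>null_subsets\<close>.\<close>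

locale standard_process = filtration UNIV F
  for M :: "'w measure"
    and F :: "ennreal \<Rightarrow> 'w measure"
    and X :: "ennreal \<Rightarrow> 'w \<Rightarrow> 'x :: {metric_space, second_countable_topology} option"
    and \<theta> :: "ennreal \<Rightarrow> 'w \<Rightarrow> 'w"
    and P :: "'x option \<Rightarrow> 'w measure" +
  assumes space_M: "space M = UNIV"
    and sets_F: "sets (F t) \<subseteq> sets M"
    and prob_P: "prob_space (P x)"
    and sets_P: "sets (P x) = sets M"
    and adapted: "X t \<in> measurable (F t) cemetery_borel"
    and X_infinity: "X \<infinity> \<omega> = None"
    and absorbing: "X s \<omega> = None \<Longrightarrow> s \<le> t \<Longrightarrow> X t \<omega> = None"
    and shift: "X t (\<theta> h \<omega>) = X (t + h) \<omega>"
    and shift_infinity: "\<exists>\<omega>\<^sub>0. \<forall>\<omega>. \<theta> \<infinity> \<omega> = \<omega>\<^sub>0"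
    and kernel: "B \<in> sets cemetery_borel \<Longrightarrow>
      (\<lambda>x. emeasure (P x) {\<omega>. X t \<omega> \<in> B}) \<in> borel_measurable cemetery_borel"
    and normal: "emeasure (P x) {\<omega>. X 0 \<omega> = x} = 1"
    and right_continuous_F: "t < \<infinity> \<Longrightarrow> sets (F t) = (\<Inter>s\<in>{t<..}. sets (F s))"
    and augmented: "sets (augmented_filtration X P t) \<subseteq> sets (F t)"
    and null_subsets: "N \<in> sets M \<Longrightarrow> (\<And>x. emeasure (P x) N = 0) \<Longrightarrow> N' \<subseteq> N \<Longrightarrow> N' \<in> sets (F t)"
    and paths: "almost_surely M P (\<lambda>\<omega>.
      (\<forall>t<\<infinity>. limitin cemetery_topology (\<lambda>s. X s \<omega>) (X t \<omega>) (at_right t)) \<and>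
      (\<forall>t. 0 < t \<and> t < lifetime X \<omega> \<longrightarrow>
        (\<exists>y. limitin cemetery_topology (\<lambda>s. X s \<omega>) (Some y) (at_left t))))"
    and strong_measurable: "stopping_time F T \<Longrightarrow>
      (\<lambda>\<omega>. X (T \<omega>) \<omega>) \<in> measurable (pre_sigma T) cemetery_borel"
    and strong_Markov: "stopping_time F T \<Longrightarrow> \<Lambda> \<in> sets (pre_sigma T) \<Longrightarrow> B \<in> sets cemetery_borel \<Longrightarrow>
      emeasure (P x) {\<omega>\<in>\<Lambda>. X (T \<omega> + t) \<omega> \<in> B} =
      (\<integral>\<^sup>+ \<omega>\<in>\<Lambda>. emeasure (P (X (T \<omega>) \<omega>)) {\<omega>'. X t \<omega>' \<in> B} \<partial>P x)"
    and quasi_left_continuous: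
      "(\<And>n. stopping_time F (T' n)) \<Longrightarrow> (\<And>\<omega>. incseq (\<lambda>n. T' n \<omega>)) \<Longrightarrow>
      almost_surely M P (\<lambda>\<omega>. (SUP n. T' n \<omega>) < lifetime X \<omega> \<longrightarrow>
        limitin cemetery_topology (\<lambda>n. X (T' n \<omega>) \<omega>) (X (SUP n. T' n \<omega>) \<omega>) sequentially)"

definition potential ::
    "(ennreal \<Rightarrow> 'w \<Rightarrow> 'x option) \<Rightarrow> ('x option \<Rightarrow> 'w measure) \<Rightarrow> real \<Rightarrow>
      ('x \<Rightarrow> ennreal) \<Rightarrow> 'x \<Rightarrow> ennreal" where
  "potential X P \<alpha> f x = (\<integral>\<^sup>+ t\<in>{0<..}. ennreal (exp (- \<alpha> * t)) *
    (\<integral>\<^sup>+ \<omega>. extend0 f (X (ennreal t) \<omega>) \<partial>P (Some x)) \<partial>lborel)"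

definition transient ::
    "(ennreal \<Rightarrow> 'w \<Rightarrow> 'x :: topological_space option) \<Rightarrow> ('x option \<Rightarrow> 'w measure) \<Rightarrow> bool" where
  "transient X P \<longleftrightarrow>
    (\<exists>q\<in>borel_measurable borel. (\<forall>x. 0 < q x) \<and> (\<forall>x. potential X P 0 q x < \<infinity>))"

definition in_duality ::
    "'x :: topological_space measure \<Rightarrow>
      (ennreal \<Rightarrow> 'w \<Rightarrow> 'x option) \<Rightarrow> ('x option \<Rightarrow> 'w measure) \<Rightarrow>
      (ennreal \<Rightarrow> 'v \<Rightarrow> 'x option) \<Rightarrow> ('x option \<Rightarrow> 'v measure) \<Rightarrow> bool" where
  "in_duality m X P X' P' \<longleftrightarrow>
    (\<forall>\<alpha>>0. \<forall>x. \<forall>B\<in>null_sets m.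
      potential X P \<alpha> (indicator B) x = 0 \<and> potential X' P' \<alpha> (indicator B) x = 0) \<and>
    (\<forall>\<alpha>>0. \<forall>f\<in>borel_measurable borel. \<forall>g\<in>borel_measurable borel.
      (\<integral>\<^sup>+ x. f x * potential X P \<alpha> g x \<partial>m) = (\<integral>\<^sup>+ x. potential X' P' \<alpha> f x * g x \<partial>m))"


section \<open>Densities, Green functions and Kato measures\<close>

text \<open>On a locally compact separable metric space every Borel measure that is finite on compact
  sets is regular, hence a Radon measure.\<close>

definition radon_measure :: "'x :: topological_space measure \<Rightarrow> bool" where
  "radon_measure m \<longleftrightarrow> sets m = sets borel \<and> (\<forall>K. compact K \<longrightarrow> emeasure m K < \<infinity>)"

definition full_support :: "'x :: topological_space measure \<Rightarrow> bool" where
  "full_support m \<longleftrightarrow> (\<forall>U. open U \<and> U \<noteq> {} \<longrightarrow> 0 < emeasure m U)"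

definition transition_density ::
    "'x :: topological_space measure \<Rightarrow> (ennreal \<Rightarrow> 'w \<Rightarrow> 'x option) \<Rightarrow>
      ('x option \<Rightarrow> 'w measure) \<Rightarrow> (real \<Rightarrow> 'x \<Rightarrow> 'x \<Rightarrow> ennreal) \<Rightarrow> bool" where
  "transition_density m X P p \<longleftrightarrow>
    (\<lambda>(t, x, y). p t x y) \<in>
      borel_measurable (restrict_space borel {0<..} \<Otimes>\<^sub>M (borel \<Otimes>\<^sub>M borel)) \<and>
    (\<forall>t>0. \<forall>x. \<forall>B\<in>sets borel.
      emeasure (P (Some x)) {\<omega>. X (ennreal t) \<omega> \<in> Some ` B} = (\<integral>\<^sup>+ y\<in>B. p t x y \<partial>m))"

definition green :: "(real \<Rightarrow> 'x \<Rightarrow> 'x \<Rightarrow> ennreal) \<Rightarrow> real \<Rightarrow> 'x \<Rightarrow> 'x \<Rightarrow> ennreal" where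
  "green p \<alpha> x y = (\<integral>\<^sup>+ t\<in>{0<..}. ennreal (exp (- \<alpha> * t)) * p t x y \<partial>lborel)"

definition lower_semicontinuous :: "('b :: topological_space \<Rightarrow> ennreal) \<Rightarrow> bool" where
  "lower_semicontinuous f \<longleftrightarrow> (\<forall>c. open {z. c < f z})"

definition kato_measure ::
    "(real \<Rightarrow> 'x \<Rightarrow> 'x \<Rightarrow> ennreal) \<Rightarrow> 'x :: topological_space measure \<Rightarrow> bool" where
  "kato_measure p \<mu> \<longleftrightarrow> radon_measure \<mu> \<and>
    (\<exists>g :: 'x c0. \<forall>x. 0 \<le> c0_apply g x \<and> (\<integral>\<^sup>+ y. green p 0 x y \<partial>\<mu>) = ennreal (c0_apply g x))"


section \<open>Additive functionals and time change\<close>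

text \<open>Positive continuous additive functionals with a defining set \<open>\<Lambda>\<close>. They are taken finite-valued,
  which is no loss of generality up to equivalence for Revuz measures \<open>\<mu>\<close> in the Kato class,
  since then the total mass has finite expectation \<open>\<integral> G(x, y) d\<mu>(y)\<close> for every starting point.\<close>

definition pcaf ::
    "(ennreal \<Rightarrow> 'w \<Rightarrow> 'x :: topological_space option) \<Rightarrow> (ennreal \<Rightarrow> 'w \<Rightarrow> 'w) \<Rightarrow>
      ('x option \<Rightarrow> 'w measure) \<Rightarrow> (real \<Rightarrow> 'w \<Rightarrow> real) \<Rightarrow> bool" where
  "pcaf X \<theta> P A \<longleftrightarrow>
    (\<forall>t\<ge>0. A t \<in> borel_measurable (augmented_filtration X P (ennreal t))) \<and>
    (\<exists>\<Lambda>\<in>sets (augmented_filtration X P \<infinity>).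
      (\<forall>x. emeasure (P x) \<Lambda> = 1) \<and> (\<forall>t\<ge>0. \<theta> (ennreal t) ` \<Lambda> \<subseteq> \<Lambda>) \<and>
      (\<forall>\<omega>\<in>\<Lambda>. A 0 \<omega> = 0 \<and> mono_on {0..} (\<lambda>t. A t \<omega>) \<and> continuous_on {0..} (\<lambda>t. A t \<omega>) \<and>
        (\<forall>s t. 0 \<le> s \<and> s \<le> t \<and> lifetime X \<omega> \<le> ennreal s \<longrightarrow> A t \<omega> = A s \<omega>) \<and>
        (\<forall>s\<ge>0. \<forall>t\<ge>0. A (t + s) \<omega> = A t \<omega> + A s (\<theta> (ennreal t) \<omega>))))"

text \<open>The measure \<open>dA\<^sub>t(\<omega>)\<close> on the half-line; it does not charge the negative times.\<close>

definition pcaf_measure :: "(real \<Rightarrow> 'w \<Rightarrow> real) \<Rightarrow> 'w \<Rightarrow> real measure" where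
  "pcaf_measure A \<omega> = interval_measure (\<lambda>t. A (max 0 t) \<omega>)"

definition revuz_measure ::
    "'x :: topological_space measure \<Rightarrow> (ennreal \<Rightarrow> 'w \<Rightarrow> 'x option) \<Rightarrow>
      ('x option \<Rightarrow> 'w measure) \<Rightarrow> (real \<Rightarrow> 'w \<Rightarrow> real) \<Rightarrow> 'x measure \<Rightarrow> bool" where
  "revuz_measure m X P A \<mu> \<longleftrightarrow>
    (\<forall>f\<in>borel_measurable borel.
      ((\<lambda>t. ennreal (1 / t) * (\<integral>\<^sup>+ x. (\<integral>\<^sup>+ \<omega>.
          (\<integral>\<^sup>+ s\<in>{0..t}. extend0 f (X (ennreal s) \<omega>) \<partial>pcaf_measure A \<omega>) \<partial>P (Some x)) \<partial>m))
        \<longlongrightarrow> (\<integral>\<^sup>+ x. f x \<partial>\<mu>)) (at_right 0))"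

text \<open>Here \<open>u\<close> ranges over the nonnegative bounded Borel functions; the formula for signed \<open>u\<close>
  follows by linearity.\<close>

definition revuz_potential_formula ::
    "(ennreal \<Rightarrow> 'w \<Rightarrow> 'x :: topological_space option) \<Rightarrow> ('x option \<Rightarrow> 'w measure) \<Rightarrow>
      (real \<Rightarrow> 'x \<Rightarrow> 'x \<Rightarrow> ennreal) \<Rightarrow> (real \<Rightarrow> 'w \<Rightarrow> real) \<Rightarrow> 'x measure \<Rightarrow> bool" where
  "revuz_potential_formula X P p A \<mu> \<longleftrightarrow>
    (\<forall>u\<in>bounded_borel. (\<forall>y. 0 \<le> u y) \<longrightarrow> (\<forall>\<alpha>\<ge>0. \<forall>x.
      (\<integral>\<^sup>+ \<omega>. (\<integral>\<^sup>+ t\<in>{0..}. ennreal (exp (- \<alpha> * t) * extend0 u (X (ennreal t) \<omega>))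
          \<partial>pcaf_measure A \<omega>) \<partial>P (Some x)) =
      (\<integral>\<^sup>+ y. green p \<alpha> x y * ennreal (u y) \<partial>\<mu>)))"

definition time_change :: "(real \<Rightarrow> 'w \<Rightarrow> real) \<Rightarrow> real \<Rightarrow> 'w \<Rightarrow> ennreal" where
  "time_change A t \<omega> = Inf {ennreal s | s. 0 \<le> s \<and> t < A s \<omega>}"

definition P_check ::
    "(ennreal \<Rightarrow> 'w \<Rightarrow> 'x option) \<Rightarrow> ('x option \<Rightarrow> 'w measure) \<Rightarrow> (real \<Rightarrow> 'w \<Rightarrow> real) \<Rightarrow>
      real \<Rightarrow> ('x \<Rightarrow> real) \<Rightarrow> 'x \<Rightarrow> real" where
  "P_check X P A t u x = (\<integral> \<omega>. extend0 u (X (time_change A t \<omega>) \<omega>) \<partial>P (Some x))"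

definition R_check ::
    "(ennreal \<Rightarrow> 'w \<Rightarrow> 'x option) \<Rightarrow> ('x option \<Rightarrow> 'w measure) \<Rightarrow> (real \<Rightarrow> 'w \<Rightarrow> real) \<Rightarrow>
      real \<Rightarrow> ('x \<Rightarrow> real) \<Rightarrow> 'x \<Rightarrow> real" where
  "R_check X P A \<alpha> u x =
    (\<integral> \<omega>. (LBINT t:{0..}. exp (- \<alpha> * t) * extend0 u (X (time_change A t \<omega>) \<omega>)) \<partial>P (Some x))"

text \<open>By the resolvent equation for \<open>R_check\<close> this relation does not depend on \<open>\<alpha> > 0\<close>.\<close>

definition L_check_rel ::
    "(ennreal \<Rightarrow> 'w \<Rightarrow> 'x :: topological_space option) \<Rightarrow> ('x option \<Rightarrow> 'w measure) \<Rightarrow>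
      (real \<Rightarrow> 'w \<Rightarrow> real) \<Rightarrow> real \<Rightarrow> ('x c0 \<times> 'x c0) set" where
  "L_check_rel X P A \<alpha> = {(u, v). R_check X P A \<alpha> (c0_apply (v + \<alpha> *\<^sub>R u)) = c0_apply u}"

end

theory Submission
  imports Defs
begin

text \<open>
  Let \<open>Y\<^sub>t\<close> be \<open>X\<close> at the time change and \<open>P\<^sub>t\<close> its semigroup. The potential operator
  \<open>U f = \<integral>\<^sub>0\<^sup>\<infinity> P\<^sub>t f dt\<close> is \<open>\<integral> G(\<cdot>, y) f(y) d\<mu>(y)\<close>. Since \<open>G\<close> is lower semicontinuous and
  \<open>U 1\<close> is continuous, \<open>U f\<close> and \<open>U (c - f)\<close> are both lower semicontinuous with a continuous sum, so
  \<open>U\<close> maps bounded Borel functions to \<open>C\<^sub>0\<close>. The strong Markov property gives the resolvent equation,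
  by which \<open>C\<^sub>0\<close> is invariant under all resolvents \<open>R\<^sub>\<alpha>\<close>, starting from \<open>U = R\<^sub>0\<close>. Approximating the indicator of
  \<open>[0, t]\<close> in \<open>L\<^sup>1\<close> by combinations of \<open>e\<^sup>-\<^sup>k\<^sup>s\<close>, \<open>k \<ge> 1\<close>, then shows that \<open>S\<^sub>t u = \<integral>\<^sub>0\<^sup>t P\<^sub>s u ds\<close>
  lies in \<open>C\<^sub>0\<close>. As a function of \<open>s\<close>, \<open>P\<^sub>s u\<close> need not be continuous in the sup norm. Its Riemann
  sums still converge uniformly: with \<open>w\<^sub>d = sup {\<bar>P\<^sub>r u - P\<^sub>0 u\<bar> | r \<le> d}\<close> one has
  \<open>\<bar>P\<^sub>s u - P\<^sub>t u\<bar> \<le> 2 P\<^sub>t\<^sub>-\<^sub>h w\<^sub>2\<^sub>h\<close> for \<open>\<bar>s - t\<bar> < h\<close>, so the error for mesh \<open>h\<close> is at most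
  \<open>2 h \<parallel>u\<parallel> + 2 U w\<^sub>2\<^sub>h\<close>, and \<open>U w\<^sub>2\<^sub>h \<rightarrow> 0\<close> uniformly by Dini's theorem.
\<close>

section \<open>Continuous functions vanishing at infinity\<close>

text \<open>A single P_s need neither preserve C_0 nor depend continuously on s, and P_0 need not be
  the identity, since \<tau>_0 may be positive. The Markov property of Y is therefore first proved
  in time-integrated form, with a weight g(r) in front of P_{s+r} f. Its hypothesis supplies the
  integrated expectation as a Borel function of the starting point, because measurability of P_r f
  in space is not yet available then. Exponential weights give the resolvent equation; normalised
  windows give the semigroup law in the limit. The Kato condition acts as a bound: the integral of
  |P_s u| over all times is at most ||u|| G^\<mu>1. So R_\<alpha> is bounded uniformly in \<alpha>
  \<ge> 0, the value 0 included, and this fixes the step by which invariance of C_0 is carried from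
  \<alpha> = 0 upwards. The probabilistic obstacle is measurability. The axioms give the strong
  Markov property for one later time, whereas the integral of g(r) f(Y_r) over r depends on the
  whole path and is measurable only after augmentation.\<close>

lemma c0_apply_eqI: "(\<And>x. c0_apply u x = c0_apply v x) \<Longrightarrow> u = v"
  unfolding c0_apply_def by (metis bcontfun_of_c0_inject apply_bcontfun_inject ext)

lemma continuous_on_c0_apply: "continuous_on A (c0_apply u)"
  unfolding c0_apply_def by (rule continuous_on_apply_bcontfun)

lemma borel_measurable_c0_apply [measurable]:
  fixes u :: "'a :: metric_space c0"
  shows "c0_apply u \<in> borel_measurable borel"
  by (rule borel_measurable_continuous_onI[OF continuous_on_c0_apply])

lemma c0_apply_vanishes:
  assumes "0 < e"
  obtains K where "compact K" "\<And>x. x \<notin> K \<Longrightarrow> \<bar>c0_apply u x\<bar> < e"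
  using bcontfun_of_c0[of u] assms by (auto simp: c0_apply_def)

lemma abs_c0_apply_le_norm: "\<bar>c0_apply u x\<bar> \<le> norm u"
  using norm_bounded[of "bcontfun_of_c0 u" x] by (simp add: c0_apply_def norm_c0.rep_eq)

lemma norm_c0_le: "(\<And>x. \<bar>c0_apply u x\<bar> \<le> c) \<Longrightarrow> norm u \<le> c"
  unfolding norm_c0_eq_SUP by (rule cSUP_least) auto

lemma bounded_borel_c0_apply:
  fixes u :: "'a :: metric_space c0"
  shows "c0_apply u \<in> bounded_borel"
  unfolding bounded_borel_def
  by (auto intro!: boundedI[of _ "norm u"] simp: abs_c0_apply_le_norm)

lemma bounded_linear_c0_apply:
  fixes x :: "'a :: topological_space"
  shows "bounded_linear (\<lambda>u. c0_apply u x)"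
  by (rule bounded_linear_intro[of _ 1]) (auto simp: abs_c0_apply_le_norm)

text \<open>The type \<open>c0\<close> sits inside the bounded continuous functions, so boundedness
  must come first: |f| < 1 off a compact set, and f is bounded on that set by continuity.\<close>

lemma c0_functionI:
  fixes f :: "'a :: topological_space \<Rightarrow> real"
  assumes cont: "continuous_on UNIV f"
    and van: "\<And>e. 0 < e \<Longrightarrow> \<exists>K. compact K \<and> (\<forall>x. x \<notin> K \<longrightarrow> \<bar>f x\<bar> < e)"
  shows "f \<in> range c0_apply"
proof -
  obtain K where K: "compact K" "\<And>x. x \<notin> K \<Longrightarrow> \<bar>f x\<bar> < 1"
    using van[of 1] by auto
  have "bounded (f ` K)"
    by (intro compact_imp_bounded compact_continuous_image K continuous_on_subset[OF cont]) auto
  then obtain b where b: "\<And>x. x \<in> K \<Longrightarrow> \<bar>f x\<bar> \<le> b"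
    by (auto simp: bounded_iff)
  have "\<bar>f x\<bar> \<le> max b 1" for x
    using b[of x] K(2)[of x] by (cases "x \<in> K") auto
  then have f: "f \<in> bcontfun"
    using cont by (intro bcontfun_normI[of f "max b 1"]) auto
  have "c0_apply (Abs_c0 (Bcontfun f)) = f"
    using van by (simp add: c0_apply_def Abs_c0_inverse Bcontfun_inverse[OF f])
  then show ?thesis
    by (metis rangeI)
qed

text \<open>C_0 is closed under uniform limits. This is how resolvents and time integrals of the
  semigroup, known only through approximations, are placed in C_0.\<close>

lemma c0_function_uniform_limit:
  fixes f :: "'a :: topological_space \<Rightarrow> real"
  assumes "\<And>e. 0 < e \<Longrightarrow> \<exists>v. \<forall>x. \<bar>f x - c0_apply v x\<bar> \<le> e"
  shows "f \<in> range c0_apply"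
proof (rule c0_functionI)
  have "\<exists>v. \<forall>n. \<forall>x. \<bar>f x - c0_apply (v n) x\<bar> \<le> inverse (Suc n)"
    using assms by (intro choice) auto
  then obtain v where v: "\<And>n x. \<bar>f x - c0_apply (v n) x\<bar> \<le> inverse (Suc n)"
    by blast
  have "uniform_limit UNIV (\<lambda>n. c0_apply (v n)) f sequentially"
  proof (rule uniform_limitI)
    fix e :: real assume "0 < e"
    then obtain N where N: "inverse (Suc N) < e"
      using reals_Archimedean by blast
    have "\<forall>x\<in>UNIV. dist (c0_apply (v n) x) (f x) < e" if "N \<le> n" for n
    proof
      fix x
      have "inverse (real (Suc n)) \<le> inverse (Suc N)"
        using that by (intro le_imp_inverse_le) auto
      with v[of x n] N show "dist (c0_apply (v n) x) (f x) < e"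
        unfolding dist_real_def by linarith
    qed
    then show "\<forall>\<^sub>F n in sequentially. \<forall>x\<in>UNIV. dist (c0_apply (v n) x) (f x) < e"
      unfolding eventually_sequentially by blast
  qed
  then show "continuous_on UNIV f"
    by (rule uniform_limit_theorem[rotated])
      (auto intro!: always_eventually continuous_on_c0_apply)
next
  fix e :: real assume "0 < e"
  then obtain v where v: "\<And>x. \<bar>f x - c0_apply v x\<bar> \<le> e / 2"
    using assms[of "e / 2"] by auto
  obtain K where K: "compact K" "\<And>x. x \<notin> K \<Longrightarrow> \<bar>c0_apply v x\<bar> < e / 2"
    using c0_apply_vanishes[of "e / 2" v] \<open>0 < e\<close> by auto
  have "\<bar>f x\<bar> < e" if "x \<notin> K" for x
    using v[of x] K(2)[OF that] by linarith
  then show "\<exists>K. compact K \<and> (\<forall>x. x \<notin> K \<longrightarrow> \<bar>f x\<bar> < e)"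
    using K by blast
qed

text \<open>Positive and negative parts stay in C_0. Facts obtained with nonnegative integrals are
  extended to signed functions through this splitting.\<close>

lemma c0_parts:
  fixes u :: "'a :: topological_space c0"
  obtains u1 u2 where "u = u1 - u2" "\<And>x. 0 \<le> c0_apply u1 x" "\<And>x. 0 \<le> c0_apply u2 x"
proof -
  have "(\<lambda>x. max 0 (c0_apply v x)) \<in> range c0_apply" for v :: "'a c0"
  proof (rule c0_functionI)
    show "continuous_on UNIV (\<lambda>x. max 0 (c0_apply v x))"
      by (intro continuous_on_max continuous_on_c0_apply continuous_intros)
    fix e :: real assume "0 < e"
    then obtain K where K: "compact K" "\<And>x. x \<notin> K \<Longrightarrow> \<bar>c0_apply v x\<bar> < e"
      using c0_apply_vanishes by blast
    then have "\<bar>max 0 (c0_apply v x)\<bar> < e" if "x \<notin> K" for x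
      using K(2)[OF that] by auto
    then show "\<exists>K. compact K \<and> (\<forall>x. x \<notin> K \<longrightarrow> \<bar>max 0 (c0_apply v x)\<bar> < e)"
      using K by blast
  qed
  then obtain u1 u2 where u: "c0_apply u1 = (\<lambda>x. max 0 (c0_apply u x))"
      "c0_apply u2 = (\<lambda>x. max 0 (c0_apply (- u) x))"
    by (metis image_iff)
  show ?thesis
    by (rule that[of u1 u2]) (auto intro!: c0_apply_eqI simp: u)
qed

text \<open>Vanishing at infinity replaces compactness of the space: off K every member of the
  sequence lies below the small member \<open>f 0\<close>, and on K the usual finite subcover
  applies.\<close>

lemma Dini_c0:
  fixes f :: "nat \<Rightarrow> 'a :: topological_space c0"
  assumes dec: "\<And>x. decseq (\<lambda>n. c0_apply (f n) x)" and nonneg: "\<And>n x. 0 \<le> c0_apply (f n) x"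
    and lim: "\<And>x. (\<lambda>n. c0_apply (f n) x) \<longlonglongrightarrow> 0"
  shows "f \<longlonglongrightarrow> 0"
proof (rule LIMSEQ_I)
  fix e :: real assume "0 < e"
  then have e2: "0 < e / 2" by simp
  obtain K where K: "compact K" "\<And>x. x \<notin> K \<Longrightarrow> \<bar>c0_apply (f 0) x\<bar> < e / 2"
    using c0_apply_vanishes[OF e2] by blast
  let ?U = "\<lambda>n. {x. c0_apply (f n) x < e / 2}"
  have "\<exists>C'\<subseteq>UNIV. finite C' \<and> K \<subseteq> (\<Union>n\<in>C'. ?U n)"
  proof (rule compactE_image[OF K(1)])
    show "open (?U n)" for n
      by (intro open_Collect_less continuous_on_c0_apply continuous_on_const)
    have "\<exists>n. c0_apply (f n) x < e / 2" for x
    proof -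
      have "eventually (\<lambda>n. c0_apply (f n) x < e / 2) sequentially"
        using lim e2 by (rule order_tendstoD)
      then show ?thesis
        by (meson eventually_sequentially order_refl)
    qed
    then show "K \<subseteq> (\<Union>n\<in>UNIV. ?U n)"
      by auto
  qed blast
  then obtain C where C: "finite C" "K \<subseteq> (\<Union>n\<in>C. ?U n)"
    by blast
  \<comment> \<open>The index 0 joins the finite subcover to take care of the points outside
    K.\<close>
  have "norm (f n - 0) < e" if n: "Max (insert 0 C) \<le> n" for n
  proof -
    have "\<bar>c0_apply (f n) x\<bar> \<le> e / 2" for x
    proof -
      obtain k where k: "k \<in> insert 0 C" "c0_apply (f k) x < e / 2"
        using K(2)[of x] C(2) nonneg[of 0 x] by (cases "x \<in> K") auto
      have "k \<le> n"
        using Max_ge[OF _ k(1)] C(1) n by (meson finite_insert order_trans)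
      then have "c0_apply (f n) x \<le> c0_apply (f k) x"
        using dec by (simp add: decseq_def)
      then show ?thesis
        using k(2) nonneg[of n x] by simp
    qed
    then have "norm (f n) \<le> e / 2"
      by (rule norm_c0_le)
    then show ?thesis
      using \<open>0 < e\<close> by simp
  qed
  then show "\<exists>N. \<forall>n\<ge>N. norm (f n - 0) < e"
    by blast
qed

section \<open>The one-point compactification\<close>

lemma extend0_simps [simp]: "extend0 f None = 0" "extend0 f (Some x) = f x"
  by (simp_all add: extend0_def)

lemma space_cemetery_borel [simp]: "space cemetery_borel = UNIV"
  by (simp add: cemetery_borel_def space_measure_of_conv)

lemma sets_cemetery_borel: "sets cemetery_borel = sigma_sets UNIV {U. openin cemetery_topology U}"
  by (simp add: cemetery_borel_def sets_measure_of_conv)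

lemma sets_cemetery_borel_Some:
  assumes "B \<in> sets borel"
  shows "Some ` B \<in> sets cemetery_borel"
proof -
  have "B \<in> sigma_sets UNIV {S. open S}"
    using assms by (simp add: borel_def)
  then show ?thesis
  proof induction
    case (Basic S)
    then show ?case
      by (auto simp: sets_cemetery_borel)
  next
    case (Compl S)
    have "Some ` UNIV \<in> sets cemetery_borel"
      by (auto simp: sets_cemetery_borel)
    from sets.Diff[OF this Compl.IH] show ?case
      by (simp add: image_set_diff)
  next
    case (Union S)
    then show ?case
      by (auto simp: image_UN)
  qed simp
qed

lemma borel_measurable_extend0:
  fixes f :: "'a :: topological_space \<Rightarrow> 'b :: {topological_space, zero}"
  assumes f: "f \<in> borel_measurable borel"
  shows "extend0 f \<in> borel_measurable cemetery_borel"
proof (rule borel_measurableI)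
  fix S :: "'b set" assume "open S"
  then have 1: "Some ` (f -` S) \<in> sets cemetery_borel"
    using measurable_sets[OF f] by (intro sets_cemetery_borel_Some) auto
  have 2: "{None} \<in> sets (cemetery_borel :: 'a option measure)"
  proof -
    have "Some ` UNIV \<in> sets (cemetery_borel :: 'a option measure)"
      by (rule sets_cemetery_borel_Some) auto
    from sets.compl_sets[OF this] show ?thesis
      by (simp add: UNIV_option_conv insert_Diff_if)
  qed
  have "extend0 f -` S = Some ` (f -` S) \<union> (if 0 \<in> S then {None} else {})" (is "?l = ?r")
  proof (rule set_eqI)
    show "z \<in> ?l \<longleftrightarrow> z \<in> ?r" for z
      by (cases z) auto
  qed
  then show "extend0 f -` S \<inter> space cemetery_borel \<in> sets cemetery_borel"
    using 1 sets.Un[OF 1 2] by simp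
qed

lemma measurable_extend0_compose [measurable (raw)]:
  fixes f :: "'a :: topological_space \<Rightarrow> 'b :: {topological_space, zero}"
  assumes "f \<in> borel_measurable borel" "g \<in> measurable N cemetery_borel"
  shows "(\<lambda>w. extend0 f (g w)) \<in> borel_measurable N"
  by (rule measurable_compose[OF assms(2) borel_measurable_extend0[OF assms(1)]])

text \<open>Vanishing at infinity is continuity at the cemetery: when 0 lies in the open set S, the
  points sent outside S form a closed subset of a compact set.\<close>

lemma continuous_map_extend0_c0:
  fixes u :: "'a :: t2_space c0"
  shows "continuous_map cemetery_topology euclideanreal (extend0 (c0_apply u))"
  unfolding continuous_map_def
proof (intro conjI allI impI)
  fix S :: "real set" assume "openin euclideanreal S"
  then have S: "open S" by simp
  have cl: "open {x. c0_apply u x \<in> S}"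
    using open_vimage[OF S continuous_on_c0_apply[of UNIV u]] by (simp add: vimage_def)
  show "openin cemetery_topology {z \<in> topspace cemetery_topology. extend0 (c0_apply u) z \<in> S}"
  proof (cases "0 \<in> S")
    case True
    then obtain e where e: "0 < e" "ball 0 e \<subseteq> S"
      using S open_contains_ball by blast
    obtain K where K: "compact K" "\<And>x. x \<notin> K \<Longrightarrow> \<bar>c0_apply u x\<bar> < e"
      using c0_apply_vanishes[OF e(1)] by blast
    let ?C = "- {x. c0_apply u x \<in> S}"
    have "?C = K \<inter> ?C"
      using K(2) e(2) by (fastforce simp: subset_eq)
    moreover have "closed ?C"
      using cl by blast
    ultimately have "compact ?C"
      using K(1) by (metis compact_Int_closed)
    moreover have "{z \<in> topspace cemetery_topology. extend0 (c0_apply u) z \<in> S} =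
        insert None (Some ` (topspace euclidean - ?C))"
      (is "?l = ?r")
    proof (rule set_eqI)
      show "z \<in> ?l \<longleftrightarrow> z \<in> ?r" for z
        using True by (cases z) auto
    qed
    ultimately show ?thesis
      using \<open>closed ?C\<close> by (auto simp: openin_Alexandroff_compactification)
  next
    case False
    then have "{z \<in> topspace cemetery_topology. extend0 (c0_apply u) z \<in> S} =
        Some ` {x. c0_apply u x \<in> S}"
      by (auto simp: extend0_def split: option.splits)
    then show ?thesis
      using cl by simp
  qed
qed simp

lemma tendsto_extend0_c0:
  fixes u :: "'a :: t2_space c0"
  assumes "limitin cemetery_topology g l F"
  shows "((\<lambda>s. extend0 (c0_apply u) (g s)) \<longlongrightarrow> extend0 (c0_apply u) l) F"
  using continuous_map_limit[OF continuous_map_extend0_c0 assms] by (simp add: comp_def)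

lemma c0_function_positive_on_open:
  fixes W :: "'a :: metric_space set"
  assumes W: "open W" and K: "compact K" "W \<subseteq> K"
  obtains u where "W = {x. c0_apply u x \<noteq> 0}"
proof -
  \<comment> \<open>The distance to the empty set is 0 by convention, so W = UNIV, which forces a
    compact space, takes the constant 1 instead.\<close>
  let ?f = "\<lambda>x. if W = UNIV then 1 else infdist x (- W)"
  have "?f \<in> range c0_apply"
  proof (rule c0_functionI)
    show "continuous_on UNIV ?f"
      by (cases "W = UNIV") (auto intro!: continuous_intros)
    fix e :: real assume "0 < e"
    then have "\<bar>?f x\<bar> < e" if "x \<notin> K" for x
      using that K \<open>0 < e\<close> by (cases "W = UNIV") (auto simp: subset_eq intro!: infdist_zero)
    then show "\<exists>K. compact K \<and> (\<forall>x. x \<notin> K \<longrightarrow> \<bar>?f x\<bar> < e)"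
      using K(1) by blast
  qed
  then obtain u where u: "c0_apply u = ?f"
    by (metis image_iff)
  have "infdist x (- W) = 0 \<longleftrightarrow> x \<notin> W" if "W \<noteq> UNIV" for x
    using in_closed_iff_infdist_zero[of "- W" x] W that by auto
  then have "W = {x. c0_apply u x \<noteq> 0}"
    by (auto simp: u)
  then show ?thesis by (rule that)
qed

text \<open>C_0 functions generate the Borel sets of the compactification: relatively compact open
  sets are their nonvanishing sets, other open sets are countable unions of these, and
  neighbourhoods of the cemetery are complements. Measurability can thus be transferred to limits
  tested only against real functions of the path.\<close>

lemma measurable_cemeteryI:
  fixes f :: "'w \<Rightarrow> 'a :: {metric_space, second_countable_topology} option"
  assumes lc: "locally_compact_space (euclidean :: 'a topology)"
    and f: "\<And>u. (\<lambda>w. extend0 (c0_apply u) (f w)) \<in> borel_measurable N"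
  shows "f \<in> measurable N cemetery_borel"
proof -
  have small: "f -` (Some ` W) \<inter> space N \<in> sets N"
    if W: "open W" "compact K" "W \<subseteq> K" for W K :: "'a set"
  proof -
    obtain u where u: "W = {x. c0_apply u x \<noteq> 0}"
      using c0_function_positive_on_open[OF W] by blast
    have "f -` (Some ` W) \<inter> space N = {w \<in> space N. extend0 (c0_apply u) (f w) \<noteq> 0}"
      unfolding u by (auto simp: extend0_def split: option.splits)
    also have "\<dots> \<in> sets N"
      using f[of u] by measurable
    finally show ?thesis .
  qed
  have op: "f -` (Some ` U) \<inter> space N \<in> sets N" if U: "open U" for U :: "'a set"
  proof -
    \<comment> \<open>Local compactness makes these sets cover U, and second countability leaves
      countably many of them.\<close>
    let ?W = "{W. open W \<and> W \<subseteq> U \<and> (\<exists>K. compact K \<and> W \<subseteq> K)}"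
    obtain \<W> where \<W>: "\<W> \<subseteq> ?W" "countable \<W>" "\<Union>\<W> = \<Union>?W"
      by (rule Lindelof[of ?W]) auto
    have "U \<subseteq> \<Union>?W"
    proof
      fix x assume "x \<in> U"
      obtain V K where "open V" "compact K" "x \<in> V" "V \<subseteq> K"
        using lc by (simp add: locally_compact_space_def) blast
      then have "V \<inter> U \<in> ?W" "x \<in> V \<inter> U"
        using U \<open>x \<in> U\<close> by auto
      then show "x \<in> \<Union>?W" by blast
    qed
    then have "U = \<Union>\<W>"
      using \<W> by auto
    then have "f -` (Some ` U) \<inter> space N = (\<Union>W\<in>\<W>. f -` (Some ` W) \<inter> space N)"
      by auto
    also have "\<dots> \<in> sets N"
      using \<W> small by (intro sets.countable_UN'') auto
    finally show ?thesis .
  qed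
  show ?thesis
    unfolding cemetery_borel_def
  proof (rule measurable_measure_of)
    fix V :: "'a option set" assume "V \<in> {U. openin cemetery_topology U}"
    then consider U where "open U" "V = Some ` U"
      | C where "closed C" "V = insert None (Some ` (- C))"
      by (auto simp: openin_Alexandroff_compactification Compl_eq_Diff_UNIV)
    then show "f -` V \<inter> space N \<in> sets N"
    proof cases
      case 1
      then show ?thesis by (simp add: op)
    next
      case 2
      then have "f -` V \<inter> space N =
          space N - (f -` (Some ` UNIV) \<inter> space N - f -` (Some ` (- C)) \<inter> space N)"
        using not_None_eq by fastforce
      also have "\<dots> \<in> sets N"
        using 2 by (intro sets.Diff sets.top op) auto
      finally show ?thesis .
    qed
  qed auto
qed

section \<open>Riemann sums, exponentials and Laplace transforms\<close>

text \<open>On a piece K with tag s the error is the integral of f(s) - f(t) over t in K, and the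
  pieces add up. Letting the bound g depend on t is essential: a constant g serves continuous
  functions, while for the time-changed semigroup the integral of g becomes a potential.\<close>

lemma riemann_sum_error:
  fixes f :: "real \<Rightarrow> 'b :: banach"
  assumes f: "f integrable_on {a..b}" and g: "g integrable_on {a..b}"
    and p: "p tagged_division_of {a..b}" and mesh: "\<forall>(s, K)\<in>p. measure lborel K < d"
    and osc: "\<And>s t. s \<in> {a..b} \<Longrightarrow> t \<in> {a..b} \<Longrightarrow> \<bar>s - t\<bar> < d \<Longrightarrow> norm (f s - f t) \<le> g t"
  shows "norm ((\<Sum>(s, K)\<in>p. measure lborel K *\<^sub>R f s) - integral {a..b} f) \<le> integral {a..b} g"
proof -
  have p': "p tagged_division_of cbox a b"
    using p by simp
  have "(\<Sum>(s, K)\<in>p. measure lborel K *\<^sub>R f s) - integral {a..b} f =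
      (\<Sum>(s, K)\<in>p. measure lborel K *\<^sub>R f s - integral K f)"
    using integral_combine_tagged_division_topdown[OF _ p', of f] f
    by (simp add: sum_subtractf case_prod_unfold)
  also have "norm \<dots> \<le> (\<Sum>(s, K)\<in>p. integral K g)"
  proof (rule sum_norm_le, clarify)
    fix s K assume sK: "(s, K) \<in> p"
    obtain c e where K: "K = {c..e}"
      using tagged_division_ofD(4)[OF p' sK] by auto
    have s: "s \<in> {c..e}" and sub: "{c..e} \<subseteq> {a..b}"
      using tagged_division_ofD(2,3)[OF p' sK] K by auto
    have "measure lborel K < d"
      using mesh sK by auto
    then have small: "e - c < d"
      using s K by simp
    have "integral K (\<lambda>t. f s - f t) = integral K (\<lambda>t. f s) - integral K f"
      using integrable_subinterval_real[OF f sub] K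
      by (intro Henstock_Kurzweil_Integration.integral_diff) auto
    then have "measure lborel K *\<^sub>R f s - integral K f = integral K (\<lambda>t. f s - f t)"
      using K by simp
    also have "norm \<dots> \<le> integral K g"
    proof (rule integral_norm_bound_integral)
      show "(\<lambda>t. f s - f t) integrable_on K"
        using integrable_subinterval_real[OF f sub] K
        by (auto intro!: integrable_diff)
      show "g integrable_on K"
        using integrable_subinterval_real[OF g sub] K by simp
      fix t assume "t \<in> K"
      then show "norm (f s - f t) \<le> g t"
        using s sub small K by (intro osc) auto
    qed
    finally show "norm (measure lborel K *\<^sub>R f s - integral K f) \<le> integral K g" .
  qed
  also have "\<dots> = integral {a..b} g"
    using integral_combine_tagged_division_topdown[OF _ p', of g] g by simp
  finally show ?thesis .
qed

lemma has_riemann_integral_continuous: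
  fixes f :: "real \<Rightarrow> 'b :: banach"
  assumes f: "continuous_on {a..b} f" and "a \<le> b"
  shows "has_riemann_integral f (integral {a..b} f) a b"
  unfolding has_riemann_integral_def
proof (intro allI impI)
  fix e :: real assume "0 < e"
  \<comment> \<open>The summand 1 allows a = b and makes the final inequality strict.\<close>
  define c where "c = e / (b - a + 1)"
  have c: "0 < c" "c * (b - a) < e"
    using \<open>0 < e\<close> \<open>a \<le> b\<close> by (auto simp: c_def field_simps)
  have "uniformly_continuous_on {a..b} f"
    using f by (intro compact_uniformly_continuous) auto
  then obtain d where d: "0 < d"
    "\<And>s t. s \<in> {a..b} \<Longrightarrow> t \<in> {a..b} \<Longrightarrow> dist t s < d \<Longrightarrow> dist (f t) (f s) < c"
    using c(1) unfolding uniformly_continuous_on_def by metis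
  show "\<exists>d>0. \<forall>p. p tagged_division_of {a..b} \<and> (\<forall>(s, K)\<in>p. measure lborel K < d) \<longrightarrow>
      norm ((\<Sum>(s, K)\<in>p. measure lborel K *\<^sub>R f s) - integral {a..b} f) < e"
  proof (intro exI[of _ d] conjI allI impI d(1))
    fix p assume p: "p tagged_division_of {a..b} \<and> (\<forall>(s, K)\<in>p. measure lborel K < d)"
    have "norm ((\<Sum>(s, K)\<in>p. measure lborel K *\<^sub>R f s) - integral {a..b} f) \<le> integral {a..b} (\<lambda>_. c)"
    proof (rule riemann_sum_error)
      show "f integrable_on {a..b}"
        by (rule integrable_continuous_real[OF f])
      fix s t assume "s \<in> {a..b}" "t \<in> {a..b}" "\<bar>s - t\<bar> < d"
      then show "norm (f s - f t) \<le> c"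
        using d(2)[of t s] by (simp add: dist_norm less_imp_le)
    qed (use p in auto)
    also have "\<dots> < e"
      using c \<open>a \<le> b\<close> by (simp add: mult.commute)
    finally show "norm ((\<Sum>(s, K)\<in>p. measure lborel K *\<^sub>R f s) - integral {a..b} f) < e" .
  qed
qed

lemma nn_integral_exp_atLeast:
  fixes \<alpha> a :: real
  assumes "0 < \<alpha>"
  shows "(\<integral>\<^sup>+ t\<in>{a..}. ennreal (exp (- \<alpha> * t)) \<partial>lborel) = ennreal (exp (- \<alpha> * a) / \<alpha>)"
proof -
  have "(\<integral>\<^sup>+ t. ennreal (exp (- \<alpha> * t)) * indicator {a..} t \<partial>lborel) = 0 - (- exp (- \<alpha> * a) / \<alpha>)"
  proof (rule nn_integral_FTC_atLeast)
    show "((\<lambda>t. - exp (- \<alpha> * t) / \<alpha>) has_real_derivative exp (- \<alpha> * t)) (at t)" for t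
      using assms by (auto intro!: derivative_eq_intros)
    have "filterlim (\<lambda>t. - \<alpha> * t) at_bot at_top"
      by (rule filterlim_tendsto_neg_mult_at_bot[OF tendsto_const _ filterlim_ident]) (use assms in simp)
    then have "((\<lambda>t. exp (- \<alpha> * t)) \<longlongrightarrow> 0) at_top"
      by (rule filterlim_compose[OF exp_at_bot])
    then have "((\<lambda>t. - exp (- \<alpha> * t) / \<alpha>) \<longlongrightarrow> - 0 / \<alpha>) at_top"
      using assms by (intro tendsto_intros) auto
    then show "((\<lambda>t. - exp (- \<alpha> * t) / \<alpha>) \<longlongrightarrow> 0) at_top"
      by simp
  qed auto
  then show ?thesis by simp
qed

lemma set_integrable_exp:
  fixes \<alpha> a :: real
  assumes "0 < \<alpha>"
  shows "set_integrable lborel {a..} (\<lambda>t. exp (- \<alpha> * t))"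
    and "(LBINT t:{a..}. exp (- \<alpha> * t)) = exp (- \<alpha> * a) / \<alpha>"
proof -
  have *: "(\<integral>\<^sup>+ t. ennreal (indicat_real {a..} t *\<^sub>R exp (- \<alpha> * t)) \<partial>lborel) = ennreal (exp (- \<alpha> * a) / \<alpha>)"
    unfolding nn_integral_exp_atLeast[OF assms, of a, symmetric]
    by (intro nn_integral_cong) (auto simp: indicator_def)
  have "has_bochner_integral lborel (\<lambda>t. indicat_real {a..} t *\<^sub>R exp (- \<alpha> * t)) (exp (- \<alpha> * a) / \<alpha>)"
    by (rule has_bochner_integral_nn_integral[OF _ _ _ *]) (use assms in auto)
  then show "set_integrable lborel {a..} (\<lambda>t. exp (- \<alpha> * t))"
    and "(LBINT t:{a..}. exp (- \<alpha> * t)) = exp (- \<alpha> * a) / \<alpha>"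
    unfolding set_integrable_def set_lebesgue_integral_def by (auto simp: has_bochner_integral_iff)
qed

lemma set_integrable_exp_mult:
  fixes \<phi> :: "real \<Rightarrow> real"
  assumes "0 < \<alpha>" and [measurable]: "\<phi> \<in> borel_measurable borel" and "\<And>t. \<bar>\<phi> t\<bar> \<le> c"
  shows "set_integrable lborel {a..} (\<lambda>t. exp (- \<alpha> * t) * \<phi> t)"
proof (rule set_integrable_bound)
  show "set_integrable lborel {a..} (\<lambda>t. c * exp (- \<alpha> * t))"
    using set_integrable_exp(1)[OF assms(1)] by simp
  show "set_borel_measurable lborel {a..} (\<lambda>t. exp (- \<alpha> * t) * \<phi> t)"
    unfolding set_borel_measurable_def by measurable
  have "0 \<le> c"
    using assms(3)[of 0] by simp
  then show "AE t in lborel. t \<in> {a..} \<longrightarrow> norm (exp (- \<alpha> * t) * \<phi> t) \<le> norm (c * exp (- \<alpha> * t))"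
    using assms(3) by (auto simp: abs_mult intro!: mult_left_mono)
qed

text \<open>Substituting \<open>z = e\<^sup>-\<^sup>s\<close> turns the approximation in \<open>L\<^sup>1\<close> into uniform polynomial
  approximation on \<open>[0, 1]\<close>; all exponents are positive because \<open>1 / z\<close> is split off.\<close>

lemma indicator_exp_approximation:
  assumes "0 \<le> T" "0 < e"
  obtains a :: "nat \<Rightarrow> real" and n where
    "(\<integral>\<^sup>+ s\<in>{0..}. ennreal \<bar>indicat_real {0..T} s - (\<Sum>i\<le>n. a i * exp (- real (Suc i) * s))\<bar> \<partial>lborel)
      \<le> ennreal e"
proof -
  define d where "d = e / 2"
  have d: "0 < d" using assms by (simp add: d_def)
  \<comment> \<open>A continuous cutoff, 1 up to T and 0 from T + d on. It differs from the
    indicator only on [T, T + d], which costs d; the uniform approximation below costs d times the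
    integral of exp(-s), again d. Hence d = e / 2.\<close>
  define c where "c s = max 0 (min 1 ((T + d - s) / d))" for s
  define z where "z = exp (- (T + d))"
  \<comment> \<open>The cutoff in the variable y = exp(-s), divided by y. It vanishes on [0, z], so
    the division is harmless and k is continuous on [0, 1].\<close>
  define k where "k y = (if y \<le> z then 0 else c (- ln y) / y)" for y
  have z: "0 < z" "z \<le> 1"
    using assms d by (auto simp: z_def)
  have cont_c: "continuous_on A c" for A
    unfolding c_def using d by (intro continuous_intros) auto
  have "continuous_on ({..z} \<union> {z..}) k"
    unfolding k_def
  proof (rule continuous_on_If)
    show "continuous_on {z..} (\<lambda>y. c (- ln y) / y)"
      using z by (intro continuous_intros continuous_on_compose2[OF cont_c]) auto
    show "0 = c (- ln y) / y" if "y \<in> {z..}" "y \<le> z" for y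
      using that d by (auto simp: z_def c_def)
  qed auto
  then have "continuous_on {0..1} k"
    by (rule continuous_on_subset) auto
  then obtain g where g: "real_polynomial_function g" "\<And>y. y \<in> {0..1} \<Longrightarrow> \<bar>k y - g y\<bar> < d"
    using Stone_Weierstrass_real_polynomial_function[OF compact_Icc _ d] by metis
  obtain a n where an: "g = (\<lambda>y. \<Sum>i\<le>n. a i * y ^ i)"
    using real_polynomial_function_imp_sum[OF g(1)] by blast
  have sum_eq: "(\<Sum>i\<le>n. a i * exp (- real (Suc i) * s)) = exp (- s) * g (exp (- s))" for s
    unfolding an sum_distrib_left
    by (intro sum.cong refl) (simp add: exp_of_nat_mult[symmetric] exp_add[symmetric] algebra_simps)
  have c_approx: "\<bar>c s - exp (- s) * g (exp (- s))\<bar> \<le> d * exp (- s)" if "0 \<le> s" for s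
  proof -
    have "c s = exp (- s) * k (exp (- s))"
    proof (cases "exp (- s) \<le> z")
      case True
      then have "(T + d - s) / d \<le> 0"
        using d by (intro divide_nonpos_pos) (auto simp: z_def)
      then show ?thesis
        using True by (simp add: k_def c_def)
    qed (simp add: k_def)
    then have "c s - exp (- s) * g (exp (- s)) = exp (- s) * (k (exp (- s)) - g (exp (- s)))"
      by (simp add: algebra_simps)
    then have "\<bar>c s - exp (- s) * g (exp (- s))\<bar> = exp (- s) * \<bar>k (exp (- s)) - g (exp (- s))\<bar>"
      by (simp add: abs_mult)
    also have "\<dots> \<le> exp (- s) * d"
      using g(2)[of "exp (- s)"] that by (intro mult_left_mono) auto
    finally show ?thesis by (simp add: mult.commute)
  qed
  have c_ind: "\<bar>indicat_real {0..T} s - c s\<bar> \<le> indicat_real {T..T + d} s" if "0 \<le> s" for s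
    using that d by (auto simp: c_def indicator_def field_simps min_def max_def)
  have "(\<integral>\<^sup>+ s\<in>{0..}. ennreal \<bar>indicat_real {0..T} s - (\<Sum>i\<le>n. a i * exp (- real (Suc i) * s))\<bar> \<partial>lborel)
      \<le> (\<integral>\<^sup>+ s. indicator {T..T + d} s + ennreal d * (ennreal (exp (- 1 * s)) * indicator {0..} s) \<partial>lborel)"
  proof (rule nn_integral_mono)
    fix s :: real
    show "ennreal \<bar>indicat_real {0..T} s - (\<Sum>i\<le>n. a i * exp (- real (Suc i) * s))\<bar> * indicator {0..} s
        \<le> indicator {T..T + d} s + ennreal d * (ennreal (exp (- 1 * s)) * indicator {0..} s)"
    proof (cases "0 \<le> s")
      case True
      have "\<bar>indicat_real {0..T} s - (\<Sum>i\<le>n. a i * exp (- real (Suc i) * s))\<bar>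
          \<le> indicat_real {T..T + d} s + d * exp (- s)"
        unfolding sum_eq using c_ind[OF True] c_approx[OF True] by linarith
      then have "ennreal \<bar>indicat_real {0..T} s - (\<Sum>i\<le>n. a i * exp (- real (Suc i) * s))\<bar>
          \<le> ennreal (indicat_real {T..T + d} s + d * exp (- s))"
        by (rule ennreal_leI)
      also have "\<dots> = indicator {T..T + d} s + ennreal d * ennreal (exp (- s))"
        using d by (subst ennreal_plus) (auto simp: ennreal_mult ennreal_indicator)
      finally show ?thesis
        using True by simp
    qed simp
  qed
  also have "\<dots> = ennreal d + ennreal d * ennreal 1"
    using d nn_integral_exp_atLeast[of 1 0] by (simp add: nn_integral_add nn_integral_cmult)
  also have "\<dots> = ennreal e"
    using d by (simp add: d_def ennreal_plus[symmetric] del: ennreal_plus)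
  finally show ?thesis by (rule that)
qed

section \<open>Fubini identities for Laplace transforms\<close>

lemma integrable_lborel_pair_mult:
  fixes f g :: "real \<Rightarrow> real"
  assumes f: "integrable lborel f" and g: "integrable lborel g"
  shows "integrable (lborel \<Otimes>\<^sub>M lborel) (\<lambda>(x, y). f x * g y)"
proof (rule lborel_pair.Fubini_integrable)
  have [measurable]: "f \<in> borel_measurable lborel" "g \<in> borel_measurable lborel"
    using f g by auto
  show "(\<lambda>(x, y). f x * g y) \<in> borel_measurable (lborel \<Otimes>\<^sub>M lborel)"
    by measurable
  show "integrable lborel (\<lambda>x. LINT y|lborel. norm (case (x, y) of (x, y) \<Rightarrow> f x * g y))"
    using f g by (simp add: abs_mult)
  show "AE x in lborel. integrable lborel (\<lambda>y. case (x, y) of (x, y) \<Rightarrow> f x * g y)"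
    using g by simp
qed

text \<open>Fubini on the region 0 \<le> s \<le> r, where the inner integral of exp(-\<gamma> s)
  over [0, r] is (1 - exp(-\<gamma> r)) / \<gamma>. With \<gamma> = \<beta> - \<alpha> this is the
  analytic half of the resolvent equation.\<close>

lemma laplace_tail_integral:
  fixes h :: "real \<Rightarrow> real"
  assumes \<gamma>: "0 < \<gamma>" and h: "set_integrable lborel {0..} h"
  shows "(LBINT s:{0..}. exp (- \<gamma> * s) * (LBINT r:{s..}. h r)) =
    ((LBINT r:{0..}. h r) - (LBINT r:{0..}. exp (- \<gamma> * r) * h r)) / \<gamma>"
proof -
  define g where "g r = indicat_real {0..} r * h r" for r
  let ?e = "\<lambda>s. indicat_real {0..} s * exp (- \<gamma> * s)"
  have h': "integrable lborel g"
    using h by (simp add: set_integrable_def g_def[abs_def])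
  have e': "integrable lborel ?e"
    using set_integrable_exp(1)[OF \<gamma>] by (simp add: set_integrable_def)
  have [measurable]: "g \<in> borel_measurable borel"
    using borel_measurable_integrable[OF h'] by simp
  let ?k = "\<lambda>(s, r). indicat_real {s..} r * ?e s * g r"
  have k: "integrable (lborel \<Otimes>\<^sub>M lborel) ?k"
  proof (rule Bochner_Integration.integrable_bound[OF integrable_lborel_pair_mult[OF e' h']])
    have "Measurable.pred (lborel \<Otimes>\<^sub>M lborel) (\<lambda>x :: real \<times> real. fst x \<le> snd x)"
      by measurable
    then show "?k \<in> borel_measurable (lborel \<Otimes>\<^sub>M lborel)"
      unfolding indicator_def case_prod_unfold atLeast_iff by measurable
    show "AE x in lborel \<Otimes>\<^sub>M lborel. norm (?k x) \<le> norm (case x of (x, y) \<Rightarrow> ?e x * g y)"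
      by (auto simp: indicator_def abs_mult)
  qed
  have "(LBINT s:{0..}. exp (- \<gamma> * s) * (LBINT r:{s..}. h r)) = (LBINT s. LBINT r. ?k (s, r))"
    unfolding set_lebesgue_integral_def
  proof (intro Bochner_Integration.integral_cong refl)
    fix s :: real
    have "indicat_real {0..} s *\<^sub>R (exp (- \<gamma> * s) * (LBINT r. indicat_real {s..} r *\<^sub>R h r)) =
        (LBINT r. ?e s * (indicat_real {s..} r *\<^sub>R h r))"
      by simp
    also have "\<dots> = (LBINT r. ?k (s, r))"
      by (intro Bochner_Integration.integral_cong refl) (auto simp: indicator_def g_def)
    finally show "indicat_real {0..} s *\<^sub>R (exp (- \<gamma> * s) * (LBINT r. indicat_real {s..} r *\<^sub>R h r)) =
        (LBINT r. ?k (s, r))" .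
  qed
  also have "\<dots> = (LBINT r. LBINT s. ?k (s, r))"
    using lborel_pair.Fubini_integral[of "\<lambda>s r. ?k (s, r)"] k by simp
  also have "\<dots> = (LBINT r. (g r - indicat_real {0..} r * (exp (- \<gamma> * r) * h r)) / \<gamma>)"
  proof (intro Bochner_Integration.integral_cong refl)
    fix r :: real
    have "(LBINT s. ?k (s, r)) = (LBINT s. g r * (indicat_real {0..} s * exp (- \<gamma> * s) - indicat_real {r..} s * exp (- \<gamma> * s)))"
      if "0 \<le> r"
    proof (rule integral_cong_AE)
      \<comment> \<open>Both half-lines contain r, so the identity may fail at the single point s =
        r.\<close>
      show "AE s in lborel. ?k (s, r) = g r * (indicat_real {0..} s * exp (- \<gamma> * s) - indicat_real {r..} s * exp (- \<gamma> * s))"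
        by (rule AE_mp[OF AE_lborel_singleton[of r]])
          (use that in \<open>auto simp: indicator_def\<close>)
    qed (auto simp: indicator_def atLeast_def)
    moreover have "(LBINT s. indicat_real {0..} s * exp (- \<gamma> * s) - indicat_real {r..} s * exp (- \<gamma> * s)) =
        1 / \<gamma> - exp (- \<gamma> * r) / \<gamma>"
      using set_integrable_exp[OF \<gamma>, of 0] set_integrable_exp[OF \<gamma>, of r]
      by (simp add: set_integrable_def set_lebesgue_integral_def Bochner_Integration.integral_diff)
    ultimately have "(LBINT s. ?k (s, r)) = g r * (1 / \<gamma> - exp (- \<gamma> * r) / \<gamma>)" if "0 \<le> r"
      using that by (simp only: integral_mult_right_zero)
    then show "(LBINT s. ?k (s, r)) =
        (g r - indicat_real {0..} r * (exp (- \<gamma> * r) * h r)) / \<gamma>"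
      by (cases "0 \<le> r") (simp_all add: g_def diff_divide_distrib right_diff_distrib mult.commute)
  qed
  also have "\<dots> = ((LBINT r:{0..}. h r) - (LBINT r:{0..}. exp (- \<gamma> * r) * h r)) / \<gamma>"
  proof -
    have "integrable lborel (\<lambda>r. indicat_real {0..} r * (exp (- \<gamma> * r) * h r))"
    proof (rule Bochner_Integration.integrable_bound[OF h'])
      have "(\<lambda>r. exp (- \<gamma> * r) * g r) \<in> borel_measurable lborel"
        by measurable
      then show "(\<lambda>r. indicat_real {0..} r * (exp (- \<gamma> * r) * h r)) \<in> borel_measurable lborel"
        by (simp add: mult.left_commute g_def)
      show "AE r in lborel. norm (indicat_real {0..} r * (exp (- \<gamma> * r) * h r)) \<le> norm (g r)"
        using \<gamma> by (intro AE_I2) (auto simp: g_def indicator_def abs_mult mult_le_cancel_right2)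
    qed
    then show ?thesis
      using h' by (simp add: set_lebesgue_integral_def g_def[abs_def])
  qed
  finally show ?thesis .
qed

text \<open>Fubini on 0 \<le> r \<le> t, with inner integral exp(-\<alpha> r) / \<alpha>. Applied to
  P_r u(x), it links the resolvent to the time integrals of the semigroup.\<close>

lemma laplace_integral:
  fixes \<phi> :: "real \<Rightarrow> real"
  assumes \<alpha>: "0 < \<alpha>" and [measurable]: "\<phi> \<in> borel_measurable borel" and c: "\<And>t. \<bar>\<phi> t\<bar> \<le> c"
  shows "\<alpha> * (LBINT t:{0..}. exp (- \<alpha> * t) * (LBINT r:{0..t}. \<phi> r)) = (LBINT r:{0..}. exp (- \<alpha> * r) * \<phi> r)"
proof -
  \<comment> \<open>Half the rate goes to each variable: for r \<le> t, exp(-\<alpha> t) is at most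
    the product of exp(-\<alpha> t / 2) and exp(-\<alpha> r / 2), which is integrable on the
    quadrant.\<close>
  let ?e = "\<lambda>s. indicat_real {0..} s * exp (- (\<alpha> / 2) * s)"
  have e': "integrable lborel ?e"
    using set_integrable_exp(1)[of "\<alpha> / 2"] \<alpha> by (simp add: set_integrable_def)
  let ?k = "\<lambda>(t, r). indicat_real {0..} r * indicat_real {r..} t * exp (- \<alpha> * t) * \<phi> r"
  have k: "integrable (lborel \<Otimes>\<^sub>M lborel) ?k"
  proof (rule Bochner_Integration.integrable_bound)
    show "integrable (lborel \<Otimes>\<^sub>M lborel) (\<lambda>x. c * (case x of (s, r) \<Rightarrow> ?e s * ?e r))"
      by (intro integrable_mult_right integrable_lborel_pair_mult e')
    have "Measurable.pred (lborel \<Otimes>\<^sub>M lborel) (\<lambda>x :: real \<times> real. snd x \<le> fst x)"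
      by measurable
    then show "?k \<in> borel_measurable (lborel \<Otimes>\<^sub>M lborel)"
      unfolding indicator_def case_prod_unfold atLeast_iff by measurable
    have "norm (?k (t, r)) \<le> norm (c * (?e t * ?e r))" for t r
    proof (cases "0 \<le> r \<and> r \<le> t")
      case True
      have "exp (- \<alpha> * t) \<le> exp (- (\<alpha> / 2) * t) * exp (- (\<alpha> / 2) * r)"
        unfolding exp_add[symmetric] using True \<alpha> by (auto simp: field_simps)
      then have "exp (- \<alpha> * t) * \<bar>\<phi> r\<bar> \<le> exp (- (\<alpha> / 2) * t) * exp (- (\<alpha> / 2) * r) * c"
        using c[of r] by (intro mult_mono) auto
      then show ?thesis
        using True c[of r] by (auto simp: indicator_def abs_mult mult_ac)
    next
      case False
      then show ?thesis by (auto simp: indicator_def)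
    qed
    then show "AE x in lborel \<Otimes>\<^sub>M lborel. norm (?k x) \<le> norm (c * (case x of (s, r) \<Rightarrow> ?e s * ?e r))"
      by auto
  qed
  have "(LBINT t:{0..}. exp (- \<alpha> * t) * (LBINT r:{0..t}. \<phi> r)) = (LBINT t. LBINT r. ?k (t, r))"
    unfolding set_lebesgue_integral_def
  proof (intro Bochner_Integration.integral_cong refl)
    fix t :: real
    have "indicat_real {0..} t *\<^sub>R (exp (- \<alpha> * t) * (LBINT r. indicat_real {0..t} r *\<^sub>R \<phi> r)) =
        (LBINT r. (indicat_real {0..} t * exp (- \<alpha> * t)) * (indicat_real {0..t} r *\<^sub>R \<phi> r))"
      by simp
    also have "\<dots> = (LBINT r. ?k (t, r))"
      by (intro Bochner_Integration.integral_cong refl) (auto simp: indicator_def)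
    finally show "indicat_real {0..} t *\<^sub>R (exp (- \<alpha> * t) * (LBINT r. indicat_real {0..t} r *\<^sub>R \<phi> r)) =
        (LBINT r. ?k (t, r))" .
  qed
  also have "\<dots> = (LBINT r. LBINT t. ?k (t, r))"
    using lborel_pair.Fubini_integral[of "\<lambda>s r. ?k (s, r)"] k by simp
  also have "\<dots> = (LBINT r. indicat_real {0..} r * (exp (- \<alpha> * r) * \<phi> r) / \<alpha>)"
  proof (intro Bochner_Integration.integral_cong refl)
    fix r :: real
    have "(LBINT t. ?k (t, r)) = (LBINT t. (indicat_real {0..} r * \<phi> r) * (indicat_real {r..} t * exp (- \<alpha> * t)))"
      by (intro Bochner_Integration.integral_cong refl) auto
    also have "\<dots> = (indicat_real {0..} r * \<phi> r) * (exp (- \<alpha> * r) / \<alpha>)"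
      using set_integrable_exp(2)[OF \<alpha>, of r] by (simp add: set_lebesgue_integral_def)
    finally show "(LBINT t. ?k (t, r)) = indicat_real {0..} r * (exp (- \<alpha> * r) * \<phi> r) / \<alpha>"
      by simp
  qed
  finally show ?thesis
    using \<alpha> by (simp add: set_lebesgue_integral_def)
qed

section \<open>The strong Markov property for functionals of the path\<close>

text \<open>The list holds time increments, not absolute times, so that one step of the recursion
  amounts to adding a constant to a stopping time.\<close>

primrec cylinder ::
    "(ennreal \<Rightarrow> 'w \<Rightarrow> 'z) \<Rightarrow> (ennreal \<times> 'z set) list \<Rightarrow> ennreal \<Rightarrow> 'w \<Rightarrow> ennreal" where
  "cylinder X [] s \<omega> = 1"
| "cylinder X (tB # l) s \<omega> = indicator (snd tB) (X (s + fst tB) \<omega>) * cylinder X l (s + fst tB) \<omega>"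

text \<open>The iterated transition integrals, that is, the expectation of the cylinder functional
  for the process started at y; \<open>nn_integral_cylinder\<close> confirms this.\<close>

primrec cylinder_kernel ::
    "(ennreal \<Rightarrow> 'w \<Rightarrow> 'z) \<Rightarrow> ('z \<Rightarrow> 'w measure) \<Rightarrow> (ennreal \<times> 'z set) list \<Rightarrow> 'z \<Rightarrow> ennreal" where
  "cylinder_kernel X P [] y = 1"
| "cylinder_kernel X P (tB # l) y =
    (\<integral>\<^sup>+ \<omega>. indicator (snd tB) (X (fst tB) \<omega>) * cylinder_kernel X P l (X (fst tB) \<omega>) \<partial>P y)"

definition cylinder_sets :: "(ennreal \<Rightarrow> 'w \<Rightarrow> 'x :: topological_space option) \<Rightarrow> 'w set set" where
  "cylinder_sets X = {{\<omega>. \<forall>t\<in>I. X t \<omega> \<in> B t} | I B.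
    finite I \<and> (\<forall>t. B t \<in> sets cemetery_borel)}"

lemma Int_stable_cylinder_sets:
  fixes X :: "ennreal \<Rightarrow> 'w \<Rightarrow> 'x :: topological_space option"
  shows "Int_stable (cylinder_sets X)"
proof (rule Int_stableI)
  fix C D assume "C \<in> cylinder_sets X" "D \<in> cylinder_sets X"
  then obtain I B J B' where *: "finite I" "\<And>t. B t \<in> sets cemetery_borel"
      "C = {\<omega>. \<forall>t\<in>I. X t \<omega> \<in> B t}" "finite J" "\<And>t. B' t \<in> sets cemetery_borel"
      "D = {\<omega>. \<forall>t\<in>J. X t \<omega> \<in> B' t}"
    unfolding cylinder_sets_def by blast
  \<comment> \<open>Outside its index set a family of constraints is replaced by the whole space, so
    that both families live on the union of the index sets.\<close>
  define E where "E t = (if t \<in> I then B t else UNIV) \<inter> (if t \<in> J then B' t else UNIV)" for t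
  have "\<forall>t. E t \<in> sets cemetery_borel"
    unfolding E_def using *(2,5) sets.top[of "cemetery_borel :: 'x option measure"] by auto
  moreover have "C \<inter> D = {\<omega>. \<forall>t\<in>I \<union> J. X t \<omega> \<in> E t}"
    unfolding *(3,6) E_def by auto
  moreover have "finite (I \<union> J)"
    using *(1,4) by simp
  ultimately show "C \<inter> D \<in> cylinder_sets X"
    unfolding cylinder_sets_def mem_Collect_eq by (intro exI conjI)
qed

text \<open>Sorting makes the differences of consecutive times genuine increments: s + (t - s) = t
  holds in \<open>ennreal\<close> only for s \<le> t.\<close>

lemma cylinder_of_sorted:
  assumes "sorted ts" "\<And>t. t \<in> set ts \<Longrightarrow> s \<le> t" "\<And>t. B t \<in> sets cemetery_borel"
  shows "\<exists>l. (\<forall>(t, B)\<in>set l. B \<in> sets cemetery_borel) \<and>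
    (\<forall>\<omega>. cylinder X l s \<omega> = indicator {\<omega>. \<forall>t\<in>set ts. X t \<omega> \<in> B t} \<omega>)"
  using assms(1,2)
proof (induction ts arbitrary: s)
  case Nil
  then show ?case by (intro exI[of _ "[]"]) auto
next
  case (Cons t ts)
  then have "sorted ts" "\<And>t'. t' \<in> set ts \<Longrightarrow> t \<le> t'"
    by auto
  from Cons.IH[OF this] obtain l where l: "\<forall>(t, B)\<in>set l. B \<in> sets cemetery_borel"
      "\<And>\<omega>. cylinder X l t \<omega> = indicator {\<omega>. \<forall>t\<in>set ts. X t \<omega> \<in> B t} \<omega>"
    by blast
  have eq: "s + (t - s) = t"
    using Cons.prems(2)[of t] diff_add_cancel_ennreal[of s t] by (simp add: add.commute)
  have "cylinder X ((t - s, B t) # l) s \<omega> = indicator (B t) (X t \<omega>) * cylinder X l t \<omega>" for \<omega>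
    by (simp only: cylinder.simps fst_conv snd_conv eq)
  then have "cylinder X ((t - s, B t) # l) s \<omega> = indicator {\<omega>. \<forall>t\<in>set (t # ts). X t \<omega> \<in> B t} \<omega>" for \<omega>
    unfolding l(2) by (auto simp: indicator_def)
  moreover have "\<forall>(t, B)\<in>set ((t - s, B t) # l). B \<in> sets cemetery_borel"
    using l assms(3)[of t] by simp
  ultimately show ?case by blast
qed

lemma sets_raw_filtration:
  "sets (raw_filtration X t) = sigma_sets UNIV {X s -` B | s B. s \<le> t \<and> B \<in> sets cemetery_borel}"
  by (simp add: raw_filtration_def sets_measure_of_conv)

lemma space_raw_filtration [simp]: "space (raw_filtration X t) = UNIV"
  by (simp add: raw_filtration_def space_measure_of_conv)

lemma space_augmented_filtration [simp]: "space (augmented_filtration X P t) = UNIV"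
  by (simp add: augmented_filtration_def space_measure_of_conv)

lemma measurable_raw_filtration: "s \<le> t \<Longrightarrow> X s \<in> measurable (raw_filtration X t) cemetery_borel"
  by (rule measurableI) (auto simp: sets_raw_filtration)

lemma sets_raw_filtration_cylinder_sets:
  "sets (raw_filtration X \<infinity>) = sigma_sets UNIV (cylinder_sets X)"
proof (rule antisym)
  have "X s -` B \<in> cylinder_sets X" if "B \<in> sets cemetery_borel" for s B
    using that unfolding cylinder_sets_def by (auto intro!: exI[of _ "{s}"] exI[of _ "\<lambda>_. B"])
  then show "sets (raw_filtration X \<infinity>) \<subseteq> sigma_sets UNIV (cylinder_sets X)"
    unfolding sets_raw_filtration by (intro sigma_sets_mono) auto
  have "{\<omega>. \<forall>t\<in>I. X t \<omega> \<in> B t} \<in> sets (raw_filtration X \<infinity>)"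
    if "finite I" "\<And>t. B t \<in> sets cemetery_borel" for I B
  proof -
    have "{\<omega> \<in> space (raw_filtration X \<infinity>). \<forall>t\<in>I. X t \<omega> \<in> B t} \<in> sets (raw_filtration X \<infinity>)"
      using that measurable_sets[OF measurable_raw_filtration[of _ \<infinity> X]]
      by (intro sets.sets_Collect_finite_All) (auto simp: vimage_def)
    then show ?thesis by simp
  qed
  then have "cylinder_sets X \<subseteq> sets (raw_filtration X \<infinity>)"
    unfolding cylinder_sets_def by auto
  from sets.sigma_sets_subset[OF this]
  show "sigma_sets UNIV (cylinder_sets X) \<subseteq> sets (raw_filtration X \<infinity>)"
    by simp
qed

lemma sets_augmented_filtrationI:
  assumes "\<And>\<nu>. prob_space \<nu> \<Longrightarrow> sets \<nu> = sets cemetery_borel \<Longrightarrow>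
    \<exists>\<Lambda>'\<in>sets (raw_filtration X t). \<exists>N\<in>sets (raw_filtration X \<infinity>).
        (\<Lambda> - \<Lambda>') \<union> (\<Lambda>' - \<Lambda>) \<subseteq> N \<and> (\<integral>\<^sup>+ x. emeasure (P x) N \<partial>\<nu>) = 0"
  shows "\<Lambda> \<in> sets (augmented_filtration X P t)"
  unfolding augmented_filtration_def sets_measure_of_conv
  using assms by (auto intro!: sigma_sets.Basic)

lemma sets_raw_le_augmented: "sets (raw_filtration X t) \<subseteq> sets (augmented_filtration X P t)"
proof
  fix \<Lambda> assume "\<Lambda> \<in> sets (raw_filtration X t)"
  then show "\<Lambda> \<in> sets (augmented_filtration X P t)"
    by (intro sets_augmented_filtrationI bexI[of _ \<Lambda>] bexI[of _ "{}"]) auto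
qed

context standard_process
begin

lemma space_P [simp]: "space (P x) = UNIV"
  using sets_eq_imp_space_eq[OF sets_P] space_M by simp

lemma measurable_P_iff: "f \<in> measurable (P x) N \<longleftrightarrow> f \<in> measurable M N"
  by (intro eqTrueI[THEN eq_reflection, THEN meta_eq_to_obj_eq] arg_cong2[where f = "(\<in>)"] refl
      measurable_cong_sets sets_P)

lemma sets_augmented_le_M: "sets (augmented_filtration X P t) \<subseteq> sets M"
  using augmented sets_F by blast

lemma sets_raw_le_M: "sets (raw_filtration X t) \<subseteq> sets M"
  using sets_raw_le_augmented[of X t P] sets_augmented_le_M by blast

lemma measurable_F_M: "f \<in> measurable (F t) N \<Longrightarrow> f \<in> measurable M N"
  using sets_F[of t] space_F[of t] space_M by (auto simp: measurable_def)

lemma measurable_X [measurable]: "X t \<in> measurable M cemetery_borel"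
  by (rule measurable_F_M[OF adapted])

lemma sets_pre_sigma_le_M:
  assumes "stopping_time F T"
  shows "sets (pre_sigma T) \<subseteq> sets M"
  using sets_pre_sigmaD[OF assms, of _ \<infinity>] sets_F by fastforce

lemma measurable_X_stopping_time:
  assumes "stopping_time F T"
  shows "(\<lambda>\<omega>. X (T \<omega>) \<omega>) \<in> measurable M cemetery_borel"
  using strong_measurable[OF assms] sets_pre_sigma_le_M[OF assms] space_M
  by (auto simp: measurable_def space_pre_sigma)

text \<open>For finite t \<le> r the event T + t \<le> r is T \<le> r - t, which is known at a time
  before r. Otherwise it holds exactly if r = \<infinity> and does not depend on the path.\<close>

lemma stopping_time_add_const:
  assumes T: "stopping_time F T"
  shows "stopping_time F (\<lambda>\<omega>. T \<omega> + t)"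
proof (rule stopping_timeI)
  fix r :: ennreal
  show "Measurable.pred (F r) (\<lambda>\<omega>. T \<omega> + t \<le> r)"
  proof (cases "t < \<infinity> \<and> t \<le> r")
    case True
    then have "T \<omega> + t \<le> r \<longleftrightarrow> T \<omega> \<le> r - t" for \<omega>
      by (cases t; cases r; cases "T \<omega>") (auto simp: ennreal_minus ennreal_plus[symmetric] top_unique simp del: ennreal_plus)
    then show ?thesis
      using stopping_time_le_const[OF T, of "r - t" r] by (simp add: diff_le_self_ennreal)
  next
    case False
    have "T \<omega> + t \<le> r \<longleftrightarrow> r = \<infinity>" for \<omega>
    proof -
      consider "t = \<infinity>" | "\<not> t \<le> r"
        using False by (auto simp: less_top[symmetric])
      then show ?thesis
      proof cases
        case 2
        moreover have "t \<le> T \<omega> + t"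
          by (simp add: add_increasing)
        ultimately have "r < T \<omega> + t"
          by (metis not_le order_less_le_trans)
        then show ?thesis
          using 2 by (auto simp: not_le)
      qed (auto simp: top_unique)
    qed
    then show ?thesis by simp
  qed
qed

text \<open>The transition function as a kernel in the Giry monad, so that the Markov property can
  be stated with \<open>bind\<close>.\<close>

definition transition :: "ennreal \<Rightarrow> 'x option \<Rightarrow> 'x option measure" where
  "transition t y = distr (P y) cemetery_borel (X t)"

lemma measurable_transition [measurable]:
  "transition t \<in> measurable cemetery_borel (subprob_algebra cemetery_borel)"
proof (rule measurable_subprob_algebra)
  fix y :: "'x option"
  interpret prob_space "P y" by (rule prob_P)
  show "subprob_space (transition t y)"
    unfolding transition_def
    by (intro prob_space_imp_subprob_space prob_space_distr) (simp add: measurable_P_iff)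
next
  fix B :: "'x option set" assume "B \<in> sets cemetery_borel"
  then show "(\<lambda>y. emeasure (transition t y) B) \<in> borel_measurable cemetery_borel"
    using kernel[of B t] by (simp add: transition_def emeasure_distr measurable_P_iff vimage_def)
qed (simp add: transition_def)

lemma nn_integral_transition:
  "f \<in> borel_measurable cemetery_borel \<Longrightarrow> (\<integral>\<^sup>+ z. f z \<partial>transition t y) = (\<integral>\<^sup>+ \<omega>. f (X t \<omega>) \<partial>P y)"
  by (simp add: transition_def nn_integral_distr measurable_P_iff)

lemma measurable_nn_integral_X [measurable]:
  assumes [measurable]: "f \<in> borel_measurable cemetery_borel"
  shows "(\<lambda>y. \<integral>\<^sup>+ \<omega>. f (X t \<omega>) \<partial>P y) \<in> borel_measurable cemetery_borel"
  unfolding nn_integral_transition[OF assms, symmetric] by measurable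

text \<open>The axiom speaks of events X_{T+t} in B. Restricting P x to \<Lambda> by a density, it
  says that the law of X_{T+t} is the law of X_T pushed through the kernel; equal measures then
  integrate f equally.\<close>

lemma strong_Markov_nn_integral:
  assumes T: "stopping_time F T" and \<Lambda>: "\<Lambda> \<in> sets (pre_sigma T)"
    and f: "f \<in> borel_measurable cemetery_borel"
  shows "(\<integral>\<^sup>+ \<omega>\<in>\<Lambda>. f (X (T \<omega> + t) \<omega>) \<partial>P x) =
    (\<integral>\<^sup>+ \<omega>\<in>\<Lambda>. (\<integral>\<^sup>+ \<omega>'. f (X t \<omega>') \<partial>P (X (T \<omega>) \<omega>)) \<partial>P x)"
proof -
  have [measurable]: "(\<lambda>\<omega>. X (T \<omega>) \<omega>) \<in> measurable (P x) cemetery_borel"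
      "(\<lambda>\<omega>. X (T \<omega> + t) \<omega>) \<in> measurable (P x) cemetery_borel"
    unfolding measurable_P_iff
    by (intro measurable_X_stopping_time T stopping_time_add_const)+
  have [measurable]: "\<Lambda> \<in> sets (P x)"
    using \<Lambda> sets_pre_sigma_le_M[OF T] sets_P by auto
  let ?D = "density (P x) (indicator \<Lambda>)"
  let ?\<nu> = "distr ?D cemetery_borel (\<lambda>\<omega>. X (T \<omega>) \<omega>)"
  have eq: "distr ?D cemetery_borel (\<lambda>\<omega>. X (T \<omega> + t) \<omega>) = ?\<nu> \<bind> transition t"
  proof (rule measure_eqI)
    have "sets (?\<nu> \<bind> transition t) = sets cemetery_borel"
      by (rule sets_bind) (auto simp: transition_def)
    then show "sets (distr ?D cemetery_borel (\<lambda>\<omega>. X (T \<omega> + t) \<omega>)) = sets (?\<nu> \<bind> transition t)"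
      by simp
    fix B assume "B \<in> sets (distr ?D cemetery_borel (\<lambda>\<omega>. X (T \<omega> + t) \<omega>))"
    then have [measurable]: "B \<in> sets cemetery_borel" by simp
    have set_eq: "(\<lambda>\<omega>. X (T \<omega> + t) \<omega>) -` B \<inter> UNIV \<in> sets (P x)"
      using measurable_sets[of "\<lambda>\<omega>. X (T \<omega> + t) \<omega>" "P x" cemetery_borel B] by simp
    have "emeasure (distr ?D cemetery_borel (\<lambda>\<omega>. X (T \<omega> + t) \<omega>)) B =
        (\<integral>\<^sup>+ \<omega>. indicator \<Lambda> \<omega> * indicator ((\<lambda>\<omega>. X (T \<omega> + t) \<omega>) -` B \<inter> UNIV) \<omega> \<partial>P x)"
      using set_eq by (simp add: emeasure_distr emeasure_density)
    also have "\<dots> = (\<integral>\<^sup>+ \<omega>. indicator (\<Lambda> \<inter> ((\<lambda>\<omega>. X (T \<omega> + t) \<omega>) -` B \<inter> UNIV)) \<omega> \<partial>P x)"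
      by (intro nn_integral_cong) (auto simp: indicator_def)
    also have "\<dots> = emeasure (P x) {\<omega>\<in>\<Lambda>. X (T \<omega> + t) \<omega> \<in> B}"
      using set_eq by (subst nn_integral_indicator) (auto intro!: arg_cong[where f = "emeasure _"])
    also have "\<dots> = (\<integral>\<^sup>+ \<omega>\<in>\<Lambda>. emeasure (P (X (T \<omega>) \<omega>)) {\<omega>'. X t \<omega>' \<in> B} \<partial>P x)"
      by (rule strong_Markov[OF T \<Lambda>]) measurable
    also have "\<dots> = (\<integral>\<^sup>+ \<omega>. indicator \<Lambda> \<omega> * emeasure (transition t (X (T \<omega>) \<omega>)) B \<partial>P x)"
      by (intro nn_integral_cong)
        (simp add: transition_def emeasure_distr measurable_P_iff vimage_def mult.commute)
    also have "\<dots> = (\<integral>\<^sup>+ y. emeasure (transition t y) B \<partial>?\<nu>)"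
      by (simp add: nn_integral_distr nn_integral_density)
    also have "\<dots> = emeasure (?\<nu> \<bind> transition t) B"
      by (subst emeasure_bind[where N = cemetery_borel]) auto
    finally show "emeasure (distr ?D cemetery_borel (\<lambda>\<omega>. X (T \<omega> + t) \<omega>)) B =
        emeasure (?\<nu> \<bind> transition t) B" .
  qed
  have [measurable]: "f \<in> borel_measurable cemetery_borel" by fact
  have "(\<integral>\<^sup>+ \<omega>\<in>\<Lambda>. f (X (T \<omega> + t) \<omega>) \<partial>P x) =
      (\<integral>\<^sup>+ y. f y \<partial>distr ?D cemetery_borel (\<lambda>\<omega>. X (T \<omega> + t) \<omega>))"
    by (simp add: nn_integral_distr nn_integral_density mult.commute)
  also have "\<dots> = (\<integral>\<^sup>+ y. \<integral>\<^sup>+ z. f z \<partial>transition t y \<partial>?\<nu>)"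
    unfolding eq by (rule nn_integral_bind[where B = cemetery_borel]) auto
  also have "\<dots> = (\<integral>\<^sup>+ \<omega>\<in>\<Lambda>. (\<integral>\<^sup>+ \<omega>'. f (X t \<omega>') \<partial>P (X (T \<omega>) \<omega>)) \<partial>P x)"
    by (simp add: nn_integral_transition nn_integral_distr nn_integral_density mult.commute)
  finally show ?thesis .
qed

lemma measurable_cylinder_kernel:
  assumes "\<forall>(t, B)\<in>set l. B \<in> sets cemetery_borel"
  shows "cylinder_kernel X P l \<in> borel_measurable cemetery_borel"
  using assms
proof (induction l)
  case (Cons tB l)
  then have [measurable]: "snd tB \<in> sets cemetery_borel" "cylinder_kernel X P l \<in> borel_measurable cemetery_borel"
    by (auto simp: case_prod_unfold)
  have "cylinder_kernel X P (tB # l) = (\<lambda>y. \<integral>\<^sup>+ \<omega>. (\<lambda>z. indicator (snd tB) z * cylinder_kernel X P l z) (X (fst tB) \<omega>) \<partial>P y)"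
    by (rule ext) simp
  also have "\<dots> \<in> borel_measurable cemetery_borel"
    by (rule measurable_nn_integral_X) measurable
  finally show ?case .
next
  case Nil
  have "cylinder_kernel X P [] = (\<lambda>_. 1)"
    by (rule ext) simp
  then show ?case by simp
qed

text \<open>Induction with T and \<Lambda> both general: the first factor of the cylinder is
  absorbed into the event, which then belongs to the past of T + t, where the induction hypothesis
  applies.\<close>

lemma strong_Markov_cylinder:
  assumes "stopping_time F T" and "\<Lambda> \<in> sets (pre_sigma T)"
    and "\<forall>(t, B)\<in>set l. B \<in> sets cemetery_borel"
  shows "(\<integral>\<^sup>+ \<omega>\<in>\<Lambda>. cylinder X l (T \<omega>) \<omega> \<partial>P x) = (\<integral>\<^sup>+ \<omega>\<in>\<Lambda>. cylinder_kernel X P l (X (T \<omega>) \<omega>) \<partial>P x)"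
  using assms
proof (induction l arbitrary: T \<Lambda>)
  case (Cons tB l)
  obtain t B where tB: "tB = (t, B)" by fastforce
  note T = Cons.prems(1)
  let ?T = "\<lambda>\<omega>. T \<omega> + t"
  note T' = stopping_time_add_const[OF T, of t]
  have [measurable]: "B \<in> sets cemetery_borel"
    using Cons.prems(3) tB by auto
  have l: "\<forall>(t, B)\<in>set l. B \<in> sets cemetery_borel"
    using Cons.prems(3) by auto
  note [measurable] = measurable_cylinder_kernel[OF l]
  let ?\<Lambda> = "\<Lambda> \<inter> ((\<lambda>\<omega>. X (?T \<omega>) \<omega>) -` B \<inter> space (pre_sigma ?T))"
  have "sets (pre_sigma T) \<subseteq> sets (pre_sigma ?T)"
    by (rule mono_pre_sigma[OF T T']) (auto simp: add_increasing2)
  then have \<Lambda>: "?\<Lambda> \<in> sets (pre_sigma ?T)"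
    using Cons.prems(2) measurable_sets[OF strong_measurable[OF T'], of B] by auto
  have "(\<integral>\<^sup>+ \<omega>\<in>\<Lambda>. cylinder X (tB # l) (T \<omega>) \<omega> \<partial>P x) = (\<integral>\<^sup>+ \<omega>\<in>?\<Lambda>. cylinder X l (?T \<omega>) \<omega> \<partial>P x)"
    by (intro nn_integral_cong) (auto simp: tB indicator_def space_pre_sigma)
  also have "\<dots> = (\<integral>\<^sup>+ \<omega>\<in>?\<Lambda>. cylinder_kernel X P l (X (?T \<omega>) \<omega>) \<partial>P x)"
    by (rule Cons.IH[OF T' \<Lambda> l])
  also have "\<dots> = (\<integral>\<^sup>+ \<omega>\<in>\<Lambda>. (\<lambda>y. indicator B y * cylinder_kernel X P l y) (X (T \<omega> + t) \<omega>) \<partial>P x)"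
    by (intro nn_integral_cong) (auto simp: indicator_def space_pre_sigma)
  also have "\<dots> = (\<integral>\<^sup>+ \<omega>\<in>\<Lambda>. cylinder_kernel X P (tB # l) (X (T \<omega>) \<omega>) \<partial>P x)"
    by (subst strong_Markov_nn_integral[OF T Cons.prems(2)]) (auto simp: tB)
  finally show ?case .
qed simp

lemma AE_P_X_0: "AE \<omega> in P x. X 0 \<omega> = x"
proof -
  interpret prob_space "P x" by (rule prob_P)
  \<comment> \<open>A set outside the \<sigma>-algebra has \<open>emeasure\<close> 0, so measure 1
    already forces measurability.\<close>
  have "{\<omega>. X 0 \<omega> = x} \<in> sets (P x)"
    using normal[of x] by (metis emeasure_notin_sets zero_neq_one)
  then show ?thesis
    using normal[of x] AE_in_set_eq_1[of "{\<omega>. X 0 \<omega> = x}"] by (simp add: emeasure_eq_measure)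
qed

text \<open>The case of the constant stopping time 0, combined with X_0 = y almost surely under P
  y.\<close>

lemma nn_integral_cylinder:
  assumes l: "\<forall>(t, B)\<in>set l. B \<in> sets cemetery_borel"
  shows "(\<integral>\<^sup>+ \<omega>. cylinder X l 0 \<omega> \<partial>P y) = cylinder_kernel X P l y"
proof -
  interpret prob_space "P y" by (rule prob_P)
  have "(\<integral>\<^sup>+ \<omega>. cylinder X l 0 \<omega> \<partial>P y) = (\<integral>\<^sup>+ \<omega>\<in>UNIV. cylinder_kernel X P l (X 0 \<omega>) \<partial>P y)"
    using strong_Markov_cylinder[OF stopping_time_const _ l, of UNIV 0 y]
      sets.top[of "pre_sigma (\<lambda>_. 0)"] by (simp add: space_pre_sigma)
  also have "\<dots> = (\<integral>\<^sup>+ \<omega>. cylinder_kernel X P l y \<partial>P y)"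
    using AE_P_X_0[of y] by (intro nn_integral_cong_AE) auto
  finally show ?thesis
    using emeasure_space_1 by simp
qed

lemma cylinder_shift: "cylinder X l s (\<theta> h \<omega>) = cylinder X l (h + s) \<omega>"
  by (induction l arbitrary: s) (auto simp: shift ac_simps)

text \<open>Only on the raw \<open>\<sigma>\<close>-algebra does the law of the path depend on the starting point through a
  Borel kernel.\<close>

definition raw_law :: "'x option \<Rightarrow> 'w measure" where
  "raw_law y = distr (P y) (raw_filtration X \<infinity>) (\<lambda>\<omega>. \<omega>)"

lemma measurable_id_raw: "(\<lambda>\<omega>. \<omega>) \<in> measurable (P y) (raw_filtration X \<infinity>)"
  using sets_raw_le_M[of \<infinity>] sets_P by (auto simp: measurable_def)

lemma emeasure_raw_law: "A \<in> sets (raw_filtration X \<infinity>) \<Longrightarrow> emeasure (raw_law y) A = emeasure (P y) A"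
  by (simp add: raw_law_def emeasure_distr[OF measurable_id_raw] del: infinity_ennreal_def)

lemma cylinder_setE:
  assumes "A \<in> cylinder_sets X"
  obtains l where "\<forall>(t, B)\<in>set l. B \<in> sets cemetery_borel" "cylinder X l 0 = indicator A"
proof -
  obtain I B where IB: "finite I" "\<And>t. B t \<in> sets cemetery_borel" "A = {\<omega>. \<forall>t\<in>I. X t \<omega> \<in> B t}"
    using assms unfolding cylinder_sets_def by blast
  from cylinder_of_sorted[of "sorted_list_of_set I" 0 B X] IB that show ?thesis
    by (auto simp: fun_eq_iff)
qed

text \<open>A kernel of probability measures is measurable once it is so on a generator stable under
  intersections; on cylinder sets its values are iterated transition integrals.\<close>

lemma measurable_raw_law [measurable]:
  "raw_law \<in> measurable cemetery_borel (subprob_algebra (raw_filtration X \<infinity>))"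
proof (rule measurable_prob_algebraD, rule measurable_prob_algebra_generated)
  show "sets (raw_filtration X \<infinity>) = sigma_sets UNIV (cylinder_sets X)"
    by (rule sets_raw_filtration_cylinder_sets)
  show "Int_stable (cylinder_sets X)"
    by (rule Int_stable_cylinder_sets)
  fix y :: "'x option"
  interpret prob_space "P y" by (rule prob_P)
  show "prob_space (raw_law y)"
    unfolding raw_law_def by (rule prob_space_distr[OF measurable_id_raw])
next
  fix A assume A: "A \<in> cylinder_sets X"
  then obtain l where l: "\<forall>(t, B)\<in>set l. B \<in> sets cemetery_borel" "cylinder X l 0 = indicator A"
    by (rule cylinder_setE)
  have "A \<in> sets (raw_filtration X \<infinity>)"
    using A by (simp add: sets_raw_filtration_cylinder_sets sigma_sets.Basic del: infinity_ennreal_def)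
  then have "emeasure (raw_law y) A = cylinder_kernel X P l y" for y
    using nn_integral_cylinder[OF l(1), of y] sets_raw_le_M[of \<infinity>] sets_P
    by (subst emeasure_raw_law) (auto simp: l(2) nn_integral_indicator)
  then show "(\<lambda>y. emeasure (raw_law y) A) \<in> borel_measurable cemetery_borel"
    using measurable_cylinder_kernel[OF l(1)] by simp
qed (auto simp: raw_law_def)

text \<open>X_s after the shift by T is X_{T+s}, the process at another stopping time. The target is
  the raw \<sigma>-algebra; functionals measurable only after augmentation need the approximation
  below.\<close>

lemma measurable_shift:
  assumes T: "stopping_time F T"
  shows "(\<lambda>\<omega>. \<theta> (T \<omega>) \<omega>) \<in> measurable M (raw_filtration X \<infinity>)"
  unfolding raw_filtration_def
proof (rule measurable_measure_of)
  fix A assume "A \<in> {X s -` B | s B. s \<le> \<infinity> \<and> B \<in> sets cemetery_borel}"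
  then obtain s B where A: "A = X s -` B" and B: "B \<in> sets cemetery_borel"
    by auto
  have "(\<lambda>\<omega>. \<theta> (T \<omega>) \<omega>) -` A \<inter> space M = (\<lambda>\<omega>. X (T \<omega> + s) \<omega>) -` B \<inter> space M"
    by (auto simp: A shift add.commute)
  also have "\<dots> \<in> sets M"
    by (rule measurable_sets[OF measurable_X_stopping_time[OF stopping_time_add_const[OF T]] B])
  finally show "(\<lambda>\<omega>. \<theta> (T \<omega>) \<omega>) -` A \<inter> space M \<in> sets M" .
qed auto

text \<open>The law of the path after T is the mixture of the laws P y over the distribution of X_T.
  Both sides are finite and agree on cylinder sets, which determine them.\<close>

lemma strong_Markov_raw:
  assumes T: "stopping_time F T"
  shows "distr (P x) (raw_filtration X \<infinity>) (\<lambda>\<omega>. \<theta> (T \<omega>) \<omega>) =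
    distr (P x) cemetery_borel (\<lambda>\<omega>. X (T \<omega>) \<omega>) \<bind> raw_law" (is "?L = ?\<nu> \<bind> raw_law")
proof (rule measure_eqI_generator_eq[where E = "cylinder_sets X" and A = "\<lambda>_. UNIV"])
  interpret prob_space "P x" by (rule prob_P)
  have [measurable]: "(\<lambda>\<omega>. X (T \<omega>) \<omega>) \<in> measurable (P x) cemetery_borel"
    unfolding measurable_P_iff by (rule measurable_X_stopping_time[OF T])
  have sh: "(\<lambda>\<omega>. \<theta> (T \<omega>) \<omega>) \<in> measurable (P x) (raw_filtration X \<infinity>)"
    unfolding measurable_P_iff by (rule measurable_shift[OF T])
  have sets_bind: "sets (?\<nu> \<bind> raw_law) = sets (raw_filtration X \<infinity>)"
    by (rule sets_bind) (auto simp: raw_law_def)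
  show "sets ?L = sigma_sets UNIV (cylinder_sets X)" "sets (?\<nu> \<bind> raw_law) = sigma_sets UNIV (cylinder_sets X)"
    using sets_bind by (simp_all add: sets_raw_filtration_cylinder_sets del: infinity_ennreal_def)
  show "Int_stable (cylinder_sets X)"
    by (rule Int_stable_cylinder_sets)
  show "range (\<lambda>_. UNIV) \<subseteq> cylinder_sets X"
    unfolding cylinder_sets_def by (auto intro!: exI[of _ "{}"] exI[of _ "\<lambda>_. {}"])
  show "emeasure ?L UNIV \<noteq> \<infinity>"
    using emeasure_space_1 sets.top[of "raw_filtration X \<infinity>"] by (simp add: emeasure_distr[OF sh] del: infinity_ennreal_def) simp
  fix A assume A: "A \<in> cylinder_sets X"
  then obtain l where l: "\<forall>(t, B)\<in>set l. B \<in> sets cemetery_borel" "cylinder X l 0 = indicator A"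
    by (rule cylinder_setE)
  note [measurable] = measurable_cylinder_kernel[OF l(1)]
  have A': "A \<in> sets (raw_filtration X \<infinity>)"
    using A by (simp add: sets_raw_filtration_cylinder_sets sigma_sets.Basic del: infinity_ennreal_def)
  then have "A \<in> sets (P y)" for y
    using sets_raw_le_M[of \<infinity>] sets_P by auto
  then have kern: "emeasure (P y) A = cylinder_kernel X P l y" for y
    using nn_integral_cylinder[OF l(1), of y] by (simp add: l(2) nn_integral_indicator)
  have "emeasure ?L A = (\<integral>\<^sup>+ \<omega>. indicator A (\<theta> (T \<omega>) \<omega>) \<partial>P x)"
    using A' nn_integral_distr[OF sh, of "indicator A"] by simp
  also have "\<dots> = (\<integral>\<^sup>+ \<omega>\<in>UNIV. cylinder X l (T \<omega>) \<omega> \<partial>P x)"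
    using cylinder_shift[of l 0] by (simp add: l(2)[symmetric])
  also have "\<dots> = (\<integral>\<^sup>+ \<omega>\<in>UNIV. cylinder_kernel X P l (X (T \<omega>) \<omega>) \<partial>P x)"
    using sets.top[of "pre_sigma T"]
    by (intro strong_Markov_cylinder[OF T _ l(1)]) (simp add: space_pre_sigma)
  also have "\<dots> = (\<integral>\<^sup>+ y. cylinder_kernel X P l y \<partial>?\<nu>)"
    by (simp add: nn_integral_distr)
  also have "\<dots> = (\<integral>\<^sup>+ y. emeasure (raw_law y) A \<partial>?\<nu>)"
    using A' by (simp add: emeasure_raw_law kern)
  also have "\<dots> = emeasure (?\<nu> \<bind> raw_law) A"
    using A' by (subst emeasure_bind[where N = "raw_filtration X \<infinity>"]) (auto simp del: infinity_ennreal_def)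
  finally show "emeasure ?L A = emeasure (?\<nu> \<bind> raw_law) A" .
qed auto

text \<open>\<open>augmented_filtration\<close> is the \<sigma>-algebra generated by the
  approximable sets. These are already closed under complements and countable unions, so each of its
  members is approximable, with null sets that may depend on \<nu>.\<close>

lemma augmented_approximation:
  assumes \<Lambda>: "\<Lambda> \<in> sets (augmented_filtration X P t)"
    and \<nu>: "prob_space \<nu>" "sets \<nu> = sets cemetery_borel"
  shows "\<exists>\<Lambda>'\<in>sets (raw_filtration X t). \<exists>N\<in>sets (raw_filtration X \<infinity>).
    (\<Lambda> - \<Lambda>') \<union> (\<Lambda>' - \<Lambda>) \<subseteq> N \<and> (\<integral>\<^sup>+ x. emeasure (P x) N \<partial>\<nu>) = 0"
proof -
  define G where "G \<Lambda> \<Lambda>' N \<longleftrightarrow> \<Lambda>' \<in> sets (raw_filtration X t) \<and> N \<in> sets (raw_filtration X \<infinity>) \<and>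
    (\<Lambda> - \<Lambda>') \<union> (\<Lambda>' - \<Lambda>) \<subseteq> N \<and> (\<integral>\<^sup>+ x. emeasure (P x) N \<partial>\<nu>) = 0" for \<Lambda> \<Lambda>' N
  have "\<Lambda> \<in> sigma_sets UNIV {\<Lambda>. \<forall>\<nu>. prob_space \<nu> \<and> sets \<nu> = sets cemetery_borel \<longrightarrow>
      (\<exists>\<Lambda>'\<in>sets (raw_filtration X t). \<exists>N\<in>sets (raw_filtration X \<infinity>).
        (\<Lambda> - \<Lambda>') \<union> (\<Lambda>' - \<Lambda>) \<subseteq> N \<and> (\<integral>\<^sup>+ x. emeasure (P x) N \<partial>\<nu>) = 0)}"
    using \<Lambda> unfolding augmented_filtration_def sets_measure_of_conv
    by (simp only: Pow_UNIV subset_UNIV if_True)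
  then have "\<exists>\<Lambda>' N. G \<Lambda> \<Lambda>' N"
  proof induction
    case (Basic a)
    then show ?case unfolding G_def mem_Collect_eq Bex_def using \<nu> by meson
  next
    case Empty
    have "G {} {} {}" by (simp add: G_def)
    then show ?case by blast
  next
    case (Compl a)
    then obtain \<Lambda>' N where *: "G a \<Lambda>' N"
      by blast
    have "UNIV - \<Lambda>' \<in> sets (raw_filtration X t)"
      using sets.compl_sets[of \<Lambda>' "raw_filtration X t"] * by (simp add: G_def)
    moreover have "((UNIV - a) - (UNIV - \<Lambda>')) \<union> ((UNIV - \<Lambda>') - (UNIV - a)) = (a - \<Lambda>') \<union> (\<Lambda>' - a)"
      by auto
    ultimately have "G (UNIV - a) (UNIV - \<Lambda>') N"
      using * unfolding G_def by simp
    then show ?case by blast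
  next
    case (Union a)
    then obtain \<Lambda>' N where G: "\<And>i. G (a i) (\<Lambda>' i) (N i)"
      by metis
    have raw: "\<And>i. \<Lambda>' i \<in> sets (raw_filtration X t)" "\<And>i. N i \<in> sets (raw_filtration X \<infinity>)"
      and sub: "\<And>i. (a i - \<Lambda>' i) \<union> (\<Lambda>' i - a i) \<subseteq> N i"
      and null: "\<And>i. (\<integral>\<^sup>+ x. emeasure (P x) (N i) \<partial>\<nu>) = 0"
      using G unfolding G_def by blast+
    have meas: "(\<lambda>x. emeasure (P x) A) \<in> borel_measurable \<nu>" if "A \<in> sets (raw_filtration X \<infinity>)" for A
    proof -
      have "(\<lambda>x. emeasure (raw_law x) A) \<in> borel_measurable cemetery_borel"
        by (rule measurable_emeasure_kernel[OF measurable_raw_law that])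
      then show ?thesis
        unfolding emeasure_raw_law[OF that] using \<nu>(2) by (simp cong: measurable_cong_sets)
    qed
    \<comment> \<open>The step from a vanishing integral to a vanishing integrand needs x |-> P x
      (N) to be Borel, which holds because N is raw.\<close>
    have "AE x in \<nu>. emeasure (P x) (N i) = 0" for i
      using null[of i] nn_integral_0_iff_AE[OF meas[OF raw(2)[of i]]] by blast
    then have "AE x in \<nu>. \<forall>i. emeasure (P x) (N i) = 0"
      unfolding AE_all_countable by blast
    then have "AE x in \<nu>. emeasure (P x) (\<Union>i. N i) = 0"
    proof (rule AE_mp, intro AE_I2 impI)
      fix x assume "\<forall>i. emeasure (P x) (N i) = 0"
      moreover have "N i \<in> sets (P x)" for i
        using raw(2)[of i] sets_raw_le_M[of \<infinity>] unfolding sets_P by blast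
      ultimately show "emeasure (P x) (\<Union>i. N i) = 0"
        by (intro emeasure_UN_eq_0) auto
    qed
    moreover have UN: "(\<Union>i. N i) \<in> sets (raw_filtration X \<infinity>)" "(\<Union>i. \<Lambda>' i) \<in> sets (raw_filtration X t)"
      using raw by (intro sets.countable_UN; blast)+
    ultimately have "(\<integral>\<^sup>+ x. emeasure (P x) (\<Union>i. N i) \<partial>\<nu>) = 0"
      using nn_integral_0_iff_AE[OF meas[OF UN(1)]] by blast
    moreover have "((\<Union>i. a i) - (\<Union>i. \<Lambda>' i)) \<union> ((\<Union>i. \<Lambda>' i) - (\<Union>i. a i)) \<subseteq> (\<Union>i. N i)"
      using sub by fast
    ultimately have "G (\<Union>i. a i) (\<Union>i. \<Lambda>' i) (\<Union>i. N i)"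
      unfolding G_def using UN by blast
    then show ?case by blast
  qed
  then show ?thesis
    unfolding G_def Bex_def by blast
qed

text \<open>Let \<nu> be the law of X_T and Q the law of the shifted path. V agrees with a raw
  functional off a Q-null set N; shifted paths avoid N almost surely, and N is also null under P y
  for \<nu>-almost every y, so V may be exchanged on both sides. As J has only to agree almost
  surely with the shifted V, it may be given by another formula.\<close>

theorem strong_Markov_functional:
  fixes V J :: "'w \<Rightarrow> ennreal"
  assumes T: "stopping_time F T" and V: "V \<in> borel_measurable (augmented_filtration X P \<infinity>)"
    and J: "AE \<omega> in P x. J \<omega> = V (\<theta> (T \<omega>) \<omega>)"
    and h: "h \<in> borel_measurable cemetery_borel" "\<And>y. (\<integral>\<^sup>+ \<omega>. V \<omega> \<partial>P y) = h y"
  shows "(\<integral>\<^sup>+ \<omega>. J \<omega> \<partial>P x) = (\<integral>\<^sup>+ \<omega>. h (X (T \<omega>) \<omega>) \<partial>P x)"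
proof -
  interpret prob_space "P x" by (rule prob_P)
  have [measurable]: "(\<lambda>\<omega>. X (T \<omega>) \<omega>) \<in> measurable (P x) cemetery_borel"
    unfolding measurable_P_iff by (rule measurable_X_stopping_time[OF T])
  have sh: "(\<lambda>\<omega>. \<theta> (T \<omega>) \<omega>) \<in> measurable (P x) (raw_filtration X \<infinity>)"
    unfolding measurable_P_iff by (rule measurable_shift[OF T])
  define \<nu> where "\<nu> = distr (P x) cemetery_borel (\<lambda>\<omega>. X (T \<omega>) \<omega>)"
  define Q where "Q = \<nu> \<bind> raw_law"
  have \<nu>: "prob_space \<nu>" "sets \<nu> = sets cemetery_borel"
    unfolding \<nu>_def by (auto intro: prob_space_distr)
  have space_\<nu>: "space \<nu> = UNIV" by (simp add: \<nu>_def)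
  have raw: "raw_law \<in> measurable \<nu> (subprob_algebra (raw_filtration X \<infinity>))"
    using measurable_raw_law \<nu>(2) by (simp cong: measurable_cong_sets)
  have sets_Q [measurable_cong]: "sets Q = sets (raw_filtration X \<infinity>)"
    unfolding Q_def by (rule sets_bind) (auto simp: raw_law_def space_\<nu>)
  have space_Q: "space Q = UNIV"
    using sets_eq_imp_space_eq[OF sets_Q] by simp
  have emeasure_Q: "emeasure Q A = (\<integral>\<^sup>+ y. emeasure (P y) A \<partial>\<nu>)" if "A \<in> sets (raw_filtration X \<infinity>)" for A
    unfolding Q_def using that
    by (subst emeasure_bind[OF _ raw]) (auto simp: space_\<nu> emeasure_raw_law)
  \<comment> \<open>The approximation is used for the initial distribution \<nu>; the integral that
    makes N negligible there is exactly its Q-measure.\<close>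
  have "\<Lambda> \<in> sets (completion Q)" if A: "\<Lambda> \<in> sets (augmented_filtration X P \<infinity>)" for \<Lambda>
  proof -
    obtain \<Lambda>' N where *: "\<Lambda>' \<in> sets (raw_filtration X \<infinity>)" "N \<in> sets (raw_filtration X \<infinity>)"
      "(\<Lambda> - \<Lambda>') \<union> (\<Lambda>' - \<Lambda>) \<subseteq> N" "(\<integral>\<^sup>+ x. emeasure (P x) N \<partial>\<nu>) = 0"
      using augmented_approximation[OF A \<nu>] unfolding Bex_def by metis
    show ?thesis
    proof (rule sets_completionI)
      show "\<Lambda> = (\<Lambda>' - N) \<union> (\<Lambda> \<inter> N)" "\<Lambda> \<inter> N \<subseteq> N"
        using *(3) by auto
      show "N \<in> null_sets Q" "\<Lambda>' - N \<in> sets Q"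
        using * by (auto simp: sets_Q emeasure_Q)
    qed
  qed
  then have "V \<in> borel_measurable (completion Q)"
    using V by (auto simp: measurable_def space_Q)
  then obtain V1 where V1: "V1 \<in> borel_measurable Q" "AE \<omega> in Q. V \<omega> = V1 \<omega>"
    using completion_ex_borel_measurable by blast
  obtain N where N: "{\<omega>. V \<omega> \<noteq> V1 \<omega>} \<subseteq> N" "emeasure Q N = 0" "N \<in> sets Q"
    using AE_E[OF V1(2)] by (auto simp: space_Q)
  have VN: "V \<omega> = V1 \<omega>" if "\<omega> \<notin> N" for \<omega>
    using subsetD[OF N(1), of \<omega>] that by auto
  have V1_raw: "V1 \<in> borel_measurable (raw_filtration X \<infinity>)"
    using V1(1) sets_Q by (simp cong: measurable_cong_sets)
  have Q_eq: "distr (P x) (raw_filtration X \<infinity>) (\<lambda>\<omega>. \<theta> (T \<omega>) \<omega>) = Q"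
    unfolding Q_def \<nu>_def by (rule strong_Markov_raw[OF T])
  have "emeasure (P x) ((\<lambda>\<omega>. \<theta> (T \<omega>) \<omega>) -` N \<inter> space (P x)) = 0"
    using N(2,3) emeasure_distr[OF sh, of N] unfolding sets_Q Q_eq by metis
  moreover have "(\<lambda>\<omega>. \<theta> (T \<omega>) \<omega>) -` N \<inter> space (P x) \<in> sets (P x)"
    using N(3) by (intro measurable_sets[OF sh]) (simp add: sets_Q)
  ultimately have notN: "AE \<omega> in P x. \<theta> (T \<omega>) \<omega> \<notin> N"
    by (intro AE_I[of _ _ "(\<lambda>\<omega>. \<theta> (T \<omega>) \<omega>) -` N \<inter> space (P x)"]) auto
  have "(\<integral>\<^sup>+ \<omega>. J \<omega> \<partial>P x) = (\<integral>\<^sup>+ \<omega>. V1 (\<theta> (T \<omega>) \<omega>) \<partial>P x)"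
  proof (rule nn_integral_cong_AE)
    show "AE \<omega> in P x. J \<omega> = V1 (\<theta> (T \<omega>) \<omega>)"
      using J notN by eventually_elim (simp add: VN)
  qed
  also have "\<dots> = (\<integral>\<^sup>+ \<omega>. V1 \<omega> \<partial>Q)"
    using nn_integral_distr[OF sh, of V1] V1_raw by (simp add: Q_eq[symmetric] del: infinity_ennreal_def)
  also have "\<dots> = (\<integral>\<^sup>+ y. \<integral>\<^sup>+ \<omega>. V1 \<omega> \<partial>raw_law y \<partial>\<nu>)"
    unfolding Q_def by (rule nn_integral_bind[OF V1_raw raw])
  also have "\<dots> = (\<integral>\<^sup>+ y. \<integral>\<^sup>+ \<omega>. V1 \<omega> \<partial>P y \<partial>\<nu>)"
    unfolding raw_law_def using V1_raw by (subst nn_integral_distr[OF measurable_id_raw]) (simp_all del: infinity_ennreal_def)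
  also have "\<dots> = (\<integral>\<^sup>+ y. h y \<partial>\<nu>)"
  proof (rule nn_integral_cong_AE)
    have "(\<lambda>y. emeasure (P y) N) \<in> borel_measurable \<nu>"
      using measurable_emeasure_kernel[OF raw, of N] N(3) by (simp add: sets_Q emeasure_raw_law)
    \<comment> \<open>Q is the mixture of the P y over \<nu>, so a Q-null set is null for almost
      every starting point.\<close>
    then have "AE y in \<nu>. emeasure (P y) N = 0"
      using N emeasure_Q[of N] by (simp add: sets_Q nn_integral_0_iff_AE)
    then show "AE y in \<nu>. (\<integral>\<^sup>+ \<omega>. V1 \<omega> \<partial>P y) = h y"
    proof (rule AE_mp, intro AE_I2 impI)
      fix y assume "emeasure (P y) N = 0"
      then have "AE \<omega> in P y. \<omega> \<notin> N"
        using N(3) sets_raw_le_M[of \<infinity>] by (intro AE_I[of _ _ N]) (auto simp: sets_Q sets_P)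
      then have "(\<integral>\<^sup>+ \<omega>. V1 \<omega> \<partial>P y) = (\<integral>\<^sup>+ \<omega>. V \<omega> \<partial>P y)"
        by (intro nn_integral_cong_AE, elim AE_mp) (use VN in \<open>auto intro!: AE_I2\<close>)
      then show "(\<integral>\<^sup>+ \<omega>. V1 \<omega> \<partial>P y) = h y"
        by (simp add: h(2))
    qed
  qed
  also have "\<dots> = (\<integral>\<^sup>+ \<omega>. h (X (T \<omega>) \<omega>) \<partial>P x)"
    unfolding \<nu>_def using h(1) by (simp add: nn_integral_distr)
  finally show ?thesis .
qed

end

section \<open>The time-changed process\<close>

text \<open>The least multiple of 1 / (n + 1) strictly after t, with \<infinity> kept fixed. It
  takes countably many values and approaches t from the right, which suits measurability and right
  continuity at once.\<close>

definition grid_after :: "nat \<Rightarrow> ennreal \<Rightarrow> ennreal" where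
  "grid_after n t =
    (if t = \<infinity> then \<infinity> else ennreal (real_of_int (\<lfloor>real (Suc n) * enn2real t\<rfloor> + 1) / real (Suc n)))"

lemma grid_after_greater:
  assumes "t < \<infinity>"
  shows "t < grid_after n t"
proof -
  obtain r where r: "0 \<le> r" "t = ennreal r"
    using assms by (cases t) auto
  have "real (Suc n) * r < real_of_int (\<lfloor>real (Suc n) * r\<rfloor> + 1)"
    by linarith
  then have "r < real_of_int (\<lfloor>real (Suc n) * r\<rfloor> + 1) / real (Suc n)"
    by (simp add: field_simps)
  then show ?thesis
    using r by (simp add: grid_after_def ennreal_lessI)
qed

lemma grid_after_tendsto: "(\<lambda>n. grid_after n t) \<longlonglongrightarrow> t"
proof (cases "t = \<infinity>")
  case False
  then obtain r where r: "0 \<le> r" "t = ennreal r"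
    by (cases t) auto
  have "(\<lambda>n. real_of_int (\<lfloor>real (Suc n) * r\<rfloor> + 1) / real (Suc n)) \<longlonglongrightarrow> r"
  proof (rule tendsto_sandwich)
    show "eventually (\<lambda>n. r \<le> real_of_int (\<lfloor>real (Suc n) * r\<rfloor> + 1) / real (Suc n)) sequentially"
    proof (rule always_eventually, rule allI)
      fix n
      have "real (Suc n) * r \<le> real_of_int (\<lfloor>real (Suc n) * r\<rfloor> + 1)"
        by linarith
      then show "r \<le> real_of_int (\<lfloor>real (Suc n) * r\<rfloor> + 1) / real (Suc n)"
        by (simp add: field_simps)
    qed
    show "eventually (\<lambda>n. real_of_int (\<lfloor>real (Suc n) * r\<rfloor> + 1) / real (Suc n) \<le> r + inverse (real (Suc n)))
        sequentially"
    proof (rule always_eventually, rule allI)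
      fix n
      have "real_of_int (\<lfloor>real (Suc n) * r\<rfloor> + 1) \<le> real (Suc n) * r + 1"
        by linarith
      then have "real_of_int (\<lfloor>real (Suc n) * r\<rfloor> + 1) / real (Suc n) \<le> (real (Suc n) * r + 1) / real (Suc n)"
        by (rule divide_right_mono) simp
      also have "\<dots> = r + inverse (real (Suc n))"
        by (simp add: add_divide_distrib inverse_eq_divide del: of_nat_Suc)
      finally show "real_of_int (\<lfloor>real (Suc n) * r\<rfloor> + 1) / real (Suc n) \<le> r + inverse (real (Suc n))" .
    qed
    show "(\<lambda>n. r + inverse (real (Suc n))) \<longlonglongrightarrow> r"
      by (rule LIMSEQ_inverse_real_of_nat_add)
  qed simp
  then show ?thesis
    using r by (simp add: grid_after_def tendsto_ennrealI)
qed (simp add: grid_after_def)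

lemma tendsto_real_of_right_limit:
  fixes h :: "ennreal \<Rightarrow> real" and u :: "nat \<Rightarrow> ennreal"
  assumes "(h \<longlongrightarrow> h t) (at_right t)" "\<And>n. t \<le> u n" "u \<longlonglongrightarrow> t"
  shows "(\<lambda>n. h (u n)) \<longlonglongrightarrow> h t"
proof (rule continuous_within_tendsto_compose'[of t "{t..}"])
  show "continuous (at t within {t..}) h"
    using assms(1) by (simp add: continuous_within at_within_Ici_at_right)
qed (use assms in auto)

text \<open>The restriction to rational times makes this measurable without an exceptional set.\<close>

definition rational_time_change :: "(real \<Rightarrow> 'w \<Rightarrow> real) \<Rightarrow> real \<Rightarrow> 'w \<Rightarrow> ennreal" where
  "rational_time_change A t \<omega> = Inf {ennreal q | q. q \<in> \<rat> \<and> 0 \<le> q \<and> t < A q \<omega>}"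

lemma rational_time_change_less_iff:
  "rational_time_change A t \<omega> < c \<longleftrightarrow> (\<exists>q\<in>{q \<in> \<rat>. 0 \<le> q \<and> ennreal q < c}. t < A q \<omega>)"
  unfolding rational_time_change_def Inf_less_iff by auto

lemma rational_time_change_mono: "s \<le> t \<Longrightarrow> rational_time_change A s \<omega> \<le> rational_time_change A t \<omega>"
  unfolding rational_time_change_def by (intro Inf_superset_mono) auto

text \<open>If a time q already satisfies t < A q, it does so for all levels close to t; this bounds
  the infimum from above, and monotonicity in the level bounds it from below.\<close>

lemma rational_time_change_right_continuous:
  fixes u :: "nat \<Rightarrow> real"
  assumes "\<And>n. t \<le> u n" "u \<longlonglongrightarrow> t"
  shows "(\<lambda>n. rational_time_change A (u n) \<omega>) \<longlonglongrightarrow> rational_time_change A t \<omega>"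
proof (rule order_tendstoI)
  fix c assume "c < rational_time_change A t \<omega>"
  then have "c < rational_time_change A (u n) \<omega>" for n
    using rational_time_change_mono[OF assms(1)[of n], of A \<omega>] by (rule order_less_le_trans)
  then show "eventually (\<lambda>n. c < rational_time_change A (u n) \<omega>) sequentially"
    by simp
next
  fix c assume "rational_time_change A t \<omega> < c"
  then obtain q where q: "q \<in> \<rat>" "0 \<le> q" "ennreal q < c" "t < A q \<omega>"
    unfolding rational_time_change_less_iff by auto
  have "eventually (\<lambda>n. u n < A q \<omega>) sequentially"
    using assms(2) q(4) by (rule order_tendstoD)
  then show "eventually (\<lambda>n. rational_time_change A (u n) \<omega> < c) sequentially"
    by (rule eventually_mono) (use q in \<open>auto simp: rational_time_change_less_iff\<close>)
qed

definition regular_path :: "(real \<Rightarrow> 'w \<Rightarrow> real) \<Rightarrow> 'w \<Rightarrow> bool" where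
  "regular_path A \<omega> \<longleftrightarrow>
    A 0 \<omega> = 0 \<and> mono_on {0..} (\<lambda>t. A t \<omega>) \<and> continuous_on {0..} (\<lambda>t. A t \<omega>)"

lemma regular_path_mono: "regular_path A \<omega> \<Longrightarrow> 0 \<le> s \<Longrightarrow> s \<le> t \<Longrightarrow> A s \<omega> \<le> A t \<omega>"
  by (auto simp: regular_path_def mono_on_def)

lemma regular_path_nonneg: "regular_path A \<omega> \<Longrightarrow> 0 \<le> s \<Longrightarrow> 0 \<le> A s \<omega>"
  using regular_path_mono[of A \<omega> 0 s] by (simp add: regular_path_def)

text \<open>By monotonicity every rational time after an admissible s is admissible too, so rational
  times reach the same infimum.\<close>

lemma rational_time_change_eq:
  assumes "regular_path A \<omega>"
  shows "rational_time_change A t \<omega> = time_change A t \<omega>"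
proof (rule antisym)
  show "time_change A t \<omega> \<le> rational_time_change A t \<omega>"
    unfolding rational_time_change_def time_change_def by (intro Inf_superset_mono) auto
  show "rational_time_change A t \<omega> \<le> time_change A t \<omega>"
    unfolding time_change_def
  proof (rule Inf_greatest)
    fix x assume "x \<in> {ennreal s |s. 0 \<le> s \<and> t < A s \<omega>}"
    then obtain s where s: "x = ennreal s" "0 \<le> s" "t < A s \<omega>" by auto
    show "rational_time_change A t \<omega> \<le> x"
    proof (rule dense_ge)
      fix y assume "x < y"
      then obtain q where q: "x < ennreal (real_of_rat q)" "ennreal (real_of_rat q) < y"
        using ennreal_rat_dense by blast
      then have "s < real_of_rat q"
        using s by (simp add: ennreal_less_iff)
      then have "t < A (real_of_rat q) \<omega>"
        using regular_path_mono[OF assms s(2), of "real_of_rat q"] s(3) by linarith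
      moreover have "0 \<le> real_of_rat q"
        using \<open>s < real_of_rat q\<close> s(2) by linarith
      ultimately have "rational_time_change A t \<omega> < y"
        unfolding rational_time_change_less_iff using q s \<open>s < real_of_rat q\<close>
        by (intro bexI[of _ "real_of_rat q"]) auto
      then show "rational_time_change A t \<omega> \<le> y" by simp
    qed
  qed
qed

lemma time_change_leI: "0 \<le> u \<Longrightarrow> t < A u \<omega> \<Longrightarrow> time_change A t \<omega> \<le> ennreal u"
  unfolding time_change_def by (intro Inf_lower) auto

text \<open>A continuous A cannot jump over the level t. If it were above t at \<tau>, some earlier
  time would be admissible (A starts at 0 \<le> t, so \<tau> > 0); if below, it would stay below t
  for a while after \<tau>.\<close>

lemma pcaf_at_time_change:
  assumes reg: "regular_path A \<omega>" and t: "0 \<le> t" and \<tau>: "time_change A t \<omega> = ennreal \<tau>" "0 \<le> \<tau>"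
  shows "A \<tau> \<omega> = t"
proof (rule antisym)
  have "continuous (at \<tau> within {0..}) (\<lambda>u. A u \<omega>)"
    using reg \<tau>(2) by (auto simp: regular_path_def continuous_on_eq_continuous_within)
  then have lim: "((\<lambda>u. A u \<omega>) \<longlongrightarrow> A \<tau> \<omega>) (at \<tau> within {0..})"
    by (simp add: continuous_within)
  show "A \<tau> \<omega> \<le> t"
  proof (rule ccontr)
    assume "\<not> A \<tau> \<omega> \<le> t"
    then have gt: "t < A \<tau> \<omega>" by simp
    then have pos: "0 < \<tau>"
      using t reg \<tau>(2) by (cases "\<tau> = 0") (auto simp: regular_path_def)
    obtain d where d: "0 < d" "\<And>u. u \<in> {0..} \<Longrightarrow> u \<noteq> \<tau> \<Longrightarrow> dist u \<tau> < d \<Longrightarrow> t < A u \<omega>"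
      using order_tendstoD(1)[OF lim gt] unfolding eventually_at by blast
    define u where "u = max 0 (\<tau> - d / 2)"
    have u: "0 \<le> u" "u < \<tau>"
      using pos d(1) by (auto simp: u_def)
    then have "t < A u \<omega>"
      using d(1) by (intro d(2)) (auto simp: u_def dist_real_def)
    then have "ennreal \<tau> \<le> ennreal u"
      using time_change_leI[of u t A \<omega>] u(1) \<tau>(1) by simp
    then show False
      using u by simp
  qed
  show "t \<le> A \<tau> \<omega>"
  proof (rule ccontr)
    assume "\<not> t \<le> A \<tau> \<omega>"
    then have lt: "A \<tau> \<omega> < t" by simp
    obtain d where d: "0 < d" "\<And>u. u \<in> {0..} \<Longrightarrow> u \<noteq> \<tau> \<Longrightarrow> dist u \<tau> < d \<Longrightarrow> A u \<omega> < t"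
      using order_tendstoD(2)[OF lim lt] unfolding eventually_at by blast
    define u where "u = \<tau> + d / 2"
    have u: "0 \<le> u" "\<tau> < u"
      using \<tau>(2) d(1) by (auto simp: u_def)
    have "A u \<omega> < t"
      using u d(1) by (intro d(2)) (auto simp: u_def dist_real_def)
    then have "ennreal u \<le> time_change A t \<omega>"
      unfolding time_change_def
    proof (intro Inf_greatest)
      fix x assume "x \<in> {ennreal s |s. 0 \<le> s \<and> t < A s \<omega>}"
      then obtain s where s: "x = ennreal s" "0 \<le> s" "t < A s \<omega>" by auto
      have "u < s"
        using regular_path_mono[OF reg s(2), of u] \<open>A u \<omega> < t\<close> s(3) by (rule_tac ccontr) simp
      then show "ennreal u \<le> x"
        using s by (simp add: ennreal_leI)
    qed
    then show False
      using u \<tau> by simp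
  qed
qed

text \<open>With \<omega>' the path shifted by \<tau>_s, this is \<tau>_{s+r} = \<tau>_s +
  \<tau>_r(\<omega>'). At \<tau>_s the functional has value exactly s, so exceeding s + r afterwards
  means that the restarted functional exceeds r.\<close>

lemma time_change_add:
  assumes reg: "regular_path A \<omega>" and s: "0 \<le> s" and r: "0 \<le> r"
    and \<tau>: "time_change A s \<omega> = ennreal \<tau>" "0 \<le> \<tau>"
    and add: "\<And>v. 0 \<le> v \<Longrightarrow> A (\<tau> + v) \<omega> = A \<tau> \<omega> + A v \<omega>'"
  shows "time_change A (s + r) \<omega> = ennreal \<tau> + time_change A r \<omega>'"
proof (rule antisym)
  have A\<tau>: "A \<tau> \<omega> = s"
    by (rule pcaf_at_time_change[OF reg s \<tau>])
  show "ennreal \<tau> + time_change A r \<omega>' \<le> time_change A (s + r) \<omega>"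
    unfolding time_change_def[of A "s + r"]
  proof (rule Inf_greatest)
    fix x assume "x \<in> {ennreal u |u. 0 \<le> u \<and> s + r < A u \<omega>}"
    then obtain u where u: "x = ennreal u" "0 \<le> u" "s + r < A u \<omega>" by auto
    have "\<tau> \<le> u"
      using time_change_leI[OF u(2), of s A \<omega>] u r \<tau> by simp
    then have "r < A (u - \<tau>) \<omega>'"
      using add[of "u - \<tau>"] u(3) A\<tau> by simp
    then have "time_change A r \<omega>' \<le> ennreal (u - \<tau>)"
      using \<open>\<tau> \<le> u\<close> by (intro time_change_leI) auto
    then have "ennreal \<tau> + time_change A r \<omega>' \<le> ennreal \<tau> + ennreal (u - \<tau>)"
      by (rule add_left_mono)
    then show "ennreal \<tau> + time_change A r \<omega>' \<le> x"
      using u(1) \<tau>(2) \<open>\<tau> \<le> u\<close> by (simp add: ennreal_plus[symmetric] del: ennreal_plus)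
  qed
  show "time_change A (s + r) \<omega> \<le> ennreal \<tau> + time_change A r \<omega>'"
  proof (rule dense_ge)
    fix y assume y: "ennreal \<tau> + time_change A r \<omega>' < y"
    then have "time_change A r \<omega>' < y - ennreal \<tau>"
      by (simp add: less_diff_eq_ennreal add.commute)
    then obtain v where v: "0 \<le> v" "r < A v \<omega>'" "ennreal v < y - ennreal \<tau>"
      unfolding time_change_def Inf_less_iff by auto
    have "s + r < A (\<tau> + v) \<omega>"
      using add[OF v(1)] A\<tau> v(2) by simp
    then have "time_change A (s + r) \<omega> \<le> ennreal (\<tau> + v)"
      using v(1) \<tau>(2) by (intro time_change_leI) auto
    also have "\<dots> \<le> y"
      using v \<tau>(2) by (simp add: less_diff_eq_ennreal add.commute)
    finally show "time_change A (s + r) \<omega> \<le> y" .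
  qed
qed

text \<open>dA is the image of Lebesgue measure under s |-> \<tau>_s. The levels s with a < \<tau>_s
  \<le> b lie between the open and the closed interval with endpoints A(a) and A(b), which have the
  same length.\<close>

lemma pcaf_measure_eq_distr:
  assumes reg: "regular_path A \<omega>"
    and meas [measurable]: "(\<lambda>s. time_change A s \<omega>) \<in> borel_measurable borel"
  shows "distr (density lborel (indicator {s. 0 \<le> s \<and> time_change A s \<omega> < \<infinity>})) borel
      (\<lambda>s. enn2real (time_change A s \<omega>)) = pcaf_measure A \<omega>"
    (is "?N = _")
  unfolding pcaf_measure_def
proof (rule measure_eqI_generator_eq[where E = "range (\<lambda>(a, b). {a<..b})" and \<Omega> = UNIV
      and A = "\<lambda>i. {- real i<..real i}"])
  let ?F = "\<lambda>t. A (max 0 t) \<omega>"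
  have mono: "?F x \<le> ?F y" if "x \<le> y" for x y
    using that by (intro regular_path_mono[OF reg]) auto
  have cont: "continuous_on UNIV ?F"
    using reg by (auto simp: regular_path_def intro!: continuous_on_compose2[of "{0..}" "\<lambda>t. A t \<omega>"] continuous_intros)
  then have cont_right: "continuous (at_right a) ?F" for a
    by (simp add: continuous_on_eq_continuous_at continuous_at_imp_continuous_within)
  have eq: "emeasure ?N {a<..b} = ennreal (?F b - ?F a)" if ab: "a \<le> b" for a b
  proof -
    let ?S = "{s. 0 \<le> s \<and> time_change A s \<omega> < \<infinity> \<and> a < enn2real (time_change A s \<omega>) \<and>
        enn2real (time_change A s \<omega>) \<le> b}"
    have S: "?S \<in> sets lborel"
      by measurable
    have "emeasure ?N {a<..b} = emeasure lborel ?S"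
    proof -
      have "emeasure ?N {a<..b} = (\<integral>\<^sup>+ s. indicator {s. 0 \<le> s \<and> time_change A s \<omega> < \<infinity>} s *
          indicator ((\<lambda>s. enn2real (time_change A s \<omega>)) -` {a<..b} \<inter> space lborel) s \<partial>lborel)"
      proof -
        have "(\<lambda>s. enn2real (time_change A s \<omega>)) -` {a<..b} \<inter> space lborel \<in> sets lborel"
          by (rule measurable_sets[where A = borel]) auto
        moreover have "{s. 0 \<le> s \<and> time_change A s \<omega> < \<infinity>} \<in> sets lborel"
          by measurable
        ultimately show ?thesis
          by (simp add: emeasure_distr emeasure_density del: infinity_ennreal_def)
      qed
      also have "\<dots> = (\<integral>\<^sup>+ s. indicator ?S s \<partial>lborel)"
        by (intro nn_integral_cong) (auto simp: indicator_def)
      finally show ?thesis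
        using S by simp
    qed
    also have "\<dots> = ennreal (?F b - ?F a)"
    proof (rule antisym)
      have "?S \<subseteq> {?F a..?F b}"
      proof
        fix s assume s: "s \<in> ?S"
        then obtain \<tau> where \<tau>: "time_change A s \<omega> = ennreal \<tau>" "0 \<le> \<tau>"
          by (cases "time_change A s \<omega>") auto
        then have "A \<tau> \<omega> = s"
          using s by (intro pcaf_at_time_change[OF reg]) auto
        then have "?F \<tau> = s"
          using \<tau>(2) by simp
        then show "s \<in> {?F a..?F b}"
          using mono[of a \<tau>] mono[of \<tau> b] s \<tau> by auto
      qed
      then have "emeasure lborel ?S \<le> emeasure lborel {?F a..?F b}"
        by (intro emeasure_mono) auto
      then show "emeasure lborel ?S \<le> ennreal (?F b - ?F a)"
        using mono[OF ab] by simp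
      have "{?F a<..<?F b} \<subseteq> ?S"
      proof
        fix s assume s: "s \<in> {?F a<..<?F b}"
        then have s0: "0 < s"
          using regular_path_nonneg[OF reg, of "max 0 a"] by auto
        have "0 \<le> b"
          using s by (rule_tac ccontr) (use ab in auto)
        then have "time_change A s \<omega> \<le> ennreal b"
          using s by (intro time_change_leI) (auto simp: max_def split: if_splits)
        then obtain \<tau> where \<tau>: "time_change A s \<omega> = ennreal \<tau>" "0 \<le> \<tau>" "\<tau> \<le> b"
          using \<open>0 \<le> b\<close> by (cases "time_change A s \<omega>") (auto simp: top_unique)
        then have "?F \<tau> = s"
          using s0 pcaf_at_time_change[OF reg _ \<tau>(1)] by simp
        then have "a < \<tau>"
          using s mono[of \<tau> a] by (rule_tac ccontr) auto
        then show "s \<in> ?S"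
          using s0 \<tau> by simp
      qed
      then have "emeasure lborel {?F a<..<?F b} \<le> emeasure lborel ?S"
        using S by (intro emeasure_mono) auto
      then show "ennreal (?F b - ?F a) \<le> emeasure lborel ?S"
        using mono[OF ab] by simp
    qed
    finally show ?thesis .
  qed
  show "emeasure ?N B = emeasure (interval_measure ?F) B" if B_in: "B \<in> range (\<lambda>(a, b). {a<..b})" for B
  proof -
    obtain a b where B: "B = {a<..b}"
      using B_in by auto
    show ?thesis
      using eq[of a b] emeasure_interval_measure_Ioc_eq[of ?F a b] mono cont_right
      by (cases "a \<le> b") (auto simp: B)
  qed
  show "emeasure ?N {- real i<..real i} \<noteq> \<infinity>" for i
    using eq[of "- real i" "real i"] by simp
  show "Int_stable (range (\<lambda>(a, b). {a<..b :: real}))"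
  proof (rule Int_stableI)
    fix C D :: "real set" assume "C \<in> range (\<lambda>(a, b). {a<..b})" "D \<in> range (\<lambda>(a, b). {a<..b})"
    then obtain a b c d where "C = {a<..b}" "D = {c<..d}" by auto
    then have "C \<inter> D = (\<lambda>(a, b). {a<..b}) (max a c, min b d)"
      by auto
    then show "C \<inter> D \<in> range (\<lambda>(a, b). {a<..b})"
      by blast
  qed
  show "(\<Union>i. {- real i<..real i}) = UNIV"
  proof (intro set_eqI iffI UNIV_I)
    fix x :: real
    obtain n where "\<bar>x\<bar> < real n"
      using reals_Archimedean2 by blast
    then have "x \<in> {- real n<..real n}" by auto
    then show "x \<in> (\<Union>i. {- real i<..real i})" by blast
  qed
qed (auto simp: borel_sigma_sets_Ioc)

text \<open>The substitution t = \<tau>_s, which turns integrals against dA into time integrals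
  along the time-changed process.\<close>

lemma nn_integral_pcaf_measure:
  assumes reg: "regular_path A \<omega>"
    and meas [measurable]: "(\<lambda>s. time_change A s \<omega>) \<in> borel_measurable borel"
      "g \<in> borel_measurable borel"
  shows "(\<integral>\<^sup>+ t\<in>{0..}. g t \<partial>pcaf_measure A \<omega>) =
    (\<integral>\<^sup>+ s\<in>{s. 0 \<le> s \<and> time_change A s \<omega> < \<infinity>}. g (enn2real (time_change A s \<omega>)) \<partial>lborel)"
  unfolding pcaf_measure_eq_distr[OF reg meas(1), symmetric]
  by (subst nn_integral_distr) (auto simp: nn_integral_density mult.commute intro!: nn_integral_cong)

section \<open>The time-changed process: exceptional paths, measurability and Markov
  property\<close>

locale time_changed_process = standard_process M F X \<theta> P
  for M :: "'w measure" and F :: "ennreal \<Rightarrow> 'w measure"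
    and X :: "ennreal \<Rightarrow> 'w \<Rightarrow> 'x :: {metric_space, second_countable_topology} option"
    and \<theta> :: "ennreal \<Rightarrow> 'w \<Rightarrow> 'w" and P :: "'x option \<Rightarrow> 'w measure" +
  fixes A :: "real \<Rightarrow> 'w \<Rightarrow> real"
  assumes locally_compact: "locally_compact_space (euclidean :: 'x topology)"
    and pcaf: "pcaf X \<theta> P A"
begin

lemma sets_augmented_le_infinity:
  "sets (augmented_filtration X P t) \<subseteq> sets (augmented_filtration X P \<infinity>)"
proof
  fix \<Lambda> assume \<Lambda>: "\<Lambda> \<in> sets (augmented_filtration X P t)"
  have raw: "sets (raw_filtration X t) \<subseteq> sets (raw_filtration X \<infinity>)"
    unfolding sets_raw_filtration by (rule sigma_sets_mono') auto
  show "\<Lambda> \<in> sets (augmented_filtration X P \<infinity>)"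
  proof (rule sets_augmented_filtrationI)
    fix \<nu> :: "'x option measure" assume \<nu>: "prob_space \<nu>" "sets \<nu> = sets cemetery_borel"
    from augmented_approximation[OF \<Lambda> this] raw
    show "\<exists>\<Lambda>'\<in>sets (raw_filtration X \<infinity>). \<exists>N\<in>sets (raw_filtration X \<infinity>).
        (\<Lambda> - \<Lambda>') \<union> (\<Lambda>' - \<Lambda>) \<subseteq> N \<and> (\<integral>\<^sup>+ x. emeasure (P x) N \<partial>\<nu>) = 0"
      unfolding Bex_def by (meson subsetD)
  qed
qed

lemma measurable_A_augmented: "0 \<le> t \<Longrightarrow> A t \<in> borel_measurable (augmented_filtration X P (ennreal t))"
  using pcaf by (simp add: pcaf_def)

lemma measurable_A_infinity: "0 \<le> t \<Longrightarrow> A t \<in> borel_measurable (augmented_filtration X P \<infinity>)"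
  using measurable_A_augmented[of t] sets_augmented_le_infinity[of "ennreal t"]
  by (auto simp: measurable_def simp del: infinity_ennreal_def)

lemma measurable_X_infinity: "X t \<in> measurable (augmented_filtration X P \<infinity>) cemetery_borel"
proof -
  have "X t \<in> measurable (raw_filtration X \<infinity>) cemetery_borel"
    by (rule measurable_raw_filtration) simp
  then show ?thesis
    using sets_raw_le_augmented[of X \<infinity> P]
    by (auto simp: measurable_def simp del: infinity_ennreal_def)
qed

definition good_path :: "'w \<Rightarrow> bool" where
  "good_path \<omega> \<longleftrightarrow> regular_path A \<omega> \<and> (\<forall>t\<ge>0. regular_path A (\<theta> (ennreal t) \<omega>)) \<and>
    (\<forall>s\<ge>0. \<forall>t\<ge>0. A (t + s) \<omega> = A t \<omega> + A s (\<theta> (ennreal t) \<omega>)) \<and>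
    (\<forall>t<\<infinity>. limitin cemetery_topology (\<lambda>s. X s \<omega>) (X t \<omega>) (at_right t))"

text \<open>The complement of the defining set of A together with the null set of irregular paths.
  Invariance of the defining set under shifts makes A regular on all shifted paths as well.\<close>

lemma ex_exceptional:
  "\<exists>N. N \<in> sets M \<and> (\<forall>x. emeasure (P x) N = 0) \<and> (\<forall>\<omega>. \<omega> \<notin> N \<longrightarrow> good_path \<omega>)"
proof -
  obtain \<Lambda> where \<Lambda>: "\<Lambda> \<in> sets (augmented_filtration X P \<infinity>)" "\<And>x. emeasure (P x) \<Lambda> = 1"
      "\<And>t. 0 \<le> t \<Longrightarrow> \<theta> (ennreal t) ` \<Lambda> \<subseteq> \<Lambda>"
      "\<And>\<omega>. \<omega> \<in> \<Lambda> \<Longrightarrow> regular_path A \<omega>"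
      "\<And>\<omega> s t. \<omega> \<in> \<Lambda> \<Longrightarrow> 0 \<le> s \<Longrightarrow> 0 \<le> t \<Longrightarrow> A (t + s) \<omega> = A t \<omega> + A s (\<theta> (ennreal t) \<omega>)"
  proof -
    have "\<exists>\<Lambda>\<in>sets (augmented_filtration X P \<infinity>).
      (\<forall>x. emeasure (P x) \<Lambda> = 1) \<and> (\<forall>t\<ge>0. \<theta> (ennreal t) ` \<Lambda> \<subseteq> \<Lambda>) \<and>
      (\<forall>\<omega>\<in>\<Lambda>. A 0 \<omega> = 0 \<and> mono_on {0..} (\<lambda>t. A t \<omega>) \<and> continuous_on {0..} (\<lambda>t. A t \<omega>) \<and>
        (\<forall>s t. 0 \<le> s \<and> s \<le> t \<and> lifetime X \<omega> \<le> ennreal s \<longrightarrow> A t \<omega> = A s \<omega>) \<and>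
        (\<forall>s\<ge>0. \<forall>t\<ge>0. A (t + s) \<omega> = A t \<omega> + A s (\<theta> (ennreal t) \<omega>)))"
      using pcaf unfolding pcaf_def by (rule conjunct2)
    then show thesis
    proof (elim bexE conjE)
      fix \<Lambda>
      assume L: "\<Lambda> \<in> sets (augmented_filtration X P \<infinity>)" "\<forall>x. emeasure (P x) \<Lambda> = 1"
        "\<forall>t\<ge>0. \<theta> (ennreal t) ` \<Lambda> \<subseteq> \<Lambda>"
        and reg: "\<forall>\<omega>\<in>\<Lambda>. A 0 \<omega> = 0 \<and> mono_on {0..} (\<lambda>t. A t \<omega>) \<and> continuous_on {0..} (\<lambda>t. A t \<omega>) \<and>
          (\<forall>s t. 0 \<le> s \<and> s \<le> t \<and> lifetime X \<omega> \<le> ennreal s \<longrightarrow> A t \<omega> = A s \<omega>) \<and>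
          (\<forall>s\<ge>0. \<forall>t\<ge>0. A (t + s) \<omega> = A t \<omega> + A s (\<theta> (ennreal t) \<omega>))"
      show thesis
      proof (rule that[OF L(1)])
        show "emeasure (P x) \<Lambda> = 1" for x
          using L(2) by (rule spec)
        show "\<theta> (ennreal t) ` \<Lambda> \<subseteq> \<Lambda>" if "0 \<le> t" for t
          using L(3) that by metis
        show "regular_path A \<omega>" if "\<omega> \<in> \<Lambda>" for \<omega>
          unfolding regular_path_def using bspec[OF reg that] by metis
        show "A (t + s) \<omega> = A t \<omega> + A s (\<theta> (ennreal t) \<omega>)" if "\<omega> \<in> \<Lambda>" "0 \<le> s" "0 \<le> t" for \<omega> s t
          using bspec[OF reg that(1)] that(2,3) by metis
      qed
    qed
  qed
  obtain N where N: "N \<in> sets M" "\<And>x. emeasure (P x) N = 0"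
      "\<And>\<omega> t. \<omega> \<notin> N \<Longrightarrow> t < \<infinity> \<Longrightarrow> limitin cemetery_topology (\<lambda>s. X s \<omega>) (X t \<omega>) (at_right t)"
    using paths unfolding almost_surely_def
  proof (elim bexE conjE)
    fix N assume N: "N \<in> sets M" "\<forall>x. emeasure (P x) N = 0"
      and lim: "\<forall>\<omega>. \<omega> \<notin> N \<longrightarrow>
        (\<forall>t<\<infinity>. limitin cemetery_topology (\<lambda>s. X s \<omega>) (X t \<omega>) (at_right t)) \<and>
        (\<forall>t. 0 < t \<and> t < lifetime X \<omega> \<longrightarrow>
          (\<exists>y. limitin cemetery_topology (\<lambda>s. X s \<omega>) (Some y) (at_left t)))"
    show thesis
    proof (rule that[OF N(1)])
      show "emeasure (P x) N = 0" for x
        using N(2) by (rule spec)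
      show "limitin cemetery_topology (\<lambda>s. X s \<omega>) (X t \<omega>) (at_right t)" if "\<omega> \<notin> N" "t < \<infinity>" for \<omega> t
        using mp[OF spec[OF lim, of \<omega>] that(1)] that(2) by metis
    qed
  qed
  have \<Lambda>M: "\<Lambda> \<in> sets M"
    using \<Lambda>(1) sets_augmented_le_M by blast
  have "emeasure (P x) (UNIV - \<Lambda>) = 0" for x
  proof -
    interpret prob_space "P x" by (rule prob_P)
    show ?thesis
      using emeasure_compl[of \<Lambda> "P x"] \<Lambda>(2)[of x] \<Lambda>M emeasure_space_1 by (simp add: sets_P)
  qed
  moreover have "UNIV - \<Lambda> \<in> sets M"
    using sets.compl_sets[OF \<Lambda>M] space_M by simp
  ultimately have "emeasure (P x) ((UNIV - \<Lambda>) \<union> N) = 0" for x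
    using N(1,2) emeasure_Un_null_set[of "UNIV - \<Lambda>" "P x" N] by (simp add: sets_P null_sets_def)
  moreover have "(UNIV - \<Lambda>) \<union> N \<in> sets M"
    using N(1) \<open>UNIV - \<Lambda> \<in> sets M\<close> by auto
  moreover have "good_path \<omega>" if "\<omega> \<notin> (UNIV - \<Lambda>) \<union> N" for \<omega>
  proof -
    have \<omega>: "\<omega> \<in> \<Lambda>" "\<omega> \<notin> N"
      using that by auto
    then have "\<theta> (ennreal t) \<omega> \<in> \<Lambda>" if "0 \<le> t" for t
      using \<Lambda>(3)[OF that] by blast
    then show ?thesis
      unfolding good_path_def using \<omega> \<Lambda>(4,5) N(3) by blast
  qed
  ultimately show ?thesis by blast
qed

text \<open>One choice, null under every starting point at once, so that later definitions do not
  depend on x.\<close>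

definition exceptional :: "'w set" where
  "exceptional = (SOME N. N \<in> sets M \<and> (\<forall>x. emeasure (P x) N = 0) \<and> (\<forall>\<omega>. \<omega> \<notin> N \<longrightarrow> good_path \<omega>))"

lemma exceptional: "exceptional \<in> sets M" "emeasure (P x) exceptional = 0"
    "\<omega> \<notin> exceptional \<Longrightarrow> good_path \<omega>"
  using someI_ex[OF ex_exceptional] by (auto simp: exceptional_def)

lemma AE_not_exceptional: "AE \<omega> in P x. \<omega> \<notin> exceptional"
  using exceptional by (intro AE_I[of _ _ exceptional]) (auto simp: sets_P)

text \<open>Every subset of the exceptional set is measurable by completeness, so a function may be
  changed there. The integrands of \<open>P_check\<close> and \<open>R_check\<close>, built on an
  uncountable infimum, become measurable in this way.\<close>

lemma measurable_modification:
  assumes f: "f \<in> measurable M K" and eq: "\<And>\<omega>. \<omega> \<notin> exceptional \<Longrightarrow> f \<omega> = g \<omega>"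
    and g: "\<And>\<omega>. g \<omega> \<in> space K"
  shows "g \<in> measurable M K"
proof (rule measurableI)
  fix B assume B: "B \<in> sets K"
  have "g -` B \<inter> exceptional \<in> sets M"
    using null_subsets[OF exceptional(1,2), of "g -` B \<inter> exceptional" 0] sets_F by auto
  moreover have "(f -` B \<inter> space M) - exceptional \<in> sets M"
    using measurable_sets[OF f B] exceptional(1) by auto
  moreover have "g -` B \<inter> space M = ((f -` B \<inter> space M) - exceptional) \<union> (g -` B \<inter> exceptional)"
    using eq space_M by auto
  ultimately show "g -` B \<inter> space M \<in> sets M"
    by auto
qed (rule g)

text \<open>\<tau>_s < c is a countable union of events s < A_q with q < c, hence known at c. For
  \<tau>_s \<le> c the same is used at rational times decreasing to c, and right continuity of the
  filtration closes the gap.\<close>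

lemma stopping_time_time_change: "stopping_time F (rational_time_change A s)"
proof (rule stopping_timeI)
  have less: "{\<omega>. rational_time_change A s \<omega> < c} \<in> sets (F c)" for c
  proof -
    have "{\<omega> \<in> space (F c). s < A q \<omega>} \<in> sets (F c)" if q: "0 \<le> q" "ennreal q < c" for q
    proof -
      have "{\<omega> \<in> space (augmented_filtration X P (ennreal q)). s < A q \<omega>} \<in> sets (augmented_filtration X P (ennreal q))"
        using measurable_A_augmented[OF q(1)] by measurable
      then have "{\<omega>. s < A q \<omega>} \<in> sets (F (ennreal q))"
        using augmented by auto
      then show ?thesis
        using subsetD[OF sets_F_mono[OF less_imp_le[OF q(2)]]] by (simp add: space_F)
    qed
    moreover have "countable {q \<in> \<rat>. 0 \<le> q \<and> ennreal q < c}"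
      using countable_rat by (rule countable_subset[rotated]) auto
    moreover have "{\<omega>. rational_time_change A s \<omega> < c} =
        (\<Union>q\<in>{q \<in> \<rat>. 0 \<le> q \<and> ennreal q < c}. {\<omega> \<in> space (F c). s < A q \<omega>})"
      by (auto simp: rational_time_change_less_iff space_F)
    ultimately show ?thesis
      by (auto intro!: sets.countable_UN'')
  qed
  fix c :: ennreal
  show "Measurable.pred (F c) (\<lambda>\<omega>. rational_time_change A s \<omega> \<le> c)"
  proof (cases "c = \<infinity>")
    case False
    then have c: "c < \<infinity>" by (simp add: less_top)
    have "{\<omega>. rational_time_change A s \<omega> \<le> c} \<in> sets (F d)" if cd: "c < d" for d
    proof -
      let ?R = "{r :: rat. c < ennreal (real_of_rat r) \<and> ennreal (real_of_rat r) < d}"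
      obtain r0 where r0: "r0 \<in> ?R"
        using ennreal_rat_dense[OF cd] by blast
      have "{\<omega>. rational_time_change A s \<omega> \<le> c} = (\<Inter>r\<in>?R. {\<omega>. rational_time_change A s \<omega> < ennreal (real_of_rat r)})"
      proof (intro set_eqI iffI)
        fix \<omega> assume *: "\<omega> \<in> (\<Inter>r\<in>?R. {\<omega>. rational_time_change A s \<omega> < ennreal (real_of_rat r)})"
        have "rational_time_change A s \<omega> \<le> c"
        proof (rule dense_ge)
          fix y assume "c < y"
          then have "c < min y d"
            using cd by simp
          then obtain r where r: "c < ennreal (real_of_rat r)" "ennreal (real_of_rat r) < min y d"
            using ennreal_rat_dense by blast
          then show "rational_time_change A s \<omega> \<le> y"
            using * by (auto dest!: bspec[where x = r] intro: less_imp_le order_less_trans)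
        qed
        then show "\<omega> \<in> {\<omega>. rational_time_change A s \<omega> \<le> c}" by simp
      qed (auto intro: order_le_less_trans)
      moreover have "{\<omega>. rational_time_change A s \<omega> < ennreal (real_of_rat r)} \<in> sets (F d)" if "r \<in> ?R" for r
        using less[of "ennreal (real_of_rat r)"] sets_F_mono[of "ennreal (real_of_rat r)" d] that
        by (auto dest: less_imp_le)
      ultimately show ?thesis
        using r0 sets.top[of "F d"] by (auto intro!: sets.countable_INT'' simp: space_F)
    qed
    then have "{\<omega>. rational_time_change A s \<omega> \<le> c} \<in> sets (F c)"
      using right_continuous_F[OF c] by auto
    then show ?thesis
      by (simp add: pred_def space_F)
  qed simp
qed

lemma measurable_time_change_infinity:
  "(\<lambda>(s, \<omega>). rational_time_change A s \<omega>) \<in> borel_measurable (borel \<Otimes>\<^sub>M augmented_filtration X P \<infinity>)"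
proof (rule borel_measurableI_less)
  fix c :: ennreal
  let ?N = "borel \<Otimes>\<^sub>M augmented_filtration X P \<infinity>"
  let ?Q = "{q \<in> \<rat>. 0 \<le> q \<and> ennreal q < c}"
  have Q: "countable ?Q"
    using countable_rat by (rule countable_subset[rotated]) auto
  have "{x \<in> space ?N. \<exists>q\<in>?Q. fst x < A q (snd x)} \<in> sets ?N"
  proof (rule sets.sets_Collect_countable_Ex'[OF _ Q])
    fix q assume "q \<in> ?Q"
    then have [measurable]: "A q \<in> borel_measurable (augmented_filtration X P \<infinity>)"
      by (intro measurable_A_infinity) auto
    show "{x \<in> space ?N. fst x < A q (snd x)} \<in> sets ?N"
      by measurable
  qed
  also have "{x \<in> space ?N. \<exists>q\<in>?Q. fst x < A q (snd x)} =
      {x \<in> space ?N. (case x of (s, \<omega>) \<Rightarrow> rational_time_change A s \<omega>) < c}"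
    by (auto simp: rational_time_change_less_iff)
  finally show "{x \<in> space ?N. (case x of (s, \<omega>) \<Rightarrow> rational_time_change A s \<omega>) < c} \<in> sets ?N" .
qed

text \<open>X_t is measurable for each fixed t only; at a random time with countably many values it
  can be assembled piece by piece.\<close>

lemma measurable_X_grid:
  assumes g [measurable]: "g \<in> borel_measurable N"
    and k: "\<And>c. (\<lambda>w. X c (k w)) \<in> measurable N cemetery_borel"
  shows "(\<lambda>w. X (grid_after n (g w)) (k w)) \<in> measurable N cemetery_borel"
proof -
  let ?i = "\<lambda>w. if g w = \<infinity> then None else Some \<lfloor>real (Suc n) * enn2real (g w)\<rfloor>"
  let ?f = "\<lambda>i w. X (case i of None \<Rightarrow> \<infinity> | Some j \<Rightarrow> ennreal (real_of_int (j + 1) / real (Suc n))) (k w)"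
  have "?i \<in> measurable N (count_space UNIV)"
    by measurable
  then have "(\<lambda>w. ?f (?i w) w) \<in> measurable N cemetery_borel"
    by (rule measurable_compose_countable[rotated]) (rule k)
  moreover have "?f (?i w) w = X (grid_after n (g w)) (k w)" for w
    by (simp add: grid_after_def)
  ultimately show ?thesis by simp
qed

text \<open>Killing on the exceptional null set makes \<open>Y\<close> jointly measurable.\<close>

definition Y :: "real \<Rightarrow> 'w \<Rightarrow> 'x option" where
  "Y s \<omega> = (if \<omega> \<in> exceptional then None else X (rational_time_change A s \<omega>) \<omega>)"

lemma Y_eq_time_change: "\<omega> \<notin> exceptional \<Longrightarrow> Y s \<omega> = X (time_change A s \<omega>) \<omega>"
  using exceptional(3)[of \<omega>] rational_time_change_eq[of A \<omega> s] by (simp add: Y_def good_path_def)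

lemma X_right_continuous:
  assumes \<omega>: "\<omega> \<notin> exceptional" and u: "\<And>n. t \<le> u n" "u \<longlonglongrightarrow> t"
  shows "(\<lambda>n. extend0 (c0_apply f) (X (u n) \<omega>)) \<longlonglongrightarrow> extend0 (c0_apply f) (X t \<omega>)"
proof (cases "t < \<infinity>")
  case True
  then have "((\<lambda>s. extend0 (c0_apply f) (X s \<omega>)) \<longlongrightarrow> extend0 (c0_apply f) (X t \<omega>)) (at_right t)"
    using exceptional(3)[OF \<omega>] by (intro tendsto_extend0_c0) (auto simp: good_path_def)
  then show ?thesis
    by (rule tendsto_real_of_right_limit[OF _ u])
next
  case False
  then have "t = top"
    by (simp add: less_top[symmetric])
  then have "u n = t" for n
    using u(1)[of n] by (simp add: top_unique)
  then show ?thesis by simp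
qed

lemma grid_after_ge: "t \<le> grid_after n t"
  using grid_after_greater[of t n] by (cases "t < \<infinity>") (auto simp: grid_after_def less_top)

lemma X_grid_tendsto:
  "\<omega> \<notin> exceptional \<Longrightarrow>
    (\<lambda>n. extend0 (c0_apply f) (X (grid_after n t) \<omega>)) \<longlonglongrightarrow> extend0 (c0_apply f) (X t \<omega>)"
  by (rule X_right_continuous[OF _ grid_after_ge grid_after_tendsto])

lemma Y_right_continuous:
  assumes "\<And>n. s \<le> u n" "u \<longlonglongrightarrow> s"
  shows "(\<lambda>n. extend0 (c0_apply f) (Y (u n) \<omega>)) \<longlonglongrightarrow> extend0 (c0_apply f) (Y s \<omega>)"
proof (cases "\<omega> \<in> exceptional")
  case False
  then show ?thesis
    unfolding Y_def using assms
    by (auto intro!: X_right_continuous rational_time_change_mono rational_time_change_right_continuous)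
qed (simp add: Y_def)

lemma sets_pair_augmented_le_M:
  "sets (borel \<Otimes>\<^sub>M augmented_filtration X P \<infinity>) \<subseteq> sets (borel \<Otimes>\<^sub>M M)"
proof -
  have "(\<lambda>\<omega>. \<omega>) \<in> measurable M (augmented_filtration X P \<infinity>)"
    using sets_augmented_le_M[of \<infinity>] space_M by (auto simp: measurable_def)
  then have "(\<lambda>x. (fst x, snd x)) \<in> measurable (borel \<Otimes>\<^sub>M M) (borel \<Otimes>\<^sub>M augmented_filtration X P \<infinity>)"
    by (intro measurable_Pair) (auto intro: measurable_compose[OF measurable_snd])
  then have id: "(\<lambda>x. x) \<in> measurable (borel \<Otimes>\<^sub>M M) (borel \<Otimes>\<^sub>M augmented_filtration X P \<infinity>)"
    by simp
  show ?thesis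
  proof
    fix B assume "B \<in> sets (borel \<Otimes>\<^sub>M augmented_filtration X P \<infinity>)"
    from measurable_sets[OF id this] sets.sets_into_space[OF this]
    show "B \<in> sets (borel \<Otimes>\<^sub>M M)"
      by (simp add: space_pair_measure space_M Int_absorb2)
  qed
qed

lemma measurable_time_change [measurable]:
  "(\<lambda>(s, \<omega>). rational_time_change A s \<omega>) \<in> borel_measurable (borel \<Otimes>\<^sub>M M)"
  using measurable_time_change_infinity sets_pair_augmented_le_M
  by (auto simp: measurable_def space_pair_measure space_M simp del: infinity_ennreal_def)

text \<open>Tested against C_0 functions, Y is the pointwise limit of X at grid times after
  \<tau>_s, by right continuity of the paths.\<close>

lemma measurable_Y [measurable]: "(\<lambda>(s, \<omega>). Y s \<omega>) \<in> measurable (borel \<Otimes>\<^sub>M M) cemetery_borel"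
proof (rule measurable_cemeteryI[OF locally_compact])
  fix f :: "'x c0"
  let ?N = "borel \<Otimes>\<^sub>M M :: (real \<times> 'w) measure"
  have [measurable]: "Measurable.pred ?N (\<lambda>x. snd x \<in> exceptional)"
    using measurable_sets[OF measurable_snd exceptional(1), of borel]
    by (simp add: pred_def vimage_def Int_def conj_commute)
  have [measurable]: "(\<lambda>x. rational_time_change A (fst x) (snd x)) \<in> borel_measurable ?N"
    using measurable_time_change by (simp add: case_prod_unfold)
  have [measurable]: "(\<lambda>x. X (grid_after n (rational_time_change A (fst x) (snd x))) (snd x))
      \<in> measurable ?N cemetery_borel" for n
    by (rule measurable_X_grid) measurable
  show "(\<lambda>x. extend0 (c0_apply f) (case x of (s, \<omega>) \<Rightarrow> Y s \<omega>)) \<in> borel_measurable ?N"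
  proof (rule borel_measurable_LIMSEQ_real)
    let ?g = "\<lambda>n x. if snd x \<in> exceptional then 0 else
      extend0 (c0_apply f) (X (grid_after n (rational_time_change A (fst x) (snd x))) (snd x))"
    show "?g n \<in> borel_measurable ?N" for n
      by measurable
    show "(\<lambda>n. ?g n x) \<longlonglongrightarrow> extend0 (c0_apply f) (case x of (s, \<omega>) \<Rightarrow> Y s \<omega>)" for x
      using X_grid_tendsto[of "snd x" f "rational_time_change A (fst x) (snd x)"]
      by (cases "snd x \<in> exceptional") (auto simp: Y_def case_prod_unfold)
  qed
qed

lemma measurable_Y_pair [measurable]:
  "(\<lambda>(s, \<omega>). Y s \<omega>) \<in> measurable (lborel \<Otimes>\<^sub>M P x) cemetery_borel"
  "(\<lambda>(\<omega>, s). Y s \<omega>) \<in> measurable (P x \<Otimes>\<^sub>M lborel) cemetery_borel"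
proof -
  have eq: "sets (lborel \<Otimes>\<^sub>M P x) = sets (borel \<Otimes>\<^sub>M M)"
    by (intro sets_pair_measure_cong sets_P) simp
  show *: "(\<lambda>(s, \<omega>). Y s \<omega>) \<in> measurable (lborel \<Otimes>\<^sub>M P x) cemetery_borel"
    unfolding measurable_cong_sets[OF eq refl] by (rule measurable_Y)
  show "(\<lambda>(\<omega>, s). Y s \<omega>) \<in> measurable (P x \<Otimes>\<^sub>M lborel) cemetery_borel"
    using measurable_compose[OF measurable_pair_swap' *] by (simp add: case_prod_unfold)
qed

lemma measurable_Y_fixed [measurable]: "Y s \<in> measurable (P x) cemetery_borel"
  unfolding measurable_P_iff
  using measurable_compose[OF measurable_Pair1'[of s borel M] measurable_Y] by simp

text \<open>Off the exceptional set \<open>Y\<close> is X at the time change, so the semigroup may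
  be computed with the jointly measurable process.\<close>

lemma P_check_eq:
  assumes u [measurable]: "u \<in> borel_measurable borel"
  shows "P_check X P A s u x = (\<integral> \<omega>. extend0 u (Y s \<omega>) \<partial>P (Some x))"
  unfolding P_check_def
proof (rule integral_cong_AE)
  have Y: "(\<lambda>\<omega>. extend0 u (Y s \<omega>)) \<in> borel_measurable M"
    using measurable_compose[OF measurable_Y_fixed borel_measurable_extend0[OF u]]
    by (simp add: measurable_P_iff)
  then show "(\<lambda>\<omega>. extend0 u (Y s \<omega>)) \<in> borel_measurable (P (Some x))"
    by (simp add: measurable_P_iff)
  have "(\<lambda>\<omega>. extend0 u (X (time_change A s \<omega>) \<omega>)) \<in> borel_measurable M"
    by (rule measurable_modification[OF Y]) (auto simp: Y_eq_time_change)
  then show "(\<lambda>\<omega>. extend0 u (X (time_change A s \<omega>) \<omega>)) \<in> borel_measurable (P (Some x))"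
    by (simp add: measurable_P_iff)
  show "AE \<omega> in P (Some x). extend0 u (X (time_change A s \<omega>) \<omega>) = extend0 u (Y s \<omega>)"
    using AE_not_exceptional by eventually_elim (simp add: Y_eq_time_change)
qed

text \<open>A version of \<open>f (Y\<^sub>s)\<close> that is measurable with respect to the augmented \<open>\<sigma>\<close>-algebra: the
  exceptional set is only known to belong to the possibly larger \<open>\<sigma>\<close>-algebra of \<open>M\<close>.\<close>

definition path_value :: "'x c0 \<Rightarrow> real \<Rightarrow> 'w \<Rightarrow> ennreal" where
  "path_value f s \<omega> = limsup (\<lambda>n. ennreal (extend0 (c0_apply f) (X (grid_after n (rational_time_change A s \<omega>)) \<omega>)))"

lemma measurable_path_value:
  "(\<lambda>(s, \<omega>). path_value f s \<omega>) \<in> borel_measurable (borel \<Otimes>\<^sub>M augmented_filtration X P \<infinity>)"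
proof -
  let ?N = "borel \<Otimes>\<^sub>M augmented_filtration X P \<infinity> :: (real \<times> 'w) measure"
  have [measurable]: "(\<lambda>x. X (grid_after n (rational_time_change A (fst x) (snd x))) (snd x))
      \<in> measurable ?N cemetery_borel" for n
  proof (rule measurable_X_grid)
    show "(\<lambda>x. rational_time_change A (fst x) (snd x)) \<in> borel_measurable ?N"
      using measurable_time_change_infinity by (simp add: case_prod_unfold)
    show "(\<lambda>x. X c (snd x)) \<in> measurable ?N cemetery_borel" for c
      by (rule measurable_compose[OF measurable_snd measurable_X_infinity])
  qed
  show ?thesis
    unfolding path_value_def case_prod_unfold by measurable
qed

text \<open>The shifted path may itself be exceptional, so its right continuity cannot be used. Grid
  times of the shifted path become times after \<tau>_{s+r} on the original one, and the limit is
  taken there. If \<tau>_s = \<infinity>, both sides sit at the cemetery.\<close>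

lemma path_value_shift:
  assumes \<omega>: "\<omega> \<notin> exceptional" and "0 \<le> s" "0 \<le> r"
  shows "path_value f r (\<theta> (rational_time_change A s \<omega>) \<omega>) = ennreal (extend0 (c0_apply f) (Y (s + r) \<omega>))"
proof (cases "rational_time_change A s \<omega> = \<infinity>")
  case True
  then have "rational_time_change A (s + r) \<omega> = \<infinity>"
    using rational_time_change_mono[of s "s + r" A \<omega>] \<open>0 \<le> r\<close> by (simp add: top_unique)
  then show ?thesis
    using True \<omega> X_infinity by (simp add: path_value_def shift Y_def Limsup_const)
next
  case False
  have good: "good_path \<omega>"
    by (rule exceptional(3)[OF \<omega>])
  then have reg: "regular_path A \<omega>"
    by (simp add: good_path_def)
  obtain \<tau> where \<tau>: "rational_time_change A s \<omega> = ennreal \<tau>" "0 \<le> \<tau>"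
    using False by (cases "rational_time_change A s \<omega>") auto
  let ?\<omega> = "\<theta> (ennreal \<tau>) \<omega>"
  have reg': "regular_path A ?\<omega>"
    using good \<tau>(2) by (simp add: good_path_def)
  have tc: "rational_time_change A (s + r) \<omega> = ennreal \<tau> + rational_time_change A r ?\<omega>"
    using time_change_add[OF reg assms(2,3), of \<tau> ?\<omega>] \<tau> good
    by (simp add: rational_time_change_eq[OF reg] rational_time_change_eq[OF reg'] good_path_def)
  let ?g = "\<lambda>n. grid_after n (rational_time_change A r ?\<omega>) + ennreal \<tau>"
  have "(\<lambda>n. extend0 (c0_apply f) (X (?g n) \<omega>)) \<longlonglongrightarrow>
      extend0 (c0_apply f) (X (rational_time_change A r ?\<omega> + ennreal \<tau>) \<omega>)"
    by (intro X_right_continuous[OF \<omega>] add_right_mono grid_after_ge tendsto_add grid_after_tendsto tendsto_const)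
  then have "(\<lambda>n. ennreal (extend0 (c0_apply f) (X (?g n) \<omega>))) \<longlonglongrightarrow> ennreal (extend0 (c0_apply f) (Y (s + r) \<omega>))"
    using \<omega> tc by (intro tendsto_ennrealI) (simp add: Y_def add.commute)
  then show ?thesis
    unfolding path_value_def \<tau>(1) shift by (rule lim_imp_Limsup[rotated]) simp
qed

lemma path_value_eq:
  "\<omega> \<notin> exceptional \<Longrightarrow> path_value f s \<omega> = ennreal (extend0 (c0_apply f) (Y s \<omega>))"
  unfolding path_value_def Y_def
  by (auto intro!: lim_imp_Limsup tendsto_ennrealI X_grid_tendsto)

lemma path_value_None:
  assumes "X 0 \<omega> = None"
  shows "path_value f s \<omega> = 0"
proof -
  have "X t \<omega> = None" for t
    using assms by (rule absorbing) simp
  then show ?thesis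
    by (simp add: path_value_def Limsup_const)
qed

text \<open>The strong Markov property at \<tau>_s for the functional that integrates g(r) f(Y_r)
  over r \<ge> 0. The function h is its expectation for each starting point; requiring it to be
  Borel avoids any claim about a single P_r f.\<close>

theorem Markov_time_change:
  fixes g :: "real \<Rightarrow> ennreal" and h :: "'x \<Rightarrow> ennreal"
  assumes g [measurable]: "g \<in> borel_measurable borel" and h [measurable]: "h \<in> borel_measurable borel"
    and gh: "\<And>x. (\<integral>\<^sup>+ r\<in>{0..}. g r * (\<integral>\<^sup>+ \<omega>. ennreal (extend0 (c0_apply f) (Y r \<omega>)) \<partial>P (Some x)) \<partial>lborel) = h x"
    and s: "0 \<le> s"
  shows "(\<integral>\<^sup>+ r\<in>{0..}. g r * (\<integral>\<^sup>+ \<omega>. ennreal (extend0 (c0_apply f) (Y (s + r) \<omega>)) \<partial>P x) \<partial>lborel) =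
    (\<integral>\<^sup>+ \<omega>. extend0 h (Y s \<omega>) \<partial>P x)"
proof -
  have swap: "(\<integral>\<^sup>+ r\<in>{0..}. g r * (\<integral>\<^sup>+ \<omega>. ennreal (extend0 (c0_apply f) (Y (c + r) \<omega>)) \<partial>P y) \<partial>lborel) =
      (\<integral>\<^sup>+ \<omega>. (\<integral>\<^sup>+ r\<in>{0..}. g r * ennreal (extend0 (c0_apply f) (Y (c + r) \<omega>)) \<partial>lborel) \<partial>P y)" for c y
  proof -
    interpret prob_space "P y" by (rule prob_P)
    interpret pair_sigma_finite lborel "P y" ..
    have [measurable]: "(\<lambda>x. Y (c + fst x) (snd x)) \<in> measurable (lborel \<Otimes>\<^sub>M P y) cemetery_borel"
    proof -
      have "(\<lambda>x. (c + fst x, snd x)) \<in> measurable (lborel \<Otimes>\<^sub>M P y) (lborel \<Otimes>\<^sub>M P y)"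
        by measurable
      from measurable_compose[OF this measurable_Y_pair(1)] show ?thesis by simp
    qed
    have m: "(\<lambda>\<omega>. ennreal (extend0 (c0_apply f) (Y (c + r) \<omega>))) \<in> borel_measurable (P y)" for r
      using measurable_Y_fixed[of "c + r" y] by measurable
    have "(\<integral>\<^sup>+ r\<in>{0..}. g r * (\<integral>\<^sup>+ \<omega>. ennreal (extend0 (c0_apply f) (Y (c + r) \<omega>)) \<partial>P y) \<partial>lborel) =
        (\<integral>\<^sup>+ r. (\<integral>\<^sup>+ \<omega>. g r * ennreal (extend0 (c0_apply f) (Y (c + r) \<omega>)) * indicator {0..} r \<partial>P y) \<partial>lborel)"
    proof (intro nn_integral_cong)
      fix r :: real
      show "g r * (\<integral>\<^sup>+ \<omega>. ennreal (extend0 (c0_apply f) (Y (c + r) \<omega>)) \<partial>P y) * indicator {0..} r =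
          (\<integral>\<^sup>+ \<omega>. g r * ennreal (extend0 (c0_apply f) (Y (c + r) \<omega>)) * indicator {0..} r \<partial>P y)"
        by (cases "0 \<le> r") (simp_all add: nn_integral_cmult[OF m])
    qed
    also have "\<dots> = (\<integral>\<^sup>+ \<omega>. (\<integral>\<^sup>+ r. g r * ennreal (extend0 (c0_apply f) (Y (c + r) \<omega>)) * indicator {0..} r \<partial>lborel) \<partial>P y)"
      by (rule Fubini'[symmetric]) measurable
    finally show ?thesis .
  qed
  let ?V = "\<lambda>\<omega>. \<integral>\<^sup>+ r\<in>{0..}. g r * path_value f r \<omega> \<partial>lborel"
  let ?J = "\<lambda>\<omega>. \<integral>\<^sup>+ r\<in>{0..}. g r * ennreal (extend0 (c0_apply f) (Y (s + r) \<omega>)) \<partial>lborel"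
  have "(\<integral>\<^sup>+ \<omega>. ?J \<omega> \<partial>P x) = (\<integral>\<^sup>+ \<omega>. extend0 h (X (rational_time_change A s \<omega>) \<omega>) \<partial>P x)"
  proof (rule strong_Markov_functional[OF stopping_time_time_change])
    have "(\<lambda>x. (snd x, fst x)) \<in> measurable (augmented_filtration X P \<infinity> \<Otimes>\<^sub>M lborel)
        (borel \<Otimes>\<^sub>M augmented_filtration X P \<infinity>)"
      by (intro measurable_Pair) (auto intro: measurable_compose[OF measurable_snd])
    from measurable_compose[OF this measurable_path_value]
    have [measurable]: "(\<lambda>x. path_value f (snd x) (fst x)) \<in> borel_measurable (augmented_filtration X P \<infinity> \<Otimes>\<^sub>M lborel)"
      by simp
    show "?V \<in> borel_measurable (augmented_filtration X P \<infinity>)"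
      by (intro lborel.borel_measurable_nn_integral) measurable
    show "AE \<omega> in P x. ?J \<omega> = ?V (\<theta> (rational_time_change A s \<omega>) \<omega>)"
      using AE_not_exceptional
    proof eventually_elim
      case (elim \<omega>)
      show ?case
        by (intro nn_integral_cong) (auto simp: path_value_shift[OF elim s] indicator_def)
    qed
    show "extend0 h \<in> borel_measurable cemetery_borel"
      by measurable
    show "(\<integral>\<^sup>+ \<omega>. ?V \<omega> \<partial>P y) = extend0 h y" for y
    proof (cases y)
      case None
      have "AE \<omega> in P y. ?V \<omega> = 0"
        using AE_P_X_0[of y] by eventually_elim (simp add: None path_value_None)
      then have "(\<integral>\<^sup>+ \<omega>. ?V \<omega> \<partial>P y) = (\<integral>\<^sup>+ \<omega>. 0 \<partial>P y)"
        by (rule nn_integral_cong_AE)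
      then show ?thesis by (simp add: None)
    next
      case (Some z)
      have "(\<integral>\<^sup>+ \<omega>. ?V \<omega> \<partial>P y) = (\<integral>\<^sup>+ \<omega>. (\<integral>\<^sup>+ r\<in>{0..}. g r * ennreal (extend0 (c0_apply f) (Y (0 + r) \<omega>)) \<partial>lborel) \<partial>P y)"
      proof (rule nn_integral_cong_AE)
        show "AE \<omega> in P y. ?V \<omega> = (\<integral>\<^sup>+ r\<in>{0..}. g r * ennreal (extend0 (c0_apply f) (Y (0 + r) \<omega>)) \<partial>lborel)"
          using AE_not_exceptional by eventually_elim (simp add: path_value_eq)
      qed
      also have "\<dots> = h z"
        unfolding swap[symmetric] using gh[of z] by (simp add: Some)
      finally show ?thesis by (simp add: Some)
    qed
  qed
  also have "\<dots> = (\<integral>\<^sup>+ \<omega>. extend0 h (Y s \<omega>) \<partial>P x)"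
  proof (rule nn_integral_cong_AE)
    show "AE \<omega> in P x. extend0 h (X (rational_time_change A s \<omega>) \<omega>) = extend0 h (Y s \<omega>)"
      using AE_not_exceptional by eventually_elim (simp add: Y_def)
  qed
  finally show ?thesis
    unfolding swap .
qed

end

section \<open>Potentials and resolvents\<close>

lemma lower_semicontinuous_Liminf:
  fixes f :: "'b :: topological_space \<Rightarrow> ennreal" and z :: "nat \<Rightarrow> 'b"
  assumes "lower_semicontinuous f" "z \<longlonglongrightarrow> a"
  shows "f a \<le> liminf (\<lambda>n. f (z n))"
  unfolding le_Liminf_iff
proof (intro allI impI)
  fix c assume "c < f a"
  moreover have "open {z. c < f z}"
    using assms(1) by (simp add: lower_semicontinuous_def)
  ultimately show "eventually (\<lambda>n. c < f (z n)) sequentially"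
    using topological_tendstoD[OF assms(2), of "{z. c < f z}"] by simp
qed

locale kato_time_change = time_changed_process M F X \<theta> P A
  for M :: "'w measure" and F :: "ennreal \<Rightarrow> 'w measure"
    and X :: "ennreal \<Rightarrow> 'w \<Rightarrow> 'x :: {metric_space, second_countable_topology} option"
    and \<theta> :: "ennreal \<Rightarrow> 'w \<Rightarrow> 'w" and P :: "'x option \<Rightarrow> 'w measure"
    and A :: "real \<Rightarrow> 'w \<Rightarrow> real" +
  fixes p :: "real \<Rightarrow> 'x \<Rightarrow> 'x \<Rightarrow> ennreal" and \<mu> :: "'x measure"
  assumes lsc_green: "lower_semicontinuous (\<lambda>(x, y). green p 0 x y)"
    and kato: "kato_measure p \<mu>"
    and revuz: "revuz_potential_formula X P p A \<mu>"
begin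

lemma sets_\<mu> [measurable_cong, simp]: "sets \<mu> = sets borel"
  using kato by (simp add: kato_measure_def radon_measure_def)

lemma measurable_green [measurable]: "green p 0 x \<in> borel_measurable borel"
proof (rule borel_measurableI_greater)
  fix c :: ennreal
  have "open ((\<lambda>y. (x, y)) -` {z. c < (case z of (x, y) \<Rightarrow> green p 0 x y)})"
    using lsc_green by (intro open_vimage) (auto simp: lower_semicontinuous_def intro!: continuous_intros)
  then show "{y \<in> space borel. c < green p 0 x y} \<in> sets borel"
    by (simp add: vimage_def)
qed

definition green_potential :: "('x \<Rightarrow> ennreal) \<Rightarrow> 'x \<Rightarrow> ennreal" where
  "green_potential f x = (\<integral>\<^sup>+ y. green p 0 x y * f y \<partial>\<mu>)"

text \<open>The C_0 function G^\<mu>1. Its norm is the constant in all bounds that are uniform in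
  time or in \<alpha>.\<close>

definition kato_function :: "'x c0" where
  "kato_function = (SOME g. \<forall>x. 0 \<le> c0_apply g x \<and> green_potential (\<lambda>_. 1) x = ennreal (c0_apply g x))"

lemma kato_function:
  "0 \<le> c0_apply kato_function x" "green_potential (\<lambda>_. 1) x = ennreal (c0_apply kato_function x)"
proof -
  have "\<exists>g :: 'x c0. \<forall>x. 0 \<le> c0_apply g x \<and> green_potential (\<lambda>_. 1) x = ennreal (c0_apply g x)"
    using kato by (simp add: kato_measure_def green_potential_def)
  from someI_ex[OF this]
  show "0 \<le> c0_apply kato_function x" "green_potential (\<lambda>_. 1) x = ennreal (c0_apply kato_function x)"
    unfolding kato_function_def by blast+
qed

lemma green_potential_le:
  assumes [measurable]: "f \<in> borel_measurable borel" and "\<And>y. f y \<le> ennreal c" "0 \<le> c"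
  shows "green_potential f x \<le> ennreal (c * c0_apply kato_function x)"
proof -
  have "green_potential f x \<le> (\<integral>\<^sup>+ y. ennreal c * (green p 0 x y * 1) \<partial>\<mu>)"
    unfolding green_potential_def using assms(2)
    by (intro nn_integral_mono) (auto simp: mult.commute intro!: mult_right_mono)
  also have "\<dots> = ennreal c * green_potential (\<lambda>_. 1) x"
    unfolding green_potential_def by (rule nn_integral_cmult) measurable
  finally show ?thesis
    using kato_function[of x] assms(3) by (simp add: ennreal_mult)
qed

text \<open>Fatou's lemma for the measure with density f with respect to \<mu>, applied to the lower
  semicontinuous kernel.\<close>

lemma green_potential_lsc:
  fixes z :: "nat \<Rightarrow> 'x"
  assumes [measurable]: "f \<in> borel_measurable borel" and z: "z \<longlonglongrightarrow> a"
  shows "green_potential f a \<le> liminf (\<lambda>n. green_potential f (z n))"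
proof -
  have eq: "green_potential f x = (\<integral>\<^sup>+ y. green p 0 x y \<partial>density \<mu> f)" for x
    unfolding green_potential_def by (simp add: nn_integral_density mult.commute)
  have "(\<integral>\<^sup>+ y. green p 0 a y \<partial>density \<mu> f) \<le> (\<integral>\<^sup>+ y. liminf (\<lambda>n. green p 0 (z n) y) \<partial>density \<mu> f)"
  proof (rule nn_integral_mono)
    fix y :: 'x
    have "(\<lambda>n. (z n, y)) \<longlonglongrightarrow> (a, y)"
      using z by (intro tendsto_intros)
    from lower_semicontinuous_Liminf[OF lsc_green this]
    show "green p 0 a y \<le> liminf (\<lambda>n. green p 0 (z n) y)" by simp
  qed
  also have "\<dots> \<le> liminf (\<lambda>n. \<integral>\<^sup>+ y. green p 0 (z n) y \<partial>density \<mu> f)"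
    by (rule nn_integral_liminf) measurable
  finally show ?thesis
    unfolding eq .
qed

text \<open>The strong Feller property: the potentials of \<open>f\<close> and of \<open>c - f\<close> are both lower
  semicontinuous, and their sum is a multiple of the continuous potential of \<open>1\<close>.\<close>

lemma green_potential_c0:
  fixes f :: "'x \<Rightarrow> real"
  assumes f [measurable]: "f \<in> borel_measurable borel" and bounds: "\<And>y. 0 \<le> f y" "\<And>y. f y \<le> c"
  obtains v where "\<And>x. 0 \<le> c0_apply v x" "\<And>x. green_potential (\<lambda>y. ennreal (f y)) x = ennreal (c0_apply v x)"
proof -
  have c: "0 \<le> c"
    using bounds[of undefined] by simp
  let ?g = "c0_apply kato_function"
  define a where "a x = enn2real (green_potential (\<lambda>y. ennreal (f y)) x)" for x
  define b where "b x = enn2real (green_potential (\<lambda>y. ennreal (c - f y)) x)" for x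
  have a_le: "green_potential (\<lambda>y. ennreal (f y)) x \<le> ennreal (c * ?g x)" for x
    using bounds c by (intro green_potential_le) (auto intro: ennreal_leI)
  have b_le: "green_potential (\<lambda>y. ennreal (c - f y)) x \<le> ennreal (c * ?g x)" for x
    using bounds c by (intro green_potential_le) (auto intro: ennreal_leI)
  have a_eq: "green_potential (\<lambda>y. ennreal (f y)) x = ennreal (a x)" for x
    using a_le[of x] unfolding a_def by (simp add: order_le_less_trans[OF _ ennreal_less_top])
  have b_eq: "green_potential (\<lambda>y. ennreal (c - f y)) x = ennreal (b x)" for x
    using b_le[of x] unfolding b_def by (simp add: order_le_less_trans[OF _ ennreal_less_top])
  have nonneg: "0 \<le> a x" "0 \<le> b x" for x
    by (simp_all add: a_def b_def)
  have sum: "a x + b x = c * ?g x" for x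
  proof -
    have "ennreal (a x) + ennreal (b x) =
        (\<integral>\<^sup>+ y. green p 0 x y * ennreal (f y) + green p 0 x y * ennreal (c - f y) \<partial>\<mu>)"
      unfolding a_eq[symmetric] b_eq[symmetric] green_potential_def by (rule nn_integral_add[symmetric]) measurable
    also have "\<dots> = (\<integral>\<^sup>+ y. ennreal c * (green p 0 x y * 1) \<partial>\<mu>)"
    proof (rule nn_integral_cong)
      fix y :: 'x
      have "ennreal (f y) + ennreal (c - f y) = ennreal c"
        using bounds[of y] by (simp add: ennreal_plus[symmetric] del: ennreal_plus)
      then show "green p 0 x y * ennreal (f y) + green p 0 x y * ennreal (c - f y) = ennreal c * (green p 0 x y * 1)"
        unfolding distrib_left[symmetric] by (simp add: mult.commute)
    qed
    also have "\<dots> = ennreal c * green_potential (\<lambda>_. 1) x"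
      unfolding green_potential_def by (rule nn_integral_cmult) measurable
    finally show ?thesis
      using kato_function[of x] nonneg[of x] c
      by (simp add: ennreal_plus[symmetric] ennreal_mult[symmetric] del: ennreal_plus)
  qed
  \<comment> \<open>Lower semicontinuity in terms of real values; a negative h x - e is separated
    because \<open>ennreal\<close> would truncate it to 0.\<close>
  have lower: "eventually (\<lambda>n. h x - e < h (z n)) sequentially"
    if "\<And>x. green_potential k x = ennreal (h x)" "\<And>x. 0 \<le> h x" "k \<in> borel_measurable borel"
      "z \<longlonglongrightarrow> x" "0 < e" for h k z x e
  proof (cases "h x - e < 0")
    case True
    then have "h x - e < h (z n)" for n
      using that(2)[of "z n"] by linarith
    then show ?thesis by simp
  next
    case False
    then have "ennreal (h x - e) < green_potential k x"
      using that by (simp add: ennreal_lessI)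
    also have "\<dots> \<le> liminf (\<lambda>n. green_potential k (z n))"
      by (rule green_potential_lsc[OF that(3,4)])
    finally have "eventually (\<lambda>n. ennreal (h x - e) < green_potential k (z n)) sequentially"
      by (rule less_LiminfD)
    then show ?thesis
      by eventually_elim (use False that(1) in \<open>simp add: ennreal_less_iff\<close>)
  qed
  have "continuous_on UNIV a"
    unfolding continuous_on_sequentially comp_def
  proof (intro allI ballI impI, elim conjE)
    fix z and x :: 'x assume z: "z \<longlonglongrightarrow> x"
    have g: "(\<lambda>n. ?g (z n)) \<longlonglongrightarrow> ?g x"
      using continuous_on_c0_apply[of UNIV kato_function] z by (auto simp: continuous_on_sequentially comp_def)
    show "(\<lambda>n. a (z n)) \<longlonglongrightarrow> a x"
    proof (rule tendstoI)
      fix e :: real assume e: "0 < e"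
      have "eventually (\<lambda>n. a x - e < a (z n)) sequentially"
        by (rule lower[OF a_eq nonneg(1) _ z e]) measurable
      \<comment> \<open>The upper bound for a comes from a = c G^\<mu>1 - b: half of e is spent on b
        and half on the continuous first term.\<close>
      moreover have "eventually (\<lambda>n. b x - e / 2 < b (z n)) sequentially"
        by (rule lower[OF b_eq nonneg(2) _ z]) (use e in \<open>measurable, simp\<close>)
      moreover have "eventually (\<lambda>n. c * ?g (z n) < c * ?g x + e / 2) sequentially"
        using tendsto_mult_left[OF g, of c] e by (intro order_tendstoD) auto
      ultimately show "eventually (\<lambda>n. dist (a (z n)) (a x) < e) sequentially"
      proof eventually_elim
        case (elim n)
        then show ?case
          using sum[of x] sum[of "z n"] by (auto simp: dist_real_def abs_less_iff)
      qed
    qed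
  qed
  moreover have "\<exists>K. compact K \<and> (\<forall>x. x \<notin> K \<longrightarrow> \<bar>a x\<bar> < e)" if e: "0 < e" for e
  proof -
    have "0 < e / (c + 1)"
      using e c by simp
    then obtain K where K: "compact K" "\<And>x. x \<notin> K \<Longrightarrow> \<bar>?g x\<bar> < e / (c + 1)"
      using c0_apply_vanishes by blast
    have "\<bar>a x\<bar> < e" if "x \<notin> K" for x
    proof -
      have "a x \<le> (c + 1) * ?g x"
        using sum[of x] nonneg(2)[of x] kato_function(1)[of x] by (simp add: distrib_right)
      also have "\<dots> < e"
        using K(2)[OF that] c kato_function(1)[of x] by (simp add: field_simps)
      finally show ?thesis
        using nonneg(1)[of x] by simp
    qed
    then show ?thesis
      using K(1) by blast
  qed
  ultimately have "a \<in> range c0_apply"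
    by (rule c0_functionI)
  then obtain v where "c0_apply v = a"
    by (metis image_iff)
  then show ?thesis
    using that[of v] nonneg(1) a_eq by simp
qed

text \<open>The potential formula for \<alpha> = 0 after the substitution t = \<tau>_s. Levels with
  \<tau>_s = \<infinity> carry no dA-mass and contribute 0, as Y is then at the cemetery.\<close>

lemma nn_integral_Y:
  fixes f :: "'x \<Rightarrow> real"
  assumes f: "f \<in> bounded_borel" and nonneg: "\<And>y. 0 \<le> f y"
  shows "(\<integral>\<^sup>+ s\<in>{0..}. (\<integral>\<^sup>+ \<omega>. ennreal (extend0 f (Y s \<omega>)) \<partial>P (Some x)) \<partial>lborel) =
    green_potential (\<lambda>y. ennreal (f y)) x"
proof -
  have [measurable]: "f \<in> borel_measurable borel"
    using f by (simp add: bounded_borel_def)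
  interpret prob_space "P (Some x)" by (rule prob_P)
  interpret pair_sigma_finite lborel "P (Some x)" ..
  have path: "(\<integral>\<^sup>+ t\<in>{0..}. ennreal (exp (- 0 * t) * extend0 f (X (ennreal t) \<omega>)) \<partial>pcaf_measure A \<omega>) =
      (\<integral>\<^sup>+ s\<in>{0..}. ennreal (extend0 f (Y s \<omega>)) \<partial>lborel)" if \<omega>: "\<omega> \<notin> exceptional" for \<omega>
  proof -
    have reg: "regular_path A \<omega>"
      using exceptional(3)[OF \<omega>] by (simp add: good_path_def)
    have tc [measurable]: "(\<lambda>s. time_change A s \<omega>) \<in> borel_measurable borel"
      using measurable_compose[OF measurable_Pair2'[of \<omega> M borel] measurable_time_change]
      by (simp add: space_M rational_time_change_eq[OF reg])
    have [measurable]: "(\<lambda>t. X (ennreal t) \<omega>) \<in> measurable borel cemetery_borel"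
    proof (rule measurable_cemeteryI[OF locally_compact], rule borel_measurable_LIMSEQ_real)
      fix u :: "'x c0" and t :: real
      show "(\<lambda>n. extend0 (c0_apply u) (X (grid_after n (ennreal t)) \<omega>)) \<longlonglongrightarrow> extend0 (c0_apply u) (X (ennreal t) \<omega>)"
        by (rule X_grid_tendsto[OF \<omega>])
    next
      fix u :: "'x c0" and n
      have [measurable]: "(\<lambda>t. X (grid_after n (ennreal t)) \<omega>) \<in> measurable borel cemetery_borel"
        by (rule measurable_X_grid) measurable
      show "(\<lambda>t. extend0 (c0_apply u) (X (grid_after n (ennreal t)) \<omega>)) \<in> borel_measurable borel"
        by measurable
    qed
    have "(\<integral>\<^sup>+ t\<in>{0..}. ennreal (exp (- 0 * t) * extend0 f (X (ennreal t) \<omega>)) \<partial>pcaf_measure A \<omega>) =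
        (\<integral>\<^sup>+ s\<in>{s. 0 \<le> s \<and> time_change A s \<omega> < \<infinity>}.
          ennreal (exp (- 0 * enn2real (time_change A s \<omega>)) * extend0 f (X (ennreal (enn2real (time_change A s \<omega>))) \<omega>)) \<partial>lborel)"
      by (rule nn_integral_pcaf_measure[OF reg tc]) measurable
    also have "\<dots> = (\<integral>\<^sup>+ s\<in>{0..}. ennreal (extend0 f (Y s \<omega>)) \<partial>lborel)"
    proof (rule nn_integral_cong)
      fix s :: real
      show "ennreal (exp (- 0 * enn2real (time_change A s \<omega>)) * extend0 f (X (ennreal (enn2real (time_change A s \<omega>))) \<omega>)) *
          indicator {s. 0 \<le> s \<and> time_change A s \<omega> < \<infinity>} s = ennreal (extend0 f (Y s \<omega>)) * indicator {0..} s"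
        using X_infinity[of \<omega>] Y_eq_time_change[OF \<omega>, of s]
        by (cases "time_change A s \<omega> = \<infinity>") (auto simp: indicator_def less_top)
    qed
    finally show ?thesis .
  qed
  have "(\<integral>\<^sup>+ s\<in>{0..}. (\<integral>\<^sup>+ \<omega>. ennreal (extend0 f (Y s \<omega>)) \<partial>P (Some x)) \<partial>lborel) =
      (\<integral>\<^sup>+ s. (\<integral>\<^sup>+ \<omega>. ennreal (extend0 f (Y s \<omega>)) * indicator {0..} s \<partial>P (Some x)) \<partial>lborel)"
    by (intro nn_integral_cong) (simp add: nn_integral_multc)
  also have "\<dots> = (\<integral>\<^sup>+ \<omega>. (\<integral>\<^sup>+ s\<in>{0..}. ennreal (extend0 f (Y s \<omega>)) \<partial>lborel) \<partial>P (Some x))"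
    by (rule Fubini'[symmetric]) measurable
  also have "\<dots> = (\<integral>\<^sup>+ \<omega>. (\<integral>\<^sup>+ t\<in>{0..}. ennreal (exp (- 0 * t) * extend0 f (X (ennreal t) \<omega>)) \<partial>pcaf_measure A \<omega>) \<partial>P (Some x))"
  proof (rule nn_integral_cong_AE)
    show "AE \<omega> in P (Some x). (\<integral>\<^sup>+ s\<in>{0..}. ennreal (extend0 f (Y s \<omega>)) \<partial>lborel) =
        (\<integral>\<^sup>+ t\<in>{0..}. ennreal (exp (- 0 * t) * extend0 f (X (ennreal t) \<omega>)) \<partial>pcaf_measure A \<omega>)"
      using AE_not_exceptional by eventually_elim (rule path[symmetric])
  qed
  also have "\<dots> = green_potential (\<lambda>y. ennreal (f y)) x"
    using revuz f nonneg unfolding revuz_potential_formula_def green_potential_def by blast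
  finally show ?thesis .
qed

section \<open>The semigroup of the time-changed process and its integrability in time\<close>

abbreviation Pt :: "real \<Rightarrow> ('x \<Rightarrow> real) \<Rightarrow> 'x \<Rightarrow> real" where
  "Pt \<equiv> P_check X P A"

lemma extend0_bounded: "(\<And>y. \<bar>u y\<bar> \<le> c) \<Longrightarrow> \<bar>extend0 u z\<bar> \<le> c" for u :: "'x \<Rightarrow> real"
  by (cases z) (auto intro: order_trans[OF abs_ge_zero])

lemma integrable_Y:
  fixes u :: "'x \<Rightarrow> real"
  assumes [measurable]: "u \<in> borel_measurable borel" and "\<And>y. \<bar>u y\<bar> \<le> c"
  shows "integrable (P z) (\<lambda>\<omega>. extend0 u (Y s \<omega>))"
proof -
  interpret prob_space "P z" by (rule prob_P)
  show ?thesis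
  proof (rule integrable_const_bound[of _ c])
    show "AE \<omega> in P z. norm (extend0 u (Y s \<omega>)) \<le> c"
      using extend0_bounded[OF assms(2)] by simp
  qed measurable
qed

lemma Pt_eq: "u \<in> borel_measurable borel \<Longrightarrow> Pt s u x = (\<integral> \<omega>. extend0 u (Y s \<omega>) \<partial>P (Some x))"
  by (rule P_check_eq)

lemma Pt_nn_integral:
  assumes [measurable]: "u \<in> borel_measurable borel" and "\<And>y. \<bar>u y\<bar> \<le> c" "\<And>y. 0 \<le> u y"
  shows "ennreal (Pt s u x) = (\<integral>\<^sup>+ \<omega>. ennreal (extend0 u (Y s \<omega>)) \<partial>P (Some x))"
proof -
  have "0 \<le> extend0 u z" for z
    using assms(3) by (cases z) auto
  then show ?thesis
    using integrable_Y[OF assms(1,2), of "Some x" s] by (simp add: Pt_eq nn_integral_eq_integral)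
qed

lemma Pt_nonneg:
  assumes "u \<in> borel_measurable borel" "\<And>y. 0 \<le> u y"
  shows "0 \<le> Pt s u x"
proof -
  have "0 \<le> extend0 u z" for z
    using assms(2) by (cases z) auto
  then show ?thesis
    unfolding Pt_eq[OF assms(1)] by (intro integral_nonneg_AE AE_I2)
qed

lemma Pt_mono:
  assumes "u \<in> borel_measurable borel" "\<And>y. \<bar>u y\<bar> \<le> c" "v \<in> borel_measurable borel" "\<And>y. \<bar>v y\<bar> \<le> d"
    and "\<And>y. u y \<le> v y"
  shows "Pt s u x \<le> Pt s v x"
proof -
  have "extend0 u z \<le> extend0 v z" for z
    using assms(5) by (cases z) auto
  then show ?thesis
    unfolding Pt_eq[OF assms(1)] Pt_eq[OF assms(3)]
    by (intro integral_mono integrable_Y[OF assms(1,2)] integrable_Y[OF assms(3,4)])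
qed

lemma abs_Pt_le_Pt_abs:
  assumes [measurable]: "u \<in> borel_measurable borel"
  shows "\<bar>Pt s u x\<bar> \<le> Pt s (\<lambda>y. \<bar>u y\<bar>) x"
proof -
  have "(\<lambda>y. \<bar>u y\<bar>) \<in> borel_measurable borel"
    by measurable
  moreover have "extend0 (\<lambda>y. \<bar>u y\<bar>) z = \<bar>extend0 u z\<bar>" for z
    by (cases z) auto
  ultimately show ?thesis
    using integral_abs_bound[of "P (Some x)" "\<lambda>\<omega>. extend0 u (Y s \<omega>)"]
    by (simp add: Pt_eq assms)
qed

lemma abs_Pt_le:
  assumes [measurable]: "u \<in> borel_measurable borel" and bound: "\<And>y. \<bar>u y\<bar> \<le> c"
  shows "\<bar>Pt s u x\<bar> \<le> c"
proof -
  interpret prob_space "P (Some x)" by (rule prob_P)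
  have "\<bar>Pt s u x\<bar> \<le> (\<integral> \<omega>. \<bar>extend0 u (Y s \<omega>)\<bar> \<partial>P (Some x))"
    unfolding Pt_eq[OF assms(1)] by (rule integral_abs_bound)
  also have "\<dots> \<le> (\<integral> \<omega>. c \<partial>P (Some x))"
    using integrable_Y[OF assms] extend0_bounded[OF bound] by (intro integral_mono integrable_abs) auto
  finally show ?thesis
    using prob_space by simp
qed

lemma Pt_linear:
  assumes "u \<in> borel_measurable borel" "\<And>y. \<bar>u y\<bar> \<le> c" "v \<in> borel_measurable borel" "\<And>y. \<bar>v y\<bar> \<le> d"
  shows "Pt s (\<lambda>y. a * u y + b * v y) x = a * Pt s u x + b * Pt s v x"
proof -
  have [measurable]: "u \<in> borel_measurable borel" "v \<in> borel_measurable borel"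
    by fact+
  have m: "(\<lambda>y. a * u y + b * v y) \<in> borel_measurable borel"
    by measurable
  have "extend0 (\<lambda>y. a * u y + b * v y) z = a * extend0 u z + b * extend0 v z" for z
    by (cases z) auto
  then show ?thesis
    using integrable_Y[OF assms(1,2), of "Some x" s] integrable_Y[OF assms(3,4), of "Some x" s]
    by (simp add: Pt_eq m assms(1,3))
qed

lemma Pt_c0_add: "Pt s (c0_apply (u + v)) x = Pt s (c0_apply u) x + Pt s (c0_apply v) x"
proof -
  have eq: "c0_apply (u + v) = (\<lambda>y. 1 * c0_apply u y + 1 * c0_apply v y)"
    by (rule ext) simp
  show ?thesis
    unfolding eq Pt_linear[OF borel_measurable_c0_apply abs_c0_apply_le_norm borel_measurable_c0_apply abs_c0_apply_le_norm]
    by simp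
qed

lemma Pt_c0_diff: "Pt s (c0_apply (u - v)) x = Pt s (c0_apply u) x - Pt s (c0_apply v) x"
proof -
  have eq: "c0_apply (u - v) = (\<lambda>y. 1 * c0_apply u y + (- 1) * c0_apply v y)"
    by (rule ext) simp
  show ?thesis
    unfolding eq Pt_linear[OF borel_measurable_c0_apply abs_c0_apply_le_norm borel_measurable_c0_apply abs_c0_apply_le_norm]
    by simp
qed

lemma Pt_c0_scaleR: "Pt s (c0_apply (a *\<^sub>R u)) x = a * Pt s (c0_apply u) x"
proof -
  have eq: "c0_apply (a *\<^sub>R u) = (\<lambda>y. a * c0_apply u y + 0 * c0_apply u y)"
    by (rule ext) simp
  show ?thesis
    unfolding eq Pt_linear[OF borel_measurable_c0_apply abs_c0_apply_le_norm borel_measurable_c0_apply abs_c0_apply_le_norm]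
    by simp
qed

lemma abs_Pt_c0_le: "\<bar>Pt s (c0_apply u) x\<bar> \<le> norm u"
  by (rule abs_Pt_le) (auto simp: abs_c0_apply_le_norm)

lemma measurable_Pt [measurable]:
  assumes [measurable]: "u \<in> borel_measurable borel"
  shows "(\<lambda>s. Pt s u x) \<in> borel_measurable borel"
proof -
  interpret prob_space "P (Some x)" by (rule prob_P)
  have "(\<lambda>s. \<integral> \<omega>. extend0 u (Y s \<omega>) \<partial>P (Some x)) \<in> borel_measurable lborel"
    by measurable
  then show ?thesis
    by (simp add: Pt_eq)
qed

text \<open>Right continuity of the paths and dominated convergence. The convergence is pointwise in
  x, with no uniformity claimed.\<close>

lemma Pt_right_continuous:
  assumes "\<And>n. s \<le> r n" "r \<longlonglongrightarrow> s"
  shows "(\<lambda>n. Pt (r n) (c0_apply u) x) \<longlonglongrightarrow> Pt s (c0_apply u) x"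
proof -
  interpret prob_space "P (Some x)" by (rule prob_P)
  show ?thesis
    unfolding Pt_eq[OF borel_measurable_c0_apply]
  proof (rule integral_dominated_convergence[where w = "\<lambda>_. norm u"])
    show "AE \<omega> in P (Some x). (\<lambda>n. extend0 (c0_apply u) (Y (r n) \<omega>)) \<longlonglongrightarrow> extend0 (c0_apply u) (Y s \<omega>)"
      by (intro AE_I2 Y_right_continuous assms)
    show "AE \<omega> in P (Some x). norm (extend0 (c0_apply u) (Y (r n) \<omega>)) \<le> norm u" for n
      using extend0_bounded[of "c0_apply u" "norm u"] abs_c0_apply_le_norm[of u] by simp
  qed simp_all
qed

lemma nn_integral_Pt:
  assumes "u \<in> borel_measurable borel" "\<And>y. \<bar>u y\<bar> \<le> c" "\<And>y. 0 \<le> u y"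
  shows "(\<integral>\<^sup>+ s\<in>{0..}. ennreal (Pt s u x) \<partial>lborel) = green_potential (\<lambda>y. ennreal (u y)) x"
proof -
  have "u \<in> bounded_borel"
    using assms by (auto simp: bounded_borel_def bounded_iff)
  then show ?thesis
    using nn_integral_Y[of u x] assms(3) by (simp add: Pt_nn_integral[OF assms])
qed

text \<open>The Kato condition in the form used for integrability: the semigroup is integrable over
  the whole time axis, so \<alpha> = 0 is admissible below.\<close>

lemma nn_integral_abs_Pt_le:
  assumes [measurable]: "u \<in> borel_measurable borel" and bound: "\<And>y. \<bar>u y\<bar> \<le> c"
  shows "(\<integral>\<^sup>+ s\<in>{0..}. ennreal \<bar>Pt s u x\<bar> \<partial>lborel) \<le> ennreal (c * c0_apply kato_function x)"
proof -
  have "(\<integral>\<^sup>+ s\<in>{0..}. ennreal \<bar>Pt s u x\<bar> \<partial>lborel) \<le> (\<integral>\<^sup>+ s\<in>{0..}. ennreal (Pt s (\<lambda>y. \<bar>u y\<bar>) x) \<partial>lborel)"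
    using abs_Pt_le_Pt_abs[OF assms(1)] by (intro nn_integral_mono mult_right_mono ennreal_leI) auto
  also have "\<dots> = green_potential (\<lambda>y. ennreal \<bar>u y\<bar>) x"
    using bound by (intro nn_integral_Pt[of _ c]) auto
  also have "\<dots> \<le> ennreal (c * c0_apply kato_function x)"
    using bound by (intro green_potential_le) (auto intro: ennreal_leI order_trans[OF abs_ge_zero bound])
  finally show ?thesis .
qed

lemma set_integrable_Pt:
  assumes [measurable]: "u \<in> borel_measurable borel" and bound: "\<And>y. \<bar>u y\<bar> \<le> c"
  shows "set_integrable lborel {0..} (\<lambda>s. Pt s u x)"
  unfolding set_integrable_def
proof (rule integrableI_bounded)
  show "(\<lambda>s. indicat_real {0..} s *\<^sub>R Pt s u x) \<in> borel_measurable lborel"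
    by measurable
  have "(\<integral>\<^sup>+ s. ennreal (norm (indicat_real {0..} s *\<^sub>R Pt s u x)) \<partial>lborel) = (\<integral>\<^sup>+ s\<in>{0..}. ennreal \<bar>Pt s u x\<bar> \<partial>lborel)"
    by (intro nn_integral_cong) (auto simp: indicator_def)
  also have "\<dots> < \<infinity>"
    using nn_integral_abs_Pt_le[OF assms, of x] by (rule order_le_less_trans) simp
  finally show "(\<integral>\<^sup>+ s. ennreal (norm (indicat_real {0..} s *\<^sub>R Pt s u x)) \<partial>lborel) < \<infinity>" .
qed

text \<open>The case \<open>\<alpha> = 0\<close> is the potential operator.\<close>

definition Res :: "real \<Rightarrow> ('x \<Rightarrow> real) \<Rightarrow> 'x \<Rightarrow> real" where
  "Res \<alpha> u x = (LBINT t:{0..}. exp (- \<alpha> * t) * Pt t u x)"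

lemma set_integrable_exp_Pt:
  assumes [measurable]: "u \<in> borel_measurable borel" and bound: "\<And>y. \<bar>u y\<bar> \<le> c" and \<alpha>: "0 \<le> \<alpha>"
  shows "set_integrable lborel {0..} (\<lambda>t. exp (- \<alpha> * t) * Pt t u x)"
proof (rule set_integrable_bound[OF set_integrable_Pt[OF assms(1,2)]])
  show "set_borel_measurable lborel {0..} (\<lambda>t. exp (- \<alpha> * t) * Pt t u x)"
    unfolding set_borel_measurable_def by measurable
  show "AE t in lborel. t \<in> {0..} \<longrightarrow> norm (exp (- \<alpha> * t) * Pt t u x) \<le> norm (Pt t u x)"
    using \<alpha> by (intro AE_I2) (auto simp: abs_mult mult_le_cancel_right2)
qed

text \<open>The damping factor is at most 1, so the bound for \<alpha> = 0 holds for all \<alpha>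
  \<ge> 0. This uniformity is what the Neumann series needs.\<close>

lemma abs_Res_le:
  assumes [measurable]: "u \<in> borel_measurable borel" and bound: "\<And>y. \<bar>u y\<bar> \<le> c" and \<alpha>: "0 \<le> \<alpha>"
  shows "\<bar>Res \<alpha> u x\<bar> \<le> c * norm kato_function"
proof -
  have c: "0 \<le> c"
    using bound[of undefined] by simp
  have "ennreal \<bar>Res \<alpha> u x\<bar> \<le> (\<integral>\<^sup>+ t. ennreal (norm (indicat_real {0..} t *\<^sub>R (exp (- \<alpha> * t) * Pt t u x))) \<partial>lborel)"
    unfolding Res_def set_lebesgue_integral_def
    using integral_norm_bound_ennreal[OF set_integrable_exp_Pt[OF assms, unfolded set_integrable_def]] by simp
  also have "\<dots> \<le> (\<integral>\<^sup>+ s\<in>{0..}. ennreal \<bar>Pt s u x\<bar> \<partial>lborel)"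
    using \<alpha> by (intro nn_integral_mono)
      (auto simp: indicator_def abs_mult mult_le_cancel_right2 intro!: ennreal_leI)
  also have "\<dots> \<le> ennreal (c * c0_apply kato_function x)"
    by (rule nn_integral_abs_Pt_le[OF assms(1,2)])
  finally have "\<bar>Res \<alpha> u x\<bar> \<le> c * c0_apply kato_function x"
    using c kato_function(1)[of x] by (simp add: ennreal_le_iff)
  also have "\<dots> \<le> c * norm kato_function"
    using c abs_c0_apply_le_norm[of kato_function x] by (intro mult_left_mono) auto
  finally show ?thesis .
qed

lemma Res_c0_diff:
  assumes "0 \<le> \<alpha>"
  shows "Res \<alpha> (c0_apply (u - v)) x = Res \<alpha> (c0_apply u) x - Res \<alpha> (c0_apply v) x"
proof -
  have "set_integrable lborel {0..} (\<lambda>t. exp (- \<alpha> * t) * Pt t (c0_apply w) x)" for w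
    by (rule set_integrable_exp_Pt[OF borel_measurable_c0_apply abs_c0_apply_le_norm assms])
  from set_integral_diff(2)[OF this this] show ?thesis
    unfolding Res_def Pt_c0_diff right_diff_distrib .
qed

lemma Res_c0_add:
  assumes "0 \<le> \<alpha>"
  shows "Res \<alpha> (c0_apply (u + v)) x = Res \<alpha> (c0_apply u) x + Res \<alpha> (c0_apply v) x"
proof -
  have "set_integrable lborel {0..} (\<lambda>t. exp (- \<alpha> * t) * Pt t (c0_apply w) x)" for w
    by (rule set_integrable_exp_Pt[OF borel_measurable_c0_apply abs_c0_apply_le_norm assms])
  from set_integral_add(2)[OF this this] show ?thesis
    unfolding Res_def Pt_c0_add distrib_left .
qed

lemma Res_c0_scaleR: "Res \<alpha> (c0_apply (a *\<^sub>R u)) x = a * Res \<alpha> (c0_apply u) x"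
  unfolding Res_def Pt_c0_scaleR by (simp add: mult.left_commute)

lemma Res_nn_integral:
  assumes "u \<in> borel_measurable borel" "\<And>y. \<bar>u y\<bar> \<le> c" "\<And>y. 0 \<le> u y" "0 \<le> \<alpha>"
  shows "ennreal (Res \<alpha> u x) = (\<integral>\<^sup>+ t\<in>{0..}. ennreal (exp (- \<alpha> * t)) * ennreal (Pt t u x) \<partial>lborel)"
    and "0 \<le> Res \<alpha> u x"
proof -
  have nonneg: "0 \<le> Pt t u x" for t
    by (rule Pt_nonneg[OF assms(1,3)])
  have "ennreal (Res \<alpha> u x) = (\<integral>\<^sup>+ t. ennreal (indicat_real {0..} t *\<^sub>R (exp (- \<alpha> * t) * Pt t u x)) \<partial>lborel)"
    unfolding Res_def set_lebesgue_integral_def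
    by (rule nn_integral_eq_integral[symmetric, OF set_integrable_exp_Pt[OF assms(1,2,4), unfolded set_integrable_def]])
      (use nonneg in auto)
  also have "\<dots> = (\<integral>\<^sup>+ t\<in>{0..}. ennreal (exp (- \<alpha> * t)) * ennreal (Pt t u x) \<partial>lborel)"
    using nonneg by (intro nn_integral_cong) (auto simp: indicator_def ennreal_mult)
  finally show "ennreal (Res \<alpha> u x) = (\<integral>\<^sup>+ t\<in>{0..}. ennreal (exp (- \<alpha> * t)) * ennreal (Pt t u x) \<partial>lborel)" .
  show "0 \<le> Res \<alpha> u x"
    unfolding Res_def set_lebesgue_integral_def using nonneg by (intro integral_nonneg_AE) auto
qed

text \<open>Fubini: \<open>R_check\<close> integrates over time first, \<open>Res\<close> over paths
  first. For \<alpha> > 0 the exponential dominates a bounded integrand.\<close>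

lemma R_check_eq_Res:
  assumes [measurable]: "u \<in> borel_measurable borel" and bound: "\<And>y. \<bar>u y\<bar> \<le> c" and \<alpha>: "0 < \<alpha>"
  shows "R_check X P A \<alpha> u x = Res \<alpha> u x"
proof -
  interpret prob_space "P (Some x)" by (rule prob_P)
  interpret pair_sigma_finite lborel "P (Some x)" ..
  let ?k = "\<lambda>t \<omega>. indicat_real {0..} t *\<^sub>R (exp (- \<alpha> * t) * extend0 u (Y t \<omega>))"
  let ?L = "\<lambda>\<omega>. LBINT t:{0..}. exp (- \<alpha> * t) * extend0 u (X (time_change A t \<omega>) \<omega>)"
  have L_eq: "(LBINT t. ?k t \<omega>) = ?L \<omega>" if "\<omega> \<notin> exceptional" for \<omega>
    using Y_eq_time_change[OF that] by (simp add: set_lebesgue_integral_def)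
  have meas: "(\<lambda>\<omega>. LBINT t. ?k t \<omega>) \<in> borel_measurable (P (Some x))"
    by (intro lborel.borel_measurable_lebesgue_integral) measurable
  have "R_check X P A \<alpha> u x = (\<integral> \<omega>. (LBINT t. ?k t \<omega>) \<partial>P (Some x))"
    unfolding R_check_def
  proof (rule integral_cong_AE)
    show "?L \<in> borel_measurable (P (Some x))"
      using measurable_modification[of "\<lambda>\<omega>. LBINT t. ?k t \<omega>" borel ?L] meas L_eq
      by (simp add: measurable_P_iff)
    show "AE \<omega> in P (Some x). ?L \<omega> = (LBINT t. ?k t \<omega>)"
      using AE_not_exceptional by eventually_elim (rule L_eq[symmetric])
  qed (rule meas)
  also have "\<dots> = (LBINT t. \<integral> \<omega>. ?k t \<omega> \<partial>P (Some x))"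
  proof (rule Fubini_integral)
    show "integrable (lborel \<Otimes>\<^sub>M P (Some x)) (\<lambda>(t, \<omega>). ?k t \<omega>)"
    proof (rule Fubini_integrable)
      show "(\<lambda>(t, \<omega>). ?k t \<omega>) \<in> borel_measurable (lborel \<Otimes>\<^sub>M P (Some x))"
        by measurable
      have int: "integrable (P (Some x)) (?k t)" for t
        using integrable_Y[OF assms(1,2), of "Some x" t] by simp
      then show "AE t in lborel. integrable (P (Some x)) (\<lambda>\<omega>. case (t, \<omega>) of (t, \<omega>) \<Rightarrow> ?k t \<omega>)"
        by simp
      show "integrable lborel (\<lambda>t. \<integral> \<omega>. norm (case (t, \<omega>) of (t, \<omega>) \<Rightarrow> ?k t \<omega>) \<partial>P (Some x))"
      proof (rule Bochner_Integration.integrable_bound)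
        show "integrable lborel (\<lambda>t. c * (indicat_real {0..} t *\<^sub>R exp (- \<alpha> * t)))"
          using set_integrable_exp(1)[OF \<alpha>, of 0] by (simp add: set_integrable_def)
        show "(\<lambda>t. \<integral> \<omega>. norm (case (t, \<omega>) of (t, \<omega>) \<Rightarrow> ?k t \<omega>) \<partial>P (Some x)) \<in> borel_measurable lborel"
          by measurable
        have "(\<integral> \<omega>. norm (?k t \<omega>) \<partial>P (Some x)) \<le> c * (indicat_real {0..} t * exp (- \<alpha> * t))" for t
        proof -
          have "(\<integral> \<omega>. norm (?k t \<omega>) \<partial>P (Some x)) \<le> (\<integral> \<omega>. c * (indicat_real {0..} t * exp (- \<alpha> * t)) \<partial>P (Some x))"
          proof (rule integral_mono)
            fix \<omega>
            show "norm (?k t \<omega>) \<le> c * (indicat_real {0..} t * exp (- \<alpha> * t))"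
              using extend0_bounded[OF bound, where z = "Y t \<omega>"]
              by (auto simp: indicator_def abs_mult mult.commute intro!: mult_right_mono)
          qed (use int in auto)
          then show ?thesis
            using prob_space by simp
        qed
        then show "AE t in lborel. norm (\<integral> \<omega>. norm (case (t, \<omega>) of (t, \<omega>) \<Rightarrow> ?k t \<omega>) \<partial>P (Some x)) \<le>
            norm (c * (indicat_real {0..} t *\<^sub>R exp (- \<alpha> * t)))"
          by (auto intro!: AE_I2 order_trans[OF _ abs_ge_self])
      qed
    qed
  qed
  also have "\<dots> = Res \<alpha> u x"
    unfolding Res_def set_lebesgue_integral_def by (simp add: Pt_eq)
  finally show ?thesis .
qed

section \<open>Invariance of C_0 under the resolvents\<close>

definition c0_Feller :: "real \<Rightarrow> bool" where
  "c0_Feller \<alpha> \<longleftrightarrow> (\<forall>u. Res \<alpha> (c0_apply u) \<in> range c0_apply)"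

text \<open>R_0 is the Green potential with respect to \<mu>, which is in C_0 for bounded
  nonnegative functions by the strong Feller property.\<close>

lemma c0_Feller_0: "c0_Feller 0"
  unfolding c0_Feller_def
proof
  fix u :: "'x c0"
  have pos: "\<exists>v. Res 0 (c0_apply w) = c0_apply v" if w: "\<And>y. 0 \<le> c0_apply w y" for w :: "'x c0"
  proof -
    have le: "c0_apply w y \<le> norm w" for y
      using abs_c0_apply_le_norm[of w y] by simp
    obtain v where v: "\<And>x. 0 \<le> c0_apply v x" "\<And>x. green_potential (\<lambda>y. ennreal (c0_apply w y)) x = ennreal (c0_apply v x)"
      using green_potential_c0[OF borel_measurable_c0_apply w le] by metis
    have "Res 0 (c0_apply w) x = c0_apply v x" for x
    proof -
      have "ennreal (Res 0 (c0_apply w) x) = ennreal (c0_apply v x)"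
        using Res_nn_integral(1)[of "c0_apply w" "norm w" 0 x] w abs_c0_apply_le_norm[of w]
          nn_integral_Pt[of "c0_apply w" "norm w" x] v(2)[of x] by simp
      then show ?thesis
        using v(1)[of x] Res_nn_integral(2)[of "c0_apply w" "norm w" 0 x] w abs_c0_apply_le_norm[of w]
        by simp
    qed
    then show ?thesis by blast
  qed
  obtain u1 u2 where u: "u = u1 - u2" "\<And>x. 0 \<le> c0_apply u1 x" "\<And>x. 0 \<le> c0_apply u2 x"
    using c0_parts[of u] by blast
  obtain v1 v2 where "Res 0 (c0_apply u1) = c0_apply v1" "Res 0 (c0_apply u2) = c0_apply v2"
    using pos u by meson
  then have "Res 0 (c0_apply u) = c0_apply (v1 - v2)"
    unfolding u(1) by (intro ext) (simp add: Res_c0_diff)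
  then show "Res 0 (c0_apply u) \<in> range c0_apply"
    by simp
qed

text \<open>The integrated Markov property with weight exp(-\<alpha> r). The assumption that
  R_\<alpha> u lies in C_0 provides the Borel function of the starting point that is required
  there.\<close>

lemma Pt_Res:
  assumes F: "c0_Feller \<alpha>" and \<alpha>: "0 \<le> \<alpha>" and s: "0 \<le> s" and v: "c0_apply v = Res \<alpha> (c0_apply u)"
  shows "Pt s (c0_apply v) x = (LBINT r:{0..}. exp (- \<alpha> * r) * Pt (s + r) (c0_apply u) x)"
    and "set_integrable lborel {0..} (\<lambda>r. exp (- \<alpha> * r) * Pt (s + r) (c0_apply u) x)"
proof -
  have pos: "Pt s (c0_apply z) x = (LBINT r:{0..}. exp (- \<alpha> * r) * Pt (s + r) (c0_apply w) x) \<and>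
      set_integrable lborel {0..} (\<lambda>r. exp (- \<alpha> * r) * Pt (s + r) (c0_apply w) x)"
    if w: "\<And>y. 0 \<le> c0_apply w y" and z: "c0_apply z = Res \<alpha> (c0_apply w)" for w z
  proof -
    have w_bound: "\<bar>c0_apply w y\<bar> \<le> norm w" for y
      by (rule abs_c0_apply_le_norm)
    have z_nonneg: "0 \<le> c0_apply z y" for y
      unfolding z by (rule Res_nn_integral(2)[OF borel_measurable_c0_apply w_bound w \<alpha>])
    note Pt_w = Pt_nn_integral[OF borel_measurable_c0_apply w_bound w]
    have nonneg: "0 \<le> Pt t (c0_apply w) x" for t
      by (rule Pt_nonneg[OF borel_measurable_c0_apply w])
    have nonneg_z: "0 \<le> Pt s (c0_apply z) x"
      by (rule Pt_nonneg[OF borel_measurable_c0_apply z_nonneg])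
    have "(\<integral>\<^sup>+ r\<in>{0..}. ennreal (exp (- \<alpha> * r)) * (\<integral>\<^sup>+ \<omega>. ennreal (extend0 (c0_apply w) (Y (s + r) \<omega>)) \<partial>P (Some x)) \<partial>lborel) =
        (\<integral>\<^sup>+ \<omega>. extend0 (\<lambda>y. ennreal (c0_apply z y)) (Y s \<omega>) \<partial>P (Some x))"
    proof (rule Markov_time_change[OF _ _ _ s])
      fix y
      show "(\<integral>\<^sup>+ r\<in>{0..}. ennreal (exp (- \<alpha> * r)) * (\<integral>\<^sup>+ \<omega>. ennreal (extend0 (c0_apply w) (Y r \<omega>)) \<partial>P (Some y)) \<partial>lborel) =
          ennreal (c0_apply z y)"
        unfolding z Res_nn_integral(1)[OF borel_measurable_c0_apply w_bound w \<alpha>] Pt_w ..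
    qed measurable
    also have "\<dots> = (\<integral>\<^sup>+ \<omega>. ennreal (extend0 (c0_apply z) (Y s \<omega>)) \<partial>P (Some x))"
    proof (rule nn_integral_cong)
      show "extend0 (\<lambda>y. ennreal (c0_apply z y)) (Y s \<omega>) = ennreal (extend0 (c0_apply z) (Y s \<omega>))" for \<omega>
        by (cases "Y s \<omega>") auto
    qed
    also have "\<dots> = ennreal (Pt s (c0_apply z) x)"
      by (rule Pt_nn_integral[OF borel_measurable_c0_apply abs_c0_apply_le_norm z_nonneg, symmetric])
    finally have "(\<integral>\<^sup>+ r\<in>{0..}. ennreal (exp (- \<alpha> * r)) * ennreal (Pt (s + r) (c0_apply w) x) \<partial>lborel) =
        ennreal (Pt s (c0_apply z) x)"
      unfolding Pt_w .
    moreover have "(\<integral>\<^sup>+ r. ennreal (indicat_real {0..} r *\<^sub>R (exp (- \<alpha> * r) * Pt (s + r) (c0_apply w) x)) \<partial>lborel) =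
        (\<integral>\<^sup>+ r\<in>{0..}. ennreal (exp (- \<alpha> * r)) * ennreal (Pt (s + r) (c0_apply w) x) \<partial>lborel)"
      using nonneg by (intro nn_integral_cong) (auto simp: indicator_def ennreal_mult)
    ultimately have *: "(\<integral>\<^sup>+ r. ennreal (indicat_real {0..} r *\<^sub>R (exp (- \<alpha> * r) * Pt (s + r) (c0_apply w) x)) \<partial>lborel) =
        ennreal (Pt s (c0_apply z) x)"
      by simp
    have [measurable]: "(\<lambda>r. Pt (s + r) (c0_apply w) x) \<in> borel_measurable borel"
      by (rule measurable_compose[OF _ measurable_Pt]) measurable
    have "has_bochner_integral lborel (\<lambda>r. indicat_real {0..} r *\<^sub>R (exp (- \<alpha> * r) * Pt (s + r) (c0_apply w) x)) (Pt s (c0_apply z) x)"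
      by (rule has_bochner_integral_nn_integral[OF _ _ nonneg_z *]) (use nonneg in auto)
    then show ?thesis
      by (simp add: set_lebesgue_integral_def set_integrable_def has_bochner_integral_iff)
  qed
  obtain u1 u2 where u: "u = u1 - u2" "\<And>x. 0 \<le> c0_apply u1 x" "\<And>x. 0 \<le> c0_apply u2 x"
    using c0_parts[of u] by blast
  obtain v1 v2 where v12: "c0_apply v1 = Res \<alpha> (c0_apply u1)" "c0_apply v2 = Res \<alpha> (c0_apply u2)"
    using F unfolding c0_Feller_def by (metis image_iff)
  have "v = v1 - v2"
    by (rule c0_apply_eqI) (simp add: v v12 u(1) Res_c0_diff[OF \<alpha>])
  with pos[OF u(2) v12(1)] pos[OF u(3) v12(2)]
  show "Pt s (c0_apply v) x = (LBINT r:{0..}. exp (- \<alpha> * r) * Pt (s + r) (c0_apply u) x)"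
    and "set_integrable lborel {0..} (\<lambda>r. exp (- \<alpha> * r) * Pt (s + r) (c0_apply u) x)"
    by (simp_all add: u(1) Pt_c0_diff right_diff_distrib set_integral_diff)
qed

text \<open>P_s R_\<alpha> u is exp(\<alpha> s) times the tail from s on of the integral defining
  R_\<alpha> u; the Laplace transform of this tail is known. Invariance of C_0 is assumed for
  \<alpha> only, so the equation can be used to derive it for \<beta>.\<close>

lemma resolvent_equation:
  assumes F: "c0_Feller \<alpha>" and \<alpha>: "0 \<le> \<alpha>" "\<alpha> < \<beta>" and v: "c0_apply v = Res \<alpha> (c0_apply u)"
  shows "Res \<beta> (c0_apply u) x = Res \<alpha> (c0_apply u) x - (\<beta> - \<alpha>) * Res \<beta> (c0_apply v) x"
proof -
  let ?h = "\<lambda>r. exp (- \<alpha> * r) * Pt r (c0_apply u) x"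
  have shift: "exp (- \<beta> * s) * Pt s (c0_apply v) x = exp (- (\<beta> - \<alpha>) * s) * (LBINT r:{s..}. ?h r)" if s: "0 \<le> s" for s
  proof -
    have "(LBINT r:{s..}. ?h r) = (LBINT r:{0..}. exp (- \<alpha> * s) * (exp (- \<alpha> * r) * Pt (s + r) (c0_apply u) x))"
      unfolding set_lebesgue_integral_def
      by (subst lborel_integral_real_affine[where c = 1 and t = s])
        (auto intro!: Bochner_Integration.integral_cong simp: indicator_def exp_add[symmetric] algebra_simps)
    also have "\<dots> = exp (- \<alpha> * s) * Pt s (c0_apply v) x"
      unfolding Pt_Res(1)[OF F \<alpha>(1) s v] by simp
    finally show ?thesis
      by (simp add: exp_add[symmetric] mult.assoc[symmetric]) (simp add: algebra_simps)
  qed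
  have "Res \<beta> (c0_apply v) x = (LBINT s:{0..}. exp (- (\<beta> - \<alpha>) * s) * (LBINT r:{s..}. ?h r))"
    unfolding Res_def
  proof (rule set_lebesgue_integral_cong)
    show "\<forall>s. s \<in> {0..} \<longrightarrow> exp (- \<beta> * s) * Pt s (c0_apply v) x =
        exp (- (\<beta> - \<alpha>) * s) * (LBINT r:{s..}. ?h r)"
      unfolding atLeast_iff using shift by blast
  qed simp
  also have "\<dots> = ((LBINT r:{0..}. ?h r) - (LBINT r:{0..}. exp (- (\<beta> - \<alpha>) * r) * ?h r)) / (\<beta> - \<alpha>)"
    using \<alpha> abs_c0_apply_le_norm[of u]
    by (intro laplace_tail_integral set_integrable_exp_Pt) auto
  also have "(LBINT r:{0..}. exp (- (\<beta> - \<alpha>) * r) * ?h r) = Res \<beta> (c0_apply u) x"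
    unfolding Res_def
    by (rule set_lebesgue_integral_cong) (auto simp: exp_add[symmetric] mult.assoc[symmetric] algebra_simps)
  finally show ?thesis
    using \<alpha> by (simp add: Res_def field_simps)
qed

text \<open>The resolvent equation inverts \<open>1 + (\<beta> - \<alpha>) R\<^sub>\<alpha>\<close> by a Neumann series as long as
  \<open>\<beta> - \<alpha>\<close> is small, uniformly in \<open>\<alpha>\<close>.\<close>

lemma c0_Feller_step:
  assumes F: "c0_Feller \<alpha>" and \<alpha>: "0 \<le> \<alpha>" "\<alpha> < \<beta>" and small: "(\<beta> - \<alpha>) * norm kato_function \<le> 1 / 2"
  shows "c0_Feller \<beta>"
  unfolding c0_Feller_def
proof
  fix u :: "'x c0"
  \<comment> \<open>The n-th partial sum of the series: with z = R_\<alpha> w and v an approximation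
    of R_\<beta> z, the function z - (\<beta> - \<alpha>) v approximates R_\<beta> w, and the
    smallness assumption halves the error.\<close>
  have approx: "\<exists>v. \<forall>x. \<bar>Res \<beta> (c0_apply w) x - c0_apply v x\<bar> \<le> norm w * norm kato_function / 2 ^ n" for n w
  proof (induction n arbitrary: w)
    case 0
    have "\<bar>Res \<beta> (c0_apply w) x - c0_apply 0 x\<bar> \<le> norm w * norm kato_function / 2 ^ 0" for x
      using abs_Res_le[of "c0_apply w" "norm w" \<beta> x] abs_c0_apply_le_norm[of w] \<alpha> by simp
    then show ?case by blast
  next
    case (Suc n)
    obtain z where z: "c0_apply z = Res \<alpha> (c0_apply w)"
      using F unfolding c0_Feller_def by (metis image_iff)
    obtain v where v: "\<And>x. \<bar>Res \<beta> (c0_apply z) x - c0_apply v x\<bar> \<le> norm z * norm kato_function / 2 ^ n"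
      using Suc[of z] by blast
    have "norm z \<le> norm w * norm kato_function"
      using abs_Res_le[of "c0_apply w" "norm w" \<alpha>] abs_c0_apply_le_norm[of w] \<alpha>
      by (intro norm_c0_le) (simp add: z)
    then have "(\<beta> - \<alpha>) * norm z \<le> (\<beta> - \<alpha>) * (norm w * norm kato_function)"
      using \<alpha> by (intro mult_left_mono) auto
    also have "\<dots> = norm w * ((\<beta> - \<alpha>) * norm kato_function)"
      by simp
    also have "\<dots> \<le> norm w * (1 / 2)"
      using small by (intro mult_left_mono) auto
    finally have z_small: "(\<beta> - \<alpha>) * norm z \<le> norm w / 2" by simp
    have "\<bar>Res \<beta> (c0_apply w) x - c0_apply (z - (\<beta> - \<alpha>) *\<^sub>R v) x\<bar> \<le> norm w * norm kato_function / 2 ^ Suc n" for x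
    proof -
      have "Res \<beta> (c0_apply w) x - c0_apply (z - (\<beta> - \<alpha>) *\<^sub>R v) x =
          - ((\<beta> - \<alpha>) * (Res \<beta> (c0_apply z) x - c0_apply v x))"
        unfolding resolvent_equation[OF F \<alpha> z] by (simp add: z algebra_simps)
      then have "\<bar>Res \<beta> (c0_apply w) x - c0_apply (z - (\<beta> - \<alpha>) *\<^sub>R v) x\<bar> =
          (\<beta> - \<alpha>) * \<bar>Res \<beta> (c0_apply z) x - c0_apply v x\<bar>"
        using \<alpha> by (simp add: abs_mult)
      also have "\<dots> \<le> (\<beta> - \<alpha>) * (norm z * norm kato_function / 2 ^ n)"
        using \<alpha> v by (intro mult_left_mono) auto
      also have "\<dots> = ((\<beta> - \<alpha>) * norm z) * (norm kato_function / 2 ^ n)"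
        by simp
      also have "\<dots> \<le> norm w / 2 * (norm kato_function / 2 ^ n)"
        using z_small by (intro mult_right_mono) auto
      finally show ?thesis by simp
    qed
    then show ?case by blast
  qed
  show "Res \<beta> (c0_apply u) \<in> range c0_apply"
  proof (rule c0_function_uniform_limit)
    fix e :: real assume "0 < e"
    have "(\<lambda>n. norm u * norm kato_function / 2 ^ n) \<longlonglongrightarrow> 0"
      using tendsto_mult_right_zero[OF LIMSEQ_inverse_realpow_zero[of 2], of "norm u * norm kato_function"]
      by (simp add: divide_inverse power_inverse)
    then have "eventually (\<lambda>n. norm u * norm kato_function / 2 ^ n < e) sequentially"
      by (rule order_tendstoD(2)[OF _ \<open>0 < e\<close>])
    then obtain n where n: "norm u * norm kato_function / 2 ^ n < e"
      by (auto simp: eventually_sequentially)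
    obtain v where v: "\<And>x. \<bar>Res \<beta> (c0_apply u) x - c0_apply v x\<bar> \<le> norm u * norm kato_function / 2 ^ n"
      using approx[of u n] by blast
    have "\<bar>Res \<beta> (c0_apply u) x - c0_apply v x\<bar> \<le> e" for x
      using v[of x] n by linarith
    then show "\<exists>v. \<forall>x. \<bar>Res \<beta> (c0_apply u) x - c0_apply v x\<bar> \<le> e"
      by blast
  qed
qed

text \<open>The admissible step d does not depend on \<alpha>, so finitely many steps lead from 0 to
  any \<alpha>.\<close>

theorem c0_Feller:
  assumes "0 \<le> \<alpha>"
  shows "c0_Feller \<alpha>"
proof -
  \<comment> \<open>The largest step would be 1 / (2 ||G^\<mu>1||); the summand 1 covers the case of
    norm 0.\<close>
  define d where "d = 1 / (2 * (norm kato_function + 1))"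
  have d: "0 < d"
    by (simp add: d_def add_nonneg_pos)
  have small: "t * norm kato_function \<le> 1 / 2" if "t \<le> d" for t
  proof -
    have "t * norm kato_function \<le> d * norm kato_function"
      using that by (intro mult_right_mono) auto
    also have "\<dots> \<le> 1 / 2"
    proof -
      have "0 < norm kato_function + 1"
        by (simp add: add_nonneg_pos)
      then show ?thesis
        by (simp add: d_def field_simps)
    qed
    finally show ?thesis .
  qed
  have "c0_Feller \<alpha>" if "0 \<le> \<alpha>" "\<alpha> \<le> real n * d" for n \<alpha>
    using that
  proof (induction n arbitrary: \<alpha>)
    case 0
    then show ?case using c0_Feller_0 by simp
  next
    case (Suc n)
    show ?case
    proof (cases "\<alpha> = 0")
      case False
      let ?\<gamma> = "max 0 (\<alpha> - d)"
      have "c0_Feller ?\<gamma>"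
        using Suc.prems d by (intro Suc.IH) (auto simp: algebra_simps)
      then show ?thesis
      proof (rule c0_Feller_step)
        show "(\<alpha> - ?\<gamma>) * norm kato_function \<le> 1 / 2"
          by (rule small) simp
      qed (use Suc.prems False d in auto)
    qed (simp add: c0_Feller_0)
  qed
  moreover obtain n where "\<alpha> \<le> real n * d"
    using real_arch_simple[of "\<alpha> / d"] d by (auto simp: field_simps)
  ultimately show ?thesis
    using assms by blast
qed

section \<open>The integrated semigroup\<close>

definition St :: "real \<Rightarrow> 'x c0 \<Rightarrow> 'x \<Rightarrow> real" where
  "St t u x = (LBINT r:{0..t}. Pt r (c0_apply u) x)"

lemma integrable_Pt: "integrable lborel (\<lambda>r. indicat_real {0..} r * Pt r (c0_apply u) x)"
  using set_integrable_Pt[OF borel_measurable_c0_apply abs_c0_apply_le_norm, of u x]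
  by (simp add: set_integrable_def)

lemma integrable_indicator_Pt:
  assumes "B \<in> sets borel"
  shows "integrable lborel (\<lambda>r. indicat_real B r * (indicat_real {0..} r * Pt r (c0_apply u) x))"
  using integrable_mult_indicator[OF _ integrable_Pt, of B] assms by simp

lemma St_eq: "St t u x = (LBINT r. indicat_real {0..t} r * (indicat_real {0..} r * Pt r (c0_apply u) x))"
  unfolding St_def set_lebesgue_integral_def
  by (intro Bochner_Integration.integral_cong) (auto simp: indicator_def)

lemma abs_St_le: "\<bar>St t u x\<bar> \<le> norm u * norm kato_function"
proof -
  have "ennreal \<bar>St t u x\<bar> \<le> (\<integral>\<^sup>+ r. ennreal (norm (indicat_real {0..t} r * (indicat_real {0..} r * Pt r (c0_apply u) x))) \<partial>lborel)"
    unfolding St_eq using integral_norm_bound_ennreal[OF integrable_indicator_Pt[of "{0..t}"]] by simp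
  also have "\<dots> \<le> (\<integral>\<^sup>+ s\<in>{0..}. ennreal \<bar>Pt s (c0_apply u) x\<bar> \<partial>lborel)"
    by (intro nn_integral_mono) (auto simp: indicator_def)
  also have "\<dots> \<le> ennreal (norm u * c0_apply kato_function x)"
    by (rule nn_integral_abs_Pt_le[OF borel_measurable_c0_apply abs_c0_apply_le_norm])
  finally have "\<bar>St t u x\<bar> \<le> norm u * c0_apply kato_function x"
    using kato_function(1)[of x] by (simp add: ennreal_le_iff)
  also have "\<dots> \<le> norm u * norm kato_function"
    using abs_c0_apply_le_norm[of kato_function x] by (intro mult_left_mono) auto
  finally show ?thesis .
qed

text \<open>The integrand is bounded by ||u||. The bound does not involve x, so it yields norm
  continuity in t.\<close>

lemma St_lipschitz:
  assumes "s \<le> t"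
  shows "\<bar>St t u x - St s u x\<bar> \<le> norm u * (t - s)"
proof -
  let ?k = "\<lambda>r. indicat_real {0..} r * Pt r (c0_apply u) x"
  have int: "integrable lborel (\<lambda>r. indicat_real {0..t} r * ?k r)" "integrable lborel (\<lambda>r. indicat_real {0..s} r * ?k r)"
    by (intro integrable_indicator_Pt; simp)+
  have "\<bar>St t u x - St s u x\<bar> = \<bar>LBINT r. indicat_real {0..t} r * ?k r - indicat_real {0..s} r * ?k r\<bar>"
    unfolding St_eq using int by simp
  also have "\<dots> \<le> (LBINT r. \<bar>indicat_real {0..t} r * ?k r - indicat_real {0..s} r * ?k r\<bar>)"
    by (rule integral_abs_bound)
  also have "\<dots> \<le> (LBINT r. norm u * indicat_real {s..t} r)"
  proof (rule integral_mono)
    fix r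
    show "\<bar>indicat_real {0..t} r * ?k r - indicat_real {0..s} r * ?k r\<bar> \<le> norm u * indicat_real {s..t} r"
      using abs_Pt_c0_le[of r u x] assms by (auto simp: indicator_def)
  qed (use int assms in auto)
  also have "\<dots> = norm u * (t - s)"
    using assms by simp
  finally show ?thesis .
qed

lemma St_continuous: "continuous_on B (\<lambda>t. St t u x)"
proof (rule lipschitz_on_continuous_on[OF lipschitz_onI])
  show "dist (St s u x) (St t u x) \<le> norm u * dist s t" for s t
    using St_lipschitz[of s t u x] St_lipschitz[of t s u x]
    by (cases "s \<le> t") (auto simp: dist_real_def)
qed simp

lemma measurable_St [measurable]: "(\<lambda>t. St t u x) \<in> borel_measurable borel"
  by (rule borel_measurable_continuous_onI[OF St_continuous])

definition resolvent :: "real \<Rightarrow> 'x c0 \<Rightarrow> 'x c0" where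
  "resolvent \<alpha> u = (SOME v. c0_apply v = Res \<alpha> (c0_apply u))"

lemma c0_apply_resolvent: "0 \<le> \<alpha> \<Longrightarrow> c0_apply (resolvent \<alpha> u) = Res \<alpha> (c0_apply u)"
  using c0_Feller[of \<alpha>] unfolding c0_Feller_def resolvent_def by (metis (mono_tags) image_iff someI)

lemma c0_apply_sum: "c0_apply (\<Sum>i\<in>I. f i) x = (\<Sum>i\<in>I. c0_apply (f i) x)"
  by (rule linear_sum[OF bounded_linear.linear[OF bounded_linear_c0_apply]])

text \<open>Replacing the indicator of [0, t] by a combination of exponentials changes the integral
  by at most ||u|| times the L^1 error, uniformly in x, and each exponential contributes an element
  of C_0.\<close>

lemma St_c0: "St t u \<in> range c0_apply"
proof (cases "0 \<le> t")
  case False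
  then have "St t u = c0_apply 0"
    by (simp add: St_def set_lebesgue_integral_def fun_eq_iff)
  then show ?thesis by simp
next
  case True
  show ?thesis
  proof (rule c0_function_uniform_limit)
    fix e :: real assume e: "0 < e"
    \<comment> \<open>The L^1 accuracy is divided by the bound for the integrand; the summand 1
      covers u = 0.\<close>
    then have pos: "0 < e / (norm u + 1)"
      by (simp add: add_nonneg_pos)
    obtain a n where an: "(\<integral>\<^sup>+ s\<in>{0..}. ennreal \<bar>indicat_real {0..t} s - (\<Sum>i\<le>n. a i * exp (- real (Suc i) * s))\<bar> \<partial>lborel)
        \<le> ennreal (e / (norm u + 1))"
      by (rule indicator_exp_approximation[OF True pos])
    let ?q = "\<lambda>s. indicat_real {0..t} s - (\<Sum>i\<le>n. a i * exp (- real (Suc i) * s))"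
    let ?v = "\<Sum>i\<le>n. a i *\<^sub>R resolvent (real (Suc i)) u"
    have "\<bar>St t u x - c0_apply ?v x\<bar> \<le> e" for x
    proof -
      let ?k = "\<lambda>s. indicat_real {0..} s * Pt s (c0_apply u) x"
      let ?r = "\<lambda>i s. a i * (indicat_real {0..} s * (exp (- real (Suc i) * s) * Pt s (c0_apply u) x))"
      have ptw: "indicat_real {0..t} s * ?k s - (\<Sum>i\<le>n. ?r i s) = ?q s * ?k s" for s
      proof -
        have "(\<Sum>i\<le>n. ?r i s) = (\<Sum>i\<le>n. a i * exp (- real (Suc i) * s)) * ?k s"
          unfolding sum_distrib_right by (intro sum.cong refl) (simp only: ac_simps)
        then show ?thesis
          by (simp only: left_diff_distrib)
      qed
      have int: "integrable lborel (\<lambda>s. indicat_real {0..t} s * ?k s)"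
        by (rule integrable_indicator_Pt) simp
      have int_r: "integrable lborel (?r i)" for i
        using set_integrable_exp_Pt[OF borel_measurable_c0_apply abs_c0_apply_le_norm, of "real (Suc i)" u x]
        by (intro integrable_mult_right) (simp add: set_integrable_def)
      have "c0_apply ?v x = (\<Sum>i\<le>n. LBINT s. ?r i s)"
        by (simp add: c0_apply_sum c0_apply_resolvent Res_def set_lebesgue_integral_def)
      also have "\<dots> = (LBINT s. \<Sum>i\<le>n. ?r i s)"
        using int_r by (intro Bochner_Integration.integral_sum[symmetric]) auto
      finally have "St t u x - c0_apply ?v x = (LBINT s. indicat_real {0..t} s * ?k s - (\<Sum>i\<le>n. ?r i s))"
        unfolding St_eq using int int_r by (subst Bochner_Integration.integral_diff) auto
      also have "\<dots> = (LBINT s. ?q s * ?k s)"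
        unfolding ptw ..
      finally have eq: "St t u x - c0_apply ?v x = (LBINT s. ?q s * ?k s)" .
      have "integrable lborel (\<lambda>s. indicat_real {0..t} s * ?k s - (\<Sum>i\<le>n. ?r i s))"
        using int int_r by (intro Bochner_Integration.integrable_diff Bochner_Integration.integrable_sum) auto
      also have "(\<lambda>s. indicat_real {0..t} s * ?k s - (\<Sum>i\<le>n. ?r i s)) = (\<lambda>s. ?q s * ?k s)"
        unfolding ptw ..
      finally have "ennreal \<bar>St t u x - c0_apply ?v x\<bar> \<le> (\<integral>\<^sup>+ s. ennreal (norm (?q s * ?k s)) \<partial>lborel)"
        unfolding eq real_norm_def[symmetric] by (rule integral_norm_bound_ennreal)
      also have "\<dots> \<le> (\<integral>\<^sup>+ s. ennreal (norm u) * (ennreal \<bar>?q s\<bar> * indicator {0..} s) \<partial>lborel)"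
      proof (rule nn_integral_mono)
        fix s
        have "\<bar>?q s\<bar> * \<bar>Pt s (c0_apply u) x\<bar> \<le> norm u * \<bar>?q s\<bar>"
          using mult_left_mono[OF abs_Pt_c0_le[of s u x], of "\<bar>?q s\<bar>"] by (simp add: mult.commute)
        then have "ennreal (\<bar>?q s\<bar> * \<bar>Pt s (c0_apply u) x\<bar>) \<le> ennreal (norm u) * ennreal \<bar>?q s\<bar>"
          unfolding ennreal_mult[OF norm_ge_zero abs_ge_zero, symmetric] by (rule ennreal_leI)
        then show "ennreal (norm (?q s * ?k s)) \<le> ennreal (norm u) * (ennreal \<bar>?q s\<bar> * indicator {0..} s)"
          by (cases "0 \<le> s") (simp_all add: abs_mult)
      qed
      also have "\<dots> = ennreal (norm u) * (\<integral>\<^sup>+ s\<in>{0..}. ennreal \<bar>?q s\<bar> \<partial>lborel)"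
        by (rule nn_integral_cmult) measurable
      also have "\<dots> \<le> ennreal (norm u) * ennreal (e / (norm u + 1))"
        using an by (rule mult_left_mono) simp
      also have "\<dots> = ennreal (norm u * (e / (norm u + 1)))"
        using pos by (intro ennreal_mult[symmetric] norm_ge_zero less_imp_le)
      finally have "\<bar>St t u x - c0_apply ?v x\<bar> \<le> norm u * (e / (norm u + 1))"
        using pos by (subst (asm) ennreal_le_iff) (auto simp del: times_divide_eq_right intro!: mult_nonneg_nonneg less_imp_le)
      also have "\<dots> \<le> e"
      proof -
        have "0 < norm u + 1"
          by (simp add: add_nonneg_pos)
        then show ?thesis
          using e by (simp add: field_simps)
      qed
      finally show ?thesis .
    qed
    then show "\<exists>v. \<forall>x. \<bar>St t u x - c0_apply v x\<bar> \<le> e"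
      by blast
  qed
qed

lemma measurable_St_space [measurable]: "St t u \<in> borel_measurable borel"
  using St_c0[of t u] borel_measurable_c0_apply by auto

section \<open>Time averages, Borel measurability in space and the semigroup property\<close>

lemma St_increment:
  assumes a: "0 \<le> a" and d: "0 \<le> d"
  shows "St (a + d) u x - St a u x = (LBINT q. indicat_real {a..a + d} q * Pt q (c0_apply u) x)"
    and "integrable lborel (\<lambda>q. indicat_real {a..a + d} q * Pt q (c0_apply u) x)"
proof -
  let ?k = "\<lambda>r. indicat_real {0..} r * Pt r (c0_apply u) x"
  have eq: "indicat_real {a..a + d} q * ?k q = indicat_real {a..a + d} q * Pt q (c0_apply u) x" for q
    using a by (auto simp: indicator_def)
  show int: "integrable lborel (\<lambda>q. indicat_real {a..a + d} q * Pt q (c0_apply u) x)"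
    using integrable_indicator_Pt[of "{a..a + d}" u x] unfolding eq by simp
  have "St (a + d) u x - St a u x = (LBINT r. indicat_real {0..a + d} r * ?k r - indicat_real {0..a} r * ?k r)"
    unfolding St_eq by (intro Bochner_Integration.integral_diff[symmetric] integrable_indicator_Pt) auto
  also have "\<dots> = (LBINT q. indicat_real {a..a + d} q * Pt q (c0_apply u) x)"
  proof (rule integral_cong_AE)
    show "AE r in lborel. indicat_real {0..a + d} r * ?k r - indicat_real {0..a} r * ?k r =
        indicat_real {a..a + d} r * Pt r (c0_apply u) x"
      by (rule AE_mp[OF AE_lborel_singleton[of a]]) (use a d in \<open>auto simp: indicator_def\<close>)
  qed measurable
  finally show "St (a + d) u x - St a u x = (LBINT q. indicat_real {a..a + d} q * Pt q (c0_apply u) x)" .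
qed

text \<open>The mean of P_r u over a window of length 1 / (n + 1) starting at a. Written with S it
  is a Borel function of x, which is not yet known for P_a u itself.\<close>

definition Pt_average :: "nat \<Rightarrow> real \<Rightarrow> 'x c0 \<Rightarrow> 'x \<Rightarrow> real" where
  "Pt_average n a u x = real (Suc n) * (St (a + 1 / real (Suc n)) u x - St a u x)"

lemma abs_Pt_average_le: "\<bar>Pt_average n a u x\<bar> \<le> norm u"
proof -
  have "\<bar>Pt_average n a u x\<bar> = real (Suc n) * \<bar>St (a + 1 / real (Suc n)) u x - St a u x\<bar>"
    by (simp add: Pt_average_def abs_mult)
  also have "\<dots> \<le> real (Suc n) * (norm u * (a + 1 / real (Suc n) - a))"
    by (intro mult_left_mono St_lipschitz) auto
  finally show ?thesis by simp
qed

lemma measurable_Pt_average [measurable]: "Pt_average n a u \<in> borel_measurable borel"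
  unfolding Pt_average_def[abs_def] by measurable

text \<open>Rescaling the window to [0, 1] leaves right continuity in time and dominated
  convergence.\<close>

lemma Pt_average_tendsto:
  assumes a: "0 \<le> a"
  shows "(\<lambda>n. Pt_average n a u x) \<longlonglongrightarrow> Pt a (c0_apply u) x"
proof -
  have eq: "Pt_average n a u x = (LBINT w. indicat_real {0..1} w * Pt (a + 1 / real (Suc n) * w) (c0_apply u) x)" for n
  proof -
    let ?d = "1 / real (Suc n)"
    have "St (a + ?d) u x - St a u x = (LBINT q. indicat_real {a..a + ?d} q * Pt q (c0_apply u) x)"
      using a by (intro St_increment(1)) auto
    also have "\<dots> = \<bar>?d\<bar> *\<^sub>R (LBINT w. indicat_real {a..a + ?d} (a + ?d * w) * Pt (a + ?d * w) (c0_apply u) x)"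
      by (rule lborel_integral_real_affine) simp
    also have "\<dots> = ?d * (LBINT w. indicat_real {0..1} w * Pt (a + ?d * w) (c0_apply u) x)"
    proof -
      have "?d * w \<le> ?d * 1 \<longleftrightarrow> w \<le> 1" "?d * 0 \<le> ?d * w \<longleftrightarrow> 0 \<le> w" for w
        by (intro mult_le_cancel_left_pos; simp)+
      then have "indicat_real {a..a + ?d} (a + ?d * w) = indicat_real {0..1} w" for w
        by (simp add: indicator_def del: of_nat_Suc)
      then show ?thesis
        by simp
    qed
    finally show ?thesis
      unfolding Pt_average_def by simp
  qed
  have "(\<lambda>n. LBINT w. indicat_real {0..1} w * Pt (a + 1 / real (Suc n) * w) (c0_apply u) x) \<longlonglongrightarrow>
      (LBINT w. indicat_real {0..1 :: real} w * Pt a (c0_apply u) x)"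
  proof (rule integral_dominated_convergence[where w = "\<lambda>w :: real. norm u * indicat_real {0..1} w"])
    show "(\<lambda>w. indicat_real {0..1 :: real} w * Pt a (c0_apply u) x) \<in> borel_measurable lborel"
      by measurable
    have "(\<lambda>w. Pt (a + 1 / real (Suc n) * w) (c0_apply u) x) \<in> borel_measurable borel" for n
      by (rule measurable_compose[OF _ measurable_Pt[OF borel_measurable_c0_apply]]) measurable
    then show "(\<lambda>w. indicat_real {0..1} w * Pt (a + 1 / real (Suc n) * w) (c0_apply u) x) \<in> borel_measurable lborel" for n
      by measurable
    show "AE w in lborel. (\<lambda>n. indicat_real {0..1} w * Pt (a + 1 / real (Suc n) * w) (c0_apply u) x) \<longlonglongrightarrow>
        indicat_real {0..1} w * Pt a (c0_apply u) x"
    proof (rule AE_I2)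
      fix w :: real
      show "(\<lambda>n. indicat_real {0..1} w * Pt (a + 1 / real (Suc n) * w) (c0_apply u) x) \<longlonglongrightarrow>
          indicat_real {0..1} w * Pt a (c0_apply u) x"
      proof (cases "w \<in> {0..1}")
        case True
        have "(\<lambda>n. inverse (real (Suc n)) * w) \<longlonglongrightarrow> 0"
          by (rule tendsto_mult_left_zero[OF LIMSEQ_inverse_real_of_nat])
        then have "(\<lambda>n. a + 1 / real (Suc n) * w) \<longlonglongrightarrow> a"
          using tendsto_add[OF tendsto_const[of a]] by (fastforce simp: inverse_eq_divide)
        then show ?thesis
          using True by (intro tendsto_mult tendsto_const Pt_right_continuous) auto
      qed simp
    qed
    show "AE w in lborel. norm (indicat_real {0..1} w * Pt (a + 1 / real (Suc n) * w) (c0_apply u) x) \<le> norm u * indicat_real {0..1} w" for n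
      using abs_Pt_c0_le by (intro AE_I2) (auto simp: indicator_def)
  qed auto
  then show ?thesis
    unfolding eq by simp
qed

text \<open>A pointwise limit of the averages, each a multiple of a difference of two functions in
  C_0.\<close>

lemma measurable_Pt_space:
  assumes "0 \<le> r"
  shows "Pt r (c0_apply u) \<in> borel_measurable borel"
  by (rule borel_measurable_LIMSEQ_real[OF Pt_average_tendsto[OF assms]]) measurable

lemma Pt_dominated_convergence:
  assumes [measurable]: "\<And>n. w n \<in> borel_measurable borel" "v \<in> borel_measurable borel"
    and bound: "\<And>n y. \<bar>w n y\<bar> \<le> c" and lim: "\<And>y. (\<lambda>n. w n y) \<longlonglongrightarrow> v y"
  shows "(\<lambda>n. Pt s (w n) x) \<longlonglongrightarrow> Pt s v x"
proof -
  interpret prob_space "P (Some x)" by (rule prob_P)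
  have "(\<lambda>n. \<integral> \<omega>. extend0 (w n) (Y s \<omega>) \<partial>P (Some x)) \<longlonglongrightarrow> (\<integral> \<omega>. extend0 v (Y s \<omega>) \<partial>P (Some x))"
  proof (rule integral_dominated_convergence[where w = "\<lambda>_. c"])
    show "AE \<omega> in P (Some x). (\<lambda>n. extend0 (w n) (Y s \<omega>)) \<longlonglongrightarrow> extend0 v (Y s \<omega>)"
    proof (rule AE_I2)
      fix \<omega>
      show "(\<lambda>n. extend0 (w n) (Y s \<omega>)) \<longlonglongrightarrow> extend0 v (Y s \<omega>)"
        using lim by (cases "Y s \<omega>") auto
    qed
    show "AE \<omega> in P (Some x). norm (extend0 (w n) (Y s \<omega>)) \<le> c" for n
      using extend0_bounded[OF bound] by simp
  qed simp_all
  then show ?thesis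
    by (simp add: Pt_eq)
qed

text \<open>The left-hand side of the integrated Markov property for the weight that is n + 1 on the
  window from r and 0 elsewhere.\<close>

lemma nn_integral_average:
  assumes u: "\<And>y. 0 \<le> c0_apply u y" and s: "0 \<le> s" and r: "0 \<le> r"
  shows "(\<integral>\<^sup>+ q\<in>{0..}. (ennreal (real (Suc n)) * indicator {r..r + 1 / real (Suc n)} q) *
      (\<integral>\<^sup>+ \<omega>. ennreal (extend0 (c0_apply u) (Y (s + q) \<omega>)) \<partial>P (Some x)) \<partial>lborel) = ennreal (Pt_average n (s + r) u x)"
    (is "?l = _")
proof -
  let ?d = "1 / real (Suc n)"
  have nonneg: "0 \<le> Pt t (c0_apply u) x" for t
    by (rule Pt_nonneg[OF borel_measurable_c0_apply u])
  have aff: "(\<lambda>q. indicat_real {s + r..s + r + ?d} (s + 1 * q) * Pt (s + 1 * q) (c0_apply u) x) =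
      (\<lambda>q. indicat_real {r..r + ?d} q * Pt (s + q) (c0_apply u) x)"
    by (auto simp: indicator_def)
  have int: "integrable lborel (\<lambda>q. indicat_real {r..r + ?d} q * Pt (s + q) (c0_apply u) x)"
    using lborel_integrable_real_affine[OF St_increment(2)[of "s + r" ?d u x], of 1 s] s r
    unfolding aff by simp
  have "St (s + r + ?d) u x - St (s + r) u x = (LBINT q. indicat_real {s + r..s + r + ?d} q * Pt q (c0_apply u) x)"
    using s r by (intro St_increment(1)) auto
  also have "\<dots> = \<bar>1\<bar> *\<^sub>R (LBINT q. indicat_real {s + r..s + r + ?d} (s + 1 * q) * Pt (s + 1 * q) (c0_apply u) x)"
    by (rule lborel_integral_real_affine) simp
  finally have eq: "Pt_average n (s + r) u x = (LBINT q. real (Suc n) * (indicat_real {r..r + ?d} q * Pt (s + q) (c0_apply u) x))"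
    unfolding aff Pt_average_def by simp
  have "?l = (\<integral>\<^sup>+ q. ennreal (real (Suc n) * (indicat_real {r..r + ?d} q * Pt (s + q) (c0_apply u) x)) \<partial>lborel)"
  proof (rule nn_integral_cong)
    fix q :: real
    show "(ennreal (real (Suc n)) * indicator {r..r + ?d} q) *
        (\<integral>\<^sup>+ \<omega>. ennreal (extend0 (c0_apply u) (Y (s + q) \<omega>)) \<partial>P (Some x)) * indicator {0..} q =
        ennreal (real (Suc n) * (indicat_real {r..r + ?d} q * Pt (s + q) (c0_apply u) x))"
      unfolding Pt_nn_integral[OF borel_measurable_c0_apply abs_c0_apply_le_norm u, symmetric]
      using r nonneg[of "s + q"] by (cases "q \<in> {r..r + ?d}") (auto simp: ennreal_mult simp del: of_nat_Suc)
  qed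
  also have "\<dots> = ennreal (Pt_average n (s + r) u x)"
    unfolding eq using int nonneg by (intro nn_integral_eq_integral integrable_mult_right) auto
  finally show ?thesis .
qed

text \<open>The semigroup law for averages: the window weight is inserted into the integrated Markov
  property, and the average itself is the Borel function of the starting point.\<close>

lemma Pt_Pt_average:
  assumes u: "\<And>y. 0 \<le> c0_apply u y" and s: "0 \<le> s" and r: "0 \<le> r"
  shows "Pt s (Pt_average n r u) x = Pt_average n (s + r) u x"
proof -
  have nonneg: "0 \<le> Pt_average n a u y" if "0 \<le> a" for a y
  proof -
    have "0 \<le> Pt t (c0_apply u) y" for t
      by (rule Pt_nonneg[OF borel_measurable_c0_apply u])
    then show ?thesis
      unfolding Pt_average_def using that
      by (subst St_increment(1)) (auto intro!: mult_nonneg_nonneg integral_nonneg_AE)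
  qed
  have "ennreal (Pt_average n (s + r) u x) = (\<integral>\<^sup>+ \<omega>. extend0 (\<lambda>y. ennreal (Pt_average n r u y)) (Y s \<omega>) \<partial>P (Some x))"
    unfolding nn_integral_average[OF assms, symmetric]
  proof (rule Markov_time_change[OF _ _ _ s])
    fix y
    show "(\<integral>\<^sup>+ q\<in>{0..}. (ennreal (real (Suc n)) * indicator {r..r + 1 / real (Suc n)} q) *
        (\<integral>\<^sup>+ \<omega>. ennreal (extend0 (c0_apply u) (Y q \<omega>)) \<partial>P (Some y)) \<partial>lborel) = ennreal (Pt_average n r u y)"
      using nn_integral_average[OF u order_refl r, of n y] by simp
  qed measurable
  also have "\<dots> = (\<integral>\<^sup>+ \<omega>. ennreal (extend0 (Pt_average n r u) (Y s \<omega>)) \<partial>P (Some x))"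
  proof (rule nn_integral_cong)
    show "extend0 (\<lambda>y. ennreal (Pt_average n r u y)) (Y s \<omega>) = ennreal (extend0 (Pt_average n r u) (Y s \<omega>))" for \<omega>
      by (cases "Y s \<omega>") auto
  qed
  also have "\<dots> = ennreal (Pt s (Pt_average n r u) x)"
    by (rule Pt_nn_integral[OF measurable_Pt_average abs_Pt_average_le nonneg[OF r], symmetric])
  finally show ?thesis
    using nonneg s r Pt_nonneg[OF measurable_Pt_average nonneg[OF r], where s = s and x = x] by simp
qed

text \<open>The windows shrink: the averages converge on the left by right continuity, and under P_s
  on the right by dominated convergence.\<close>

theorem Pt_semigroup:
  assumes s: "0 \<le> s" and r: "0 \<le> r"
  shows "Pt (s + r) (c0_apply u) x = Pt s (Pt r (c0_apply u)) x"
proof -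
  have pos: "Pt (s + r) (c0_apply w) x = Pt s (Pt r (c0_apply w)) x" if w: "\<And>y. 0 \<le> c0_apply w y" for w
  proof (rule LIMSEQ_unique)
    show "(\<lambda>n. Pt_average n (s + r) w x) \<longlonglongrightarrow> Pt (s + r) (c0_apply w) x"
      using s r by (intro Pt_average_tendsto) simp
    show "(\<lambda>n. Pt_average n (s + r) w x) \<longlonglongrightarrow> Pt s (Pt r (c0_apply w)) x"
      unfolding Pt_Pt_average[OF w s r, symmetric]
      by (rule Pt_dominated_convergence[OF measurable_Pt_average measurable_Pt_space[OF r]
            abs_Pt_average_le Pt_average_tendsto[OF r]])
  qed
  obtain u1 u2 where u: "u = u1 - u2" "\<And>x. 0 \<le> c0_apply u1 x" "\<And>x. 0 \<le> c0_apply u2 x"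
    using c0_parts[of u] by blast
  have "Pt r (c0_apply u) = (\<lambda>y. 1 * Pt r (c0_apply u1) y + (- 1) * Pt r (c0_apply u2) y)"
    by (rule ext) (simp add: u(1) Pt_c0_diff)
  then have "Pt s (Pt r (c0_apply u)) x = Pt s (Pt r (c0_apply u1)) x - Pt s (Pt r (c0_apply u2)) x"
    by (simp only: Pt_linear[OF measurable_Pt_space[OF r] abs_Pt_c0_le measurable_Pt_space[OF r] abs_Pt_c0_le])
  then show ?thesis
    using pos[OF u(2)] pos[OF u(3)] by (simp add: u(1) Pt_c0_diff)
qed

text \<open>The oscillation of the semigroup near time \<open>0\<close>. It need not vanish uniformly in space, but its
  potential does, by Dini's theorem and the strong Feller property.\<close>

definition oscillation :: "'x c0 \<Rightarrow> real \<Rightarrow> 'x \<Rightarrow> real" where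
  "oscillation u d y = (SUP q\<in>{q \<in> \<rat>. 0 \<le> q \<and> q \<le> d}. \<bar>Pt q (c0_apply u) y - Pt 0 (c0_apply u) y\<bar>)"

lemma abs_Pt_diff_le: "\<bar>Pt q (c0_apply u) y - Pt r (c0_apply u) y\<bar> \<le> 2 * norm u"
  using abs_Pt_c0_le[of q u y] abs_Pt_c0_le[of r u y] by linarith

lemma bdd_above_oscillation:
  "bdd_above ((\<lambda>q. \<bar>Pt q (c0_apply u) y - Pt 0 (c0_apply u) y\<bar>) ` Q)"
  using abs_Pt_diff_le by (auto intro!: bdd_aboveI)

lemma countable_rational_interval: "countable {q \<in> \<rat>. 0 \<le> q \<and> q \<le> (d :: real)}"
  using countable_rat by (rule countable_subset[rotated]) auto

lemma measurable_oscillation [measurable]: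
  assumes "0 \<le> d"
  shows "oscillation u d \<in> borel_measurable borel"
  unfolding oscillation_def[abs_def]
proof (rule borel_measurable_cSUP[OF countable_rational_interval])
  fix q :: real assume "q \<in> {q \<in> \<rat>. 0 \<le> q \<and> q \<le> d}"
  then have [measurable]: "Pt q (c0_apply u) \<in> borel_measurable borel"
    by (intro measurable_Pt_space) simp
  have [measurable]: "Pt 0 (c0_apply u) \<in> borel_measurable borel"
    by (intro measurable_Pt_space) simp
  show "(\<lambda>y. \<bar>Pt q (c0_apply u) y - Pt 0 (c0_apply u) y\<bar>) \<in> borel_measurable borel"
    by measurable
qed (rule bdd_above_oscillation)

lemma oscillation_nonneg: "0 \<le> d \<Longrightarrow> 0 \<le> oscillation u d y"
  unfolding oscillation_def by (rule cSUP_upper2[OF bdd_above_oscillation, of 0]) auto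

lemma oscillation_le: "0 \<le> d \<Longrightarrow> (\<And>q. 0 \<le> q \<Longrightarrow> q \<le> d \<Longrightarrow> \<bar>Pt q (c0_apply u) y - Pt 0 (c0_apply u) y\<bar> \<le> c) \<Longrightarrow>
    oscillation u d y \<le> c"
  unfolding oscillation_def by (rule cSUP_least) auto

lemma oscillation_mono: "0 \<le> d \<Longrightarrow> d \<le> d' \<Longrightarrow> oscillation u d y \<le> oscillation u d' y"
  unfolding oscillation_def
  by (rule cSUP_subset_mono[OF _ bdd_above_oscillation]) (auto intro: exI[of _ 0])

lemma abs_oscillation_le: "0 \<le> d \<Longrightarrow> \<bar>oscillation u d y\<bar> \<le> 2 * norm u"
  using oscillation_nonneg[of d u y] oscillation_le[of d u y "2 * norm u"] abs_Pt_diff_le by simp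

text \<open>The strict bound r < d leaves room for rationals in (r, d) decreasing to r; right
  continuity carries the estimate over from them.\<close>

lemma oscillation_ge:
  assumes r: "0 \<le> r" "r < d"
  shows "\<bar>Pt r (c0_apply u) y - Pt 0 (c0_apply u) y\<bar> \<le> oscillation u d y"
proof -
  have "\<exists>q. q \<in> \<rat> \<and> r < q \<and> q < min d (r + inverse (real (Suc n)))" for n
    using Rats_dense_in_real[of r "min d (r + inverse (real (Suc n)))"] r by auto
  then obtain q where q: "\<And>n. q n \<in> \<rat>" "\<And>n. r < q n" "\<And>n. q n < min d (r + inverse (real (Suc n)))"
    by metis
  have "q \<longlonglongrightarrow> r"
  proof (rule tendsto_sandwich[of "\<lambda>_. r" q sequentially "\<lambda>n. r + inverse (real (Suc n))"])
    show "(\<lambda>n. r + inverse (real (Suc n))) \<longlonglongrightarrow> r"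
      by (rule LIMSEQ_inverse_real_of_nat_add)
    show "eventually (\<lambda>n. q n \<le> r + inverse (real (Suc n))) sequentially"
      using q(3) by (intro always_eventually allI) (simp add: less_imp_le)
    show "eventually (\<lambda>n. r \<le> q n) sequentially"
      using q(2) by (intro always_eventually allI less_imp_le)
  qed simp
  then have "(\<lambda>n. Pt (q n) (c0_apply u) y) \<longlonglongrightarrow> Pt r (c0_apply u) y"
    using q(2) by (intro Pt_right_continuous less_imp_le)
  then have "(\<lambda>n. \<bar>Pt (q n) (c0_apply u) y - Pt 0 (c0_apply u) y\<bar>) \<longlonglongrightarrow> \<bar>Pt r (c0_apply u) y - Pt 0 (c0_apply u) y\<bar>"
    by (intro tendsto_intros)
  then show ?thesis
  proof (rule LIMSEQ_le_const2)
    have "\<bar>Pt (q n) (c0_apply u) y - Pt 0 (c0_apply u) y\<bar> \<le> oscillation u d y" for n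
      unfolding oscillation_def using q(1,2,3)[of n] r
      by (intro cSUP_upper bdd_above_oscillation) auto
    then show "\<exists>N. \<forall>n\<ge>N. \<bar>Pt (q n) (c0_apply u) y - Pt 0 (c0_apply u) y\<bar> \<le> oscillation u d y"
      by blast
  qed
qed

text \<open>Right continuity at 0 is available along sequences, so a failure is refuted by
  collecting one bad time for each n.\<close>

lemma oscillation_tendsto: "(\<lambda>n. oscillation u (1 / real (Suc n)) y) \<longlonglongrightarrow> 0"
proof (rule LIMSEQ_I)
  fix e :: real assume e: "0 < e"
  have "\<exists>n. \<forall>q. 0 \<le> q \<and> q \<le> 1 / real (Suc n) \<longrightarrow> \<bar>Pt q (c0_apply u) y - Pt 0 (c0_apply u) y\<bar> \<le> e / 2"
  proof (rule ccontr)
    assume "\<not> ?thesis"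
    then obtain q where q: "\<And>n. 0 \<le> q n" "\<And>n. q n \<le> 1 / real (Suc n)"
        "\<And>n. e / 2 < \<bar>Pt (q n) (c0_apply u) y - Pt 0 (c0_apply u) y\<bar>"
      unfolding not_ex not_all not_imp not_le by metis
    have "q \<longlonglongrightarrow> 0"
    proof (rule tendsto_sandwich[of "\<lambda>_. 0" q sequentially "\<lambda>n. 1 / real (Suc n)"])
      show "(\<lambda>n. 1 / real (Suc n)) \<longlonglongrightarrow> 0"
        using LIMSEQ_inverse_real_of_nat by (simp add: inverse_eq_divide)
    qed (use q in \<open>auto intro!: always_eventually\<close>)
    then have "(\<lambda>n. Pt (q n) (c0_apply u) y) \<longlonglongrightarrow> Pt 0 (c0_apply u) y"
      using q(1) by (intro Pt_right_continuous)
    then have "(\<lambda>n. \<bar>Pt (q n) (c0_apply u) y - Pt 0 (c0_apply u) y\<bar>) \<longlonglongrightarrow> \<bar>Pt 0 (c0_apply u) y - Pt 0 (c0_apply u) y\<bar>"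
      by (intro tendsto_intros)
    then have "(\<lambda>n. \<bar>Pt (q n) (c0_apply u) y - Pt 0 (c0_apply u) y\<bar>) \<longlonglongrightarrow> 0"
      by simp
    then have "eventually (\<lambda>n. \<bar>Pt (q n) (c0_apply u) y - Pt 0 (c0_apply u) y\<bar> < e / 2) sequentially"
      using e by (intro order_tendstoD(2)) auto
    then obtain n where "\<bar>Pt (q n) (c0_apply u) y - Pt 0 (c0_apply u) y\<bar> < e / 2"
      by (auto simp: eventually_sequentially)
    with q(3)[of n] show False by simp
  qed
  then obtain n0 where n0: "\<And>q. 0 \<le> q \<Longrightarrow> q \<le> 1 / real (Suc n0) \<Longrightarrow> \<bar>Pt q (c0_apply u) y - Pt 0 (c0_apply u) y\<bar> \<le> e / 2"
    by blast
  have "norm (oscillation u (1 / real (Suc n)) y - 0) < e" if "n0 \<le> n" for n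
  proof -
    have "oscillation u (1 / real (Suc n)) y \<le> oscillation u (1 / real (Suc n0)) y"
      using that by (intro oscillation_mono) (auto intro!: divide_left_mono)
    also have "\<dots> \<le> e / 2"
      using n0 by (intro oscillation_le) auto
    finally show ?thesis
      using oscillation_nonneg[of "1 / real (Suc n)" u y] e by simp
  qed
  then show "\<exists>N. \<forall>n\<ge>N. norm (oscillation u (1 / real (Suc n)) y - 0) < e"
    by blast
qed

text \<open>The potentials decrease with the width and tend to 0 pointwise by dominated convergence
  with respect to \<mu>, the dominating function being a multiple of G(x, .).\<close>

lemma oscillation_potential:
  obtains V where "V \<longlonglongrightarrow> 0" "\<And>n x. 0 \<le> c0_apply (V n) x"
    "\<And>n x. green_potential (\<lambda>y. ennreal (oscillation u (1 / real (Suc n)) y)) x = ennreal (c0_apply (V n) x)"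
proof -
  let ?o = "\<lambda>n. oscillation u (1 / real (Suc n))"
  have meas [measurable]: "?o n \<in> borel_measurable borel" for n
    by (rule measurable_oscillation) simp
  have bounds: "0 \<le> ?o n y" "?o n y \<le> 2 * norm u" for n y
    using oscillation_nonneg[of "1 / real (Suc n)" u y] abs_oscillation_le[of "1 / real (Suc n)" u y] by auto
  have "\<exists>v. (\<forall>x. 0 \<le> c0_apply v x) \<and> (\<forall>x. green_potential (\<lambda>y. ennreal (?o n y)) x = ennreal (c0_apply v x))" for n
    using green_potential_c0[OF meas[of n] bounds(1)[of n] bounds(2)[of n]] by metis
  then obtain V where V: "\<And>n x. 0 \<le> c0_apply (V n) x"
      "\<And>n x. green_potential (\<lambda>y. ennreal (?o n y)) x = ennreal (c0_apply (V n) x)"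
    by metis
  have "V \<longlonglongrightarrow> 0"
  proof (rule Dini_c0)
    fix x
    show "decseq (\<lambda>n. c0_apply (V n) x)"
    proof (rule decseq_SucI)
      fix n
      have "ennreal (c0_apply (V (Suc n)) x) \<le> ennreal (c0_apply (V n) x)"
        unfolding V(2)[symmetric] green_potential_def
        by (intro nn_integral_mono mult_left_mono ennreal_leI oscillation_mono) (auto intro!: divide_left_mono)
      then show "c0_apply (V (Suc n)) x \<le> c0_apply (V n) x"
        using V(1) by simp
    qed
    have fin: "(\<integral>\<^sup>+ y. green p 0 x y \<partial>\<mu>) < \<infinity>"
      using kato_function(2)[of x] by (simp add: green_potential_def)
    have "(\<lambda>n. \<integral>\<^sup>+ y. green p 0 x y * ennreal (?o n y) \<partial>\<mu>) \<longlonglongrightarrow> (\<integral>\<^sup>+ y. 0 \<partial>\<mu>)"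
    proof (rule nn_integral_dominated_convergence[where w = "\<lambda>y. ennreal (2 * norm u) * green p 0 x y"])
      show "(\<integral>\<^sup>+ y. ennreal (2 * norm u) * green p 0 x y \<partial>\<mu>) < \<infinity>"
        using fin by (simp add: nn_integral_cmult ennreal_mult_less_top)
      show "AE y in \<mu>. green p 0 x y * ennreal (?o n y) \<le> ennreal (2 * norm u) * green p 0 x y" for n
      proof (rule AE_I2)
        fix y
        show "green p 0 x y * ennreal (?o n y) \<le> ennreal (2 * norm u) * green p 0 x y"
          unfolding mult.commute[of "ennreal (2 * norm u)"]
          by (rule mult_left_mono[OF ennreal_leI[OF bounds(2)]]) simp
      qed
      \<comment> \<open>The kernel may be infinite at some y, where its product with a null sequence
        need not tend to 0; finiteness of G^\<mu>1 makes such y negligible.\<close>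
      have "AE y in \<mu>. green p 0 x y \<noteq> \<infinity>"
        using fin by (intro nn_integral_PInf_AE) auto
      then show "AE y in \<mu>. (\<lambda>n. green p 0 x y * ennreal (?o n y)) \<longlonglongrightarrow> 0"
      proof eventually_elim
        case (elim y)
        have "(\<lambda>n. ennreal (?o n y)) \<longlonglongrightarrow> ennreal 0"
          by (intro tendsto_ennrealI oscillation_tendsto)
        from ennreal_tendsto_cmult[OF _ this, of "green p 0 x y"] elim show ?case
          by (simp add: less_top)
      qed
    qed measurable
    then have "(\<lambda>n. ennreal (c0_apply (V n) x)) \<longlonglongrightarrow> ennreal 0"
      unfolding V(2)[symmetric] green_potential_def by simp
    then show "(\<lambda>n. c0_apply (V n) x) \<longlonglongrightarrow> 0"
      using V(1) by (subst (asm) tendsto_ennreal_iff) auto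
  qed (rule V(1))
  then show ?thesis
    using that V by blast
qed

text \<open>By the semigroup law the difference is P_a applied to P_r u - P_0 u, and P_a is
  positive. Two times at distance less than d after a are compared through the common reference P_a
  P_0 u.\<close>

lemma Pt_modulus:
  assumes a: "0 \<le> a" and r: "0 \<le> r" "r < d"
  shows "\<bar>Pt (a + r) (c0_apply u) x - Pt a (Pt 0 (c0_apply u)) x\<bar> \<le> Pt a (oscillation u d) x"
proof -
  have d: "0 \<le> d" using r by simp
  note m = measurable_Pt_space[OF r(1), of u] measurable_Pt_space[OF order_refl, of u]
  let ?w = "\<lambda>y. 1 * Pt r (c0_apply u) y + (- 1) * Pt 0 (c0_apply u) y"
  have w_meas: "?w \<in> borel_measurable borel"
    using m by measurable
  then have abs_w_meas: "(\<lambda>y. \<bar>?w y\<bar>) \<in> borel_measurable borel"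
    by (rule borel_measurable_abs)
  have w_bound: "\<bar>\<bar>?w y\<bar>\<bar> \<le> 2 * norm u" for y
    using abs_Pt_diff_le[of r u y 0] by simp
  have w: "\<bar>?w y\<bar> \<le> oscillation u d y" for y
    using oscillation_ge[OF r, of u y] by simp
  have eq: "Pt (a + r) (c0_apply u) x - Pt a (Pt 0 (c0_apply u)) x = Pt a ?w x"
    unfolding Pt_semigroup[OF a r(1)] Pt_linear[OF m(1) abs_Pt_c0_le m(2) abs_Pt_c0_le] by simp
  show ?thesis
    unfolding eq
    by (rule order_trans[OF abs_Pt_le_Pt_abs[OF w_meas]
          Pt_mono[OF abs_w_meas w_bound measurable_oscillation[OF d] abs_oscillation_le[OF d] w]])
qed

theorem Pt_uniform_riemann_integral:
  assumes T: "0 \<le> T"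
  shows "has_uniform_riemann_integral (\<lambda>s. Pt s (c0_apply u)) (St T u) 0 T"
  unfolding has_uniform_riemann_integral_def
proof (intro conjI ballI allI impI)
  fix s assume "s \<in> {0..T}"
  then show "Pt s (c0_apply u) \<in> bounded_borel"
    using measurable_Pt_space[of s u] abs_Pt_c0_le[of s u]
    by (auto simp: bounded_borel_def intro!: boundedI[of _ "norm u"])
next
  show "St T u \<in> bounded_borel"
    using St_c0[of T u] bounded_borel_c0_apply by auto
next
  fix e :: real assume e: "0 < e"
  obtain V where V: "V \<longlonglongrightarrow> 0" "\<And>n x. 0 \<le> c0_apply (V n) x"
      "\<And>n x. green_potential (\<lambda>y. ennreal (oscillation u (1 / real (Suc n)) y)) x = ennreal (c0_apply (V n) x)"
    using oscillation_potential[of u] by blast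
  \<comment> \<open>The two error terms: the initial interval, where the semigroup law cannot reach
    back, and twice the potential of the oscillation.\<close>
  have "(\<lambda>n. norm u * inverse (real (Suc n)) + 2 * norm (V n)) \<longlonglongrightarrow> norm u * 0 + 2 * norm (0 :: 'x c0)"
    by (intro tendsto_intros V(1) LIMSEQ_inverse_real_of_nat)
  then have "eventually (\<lambda>n. norm u * inverse (real (Suc n)) + 2 * norm (V n) < e) sequentially"
    using e by (intro order_tendstoD(2)) auto
  then obtain n where n: "norm u * inverse (real (Suc n)) + 2 * norm (V n) < e"
    by (auto simp: eventually_sequentially)
  \<comment> \<open>The mesh is half the oscillation window: s and t at distance below \<eta> both
    lie in [t - \<eta>, t - \<eta> + 2 \<eta>).\<close>
  define \<eta> where "\<eta> = 1 / (2 * real (Suc n))"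
  have \<eta>: "0 < \<eta>" "2 * \<eta> = 1 / real (Suc n)" "2 * norm u * \<eta> = norm u * inverse (real (Suc n))"
    by (simp_all add: \<eta>_def field_simps)
  let ?o = "oscillation u (1 / real (Suc n))"
  have o_meas [measurable]: "?o \<in> borel_measurable borel"
    by (rule measurable_oscillation) simp
  have o: "0 \<le> ?o y" "\<bar>?o y\<bar> \<le> 2 * norm u" for y
    using oscillation_nonneg abs_oscillation_le by auto
  show "\<exists>d>0. \<forall>p. p tagged_division_of {0..T} \<and> (\<forall>(s, K)\<in>p. measure lborel K < d) \<longrightarrow>
      sup_norm (\<lambda>x. (\<Sum>(s, K)\<in>p. measure lborel K * Pt s (c0_apply u) x) - St T u x) < e"
  proof (intro exI[of _ \<eta>] conjI allI impI \<eta>(1))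
    fix D assume D: "D tagged_division_of {0..T} \<and> (\<forall>(s, K)\<in>D. measure lborel K < \<eta>)"
    have "\<bar>(\<Sum>(s, K)\<in>D. measure lborel K * Pt s (c0_apply u) x) - St T u x\<bar> \<le>
        norm u * inverse (real (Suc n)) + 2 * norm (V n)" for x
    proof -
      let ?f = "\<lambda>s. Pt s (c0_apply u) x"
      let ?k = "\<lambda>s. indicat_real {0..} s * Pt s ?o x"
      \<comment> \<open>The first summand covers t < \<eta>, where t - \<eta> is negative and the
        second vanishes. The argument is written as an affine map so that translation invariance
        gives its integral, a potential.\<close>
      let ?g = "\<lambda>t. 2 * norm u * indicat_real {0..\<eta>} t + 2 * ?k (- \<eta> + 1 * t)"
      have k_nonneg: "0 \<le> ?k s" for s
        using Pt_nonneg[OF o_meas o(1), of s x] by (auto simp: indicator_def)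
      have int_k: "integrable lborel ?k"
        using set_integrable_Pt[OF o_meas o(2), of x] by (simp add: set_integrable_def)
      have "ennreal (LBINT s. ?k s) = (\<integral>\<^sup>+ s\<in>{0..}. ennreal (Pt s ?o x) \<partial>lborel)"
        unfolding nn_integral_eq_integral[OF int_k AE_I2[OF k_nonneg], symmetric]
        by (intro nn_integral_cong) (auto simp: indicator_def)
      also have "\<dots> = ennreal (c0_apply (V n) x)"
        using nn_integral_Pt[OF o_meas o(2) o(1)] V(3) by simp
      finally have k_V: "(LBINT s. ?k s) = c0_apply (V n) x"
        using V(2) k_nonneg by (subst (asm) ennreal_inj) (auto intro: integral_nonneg_AE)
      have int_k': "integrable lborel (\<lambda>t. ?k (- \<eta> + 1 * t))"
        by (rule lborel_integrable_real_affine[OF int_k]) simp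
      have k_V': "(LBINT t. ?k (- \<eta> + 1 * t)) = c0_apply (V n) x"
        using lborel_integral_real_affine[of 1 ?k "- \<eta>"] k_V by simp
      have int_ind: "integrable lborel (indicat_real {0..\<eta>})"
        by (rule integrable_real_indicator) (simp_all add: emeasure_lborel_Icc_eq)
      have int_g: "integrable lborel ?g"
        by (intro Bochner_Integration.integrable_add integrable_mult_right int_ind int_k')
      have LBINT_g: "(LBINT t. ?g t) = 2 * norm u * \<eta> + 2 * c0_apply (V n) x"
      proof -
        have "(LBINT t. ?g t) = (LBINT t. 2 * norm u * indicat_real {0..\<eta>} t) + (LBINT t. 2 * ?k (- \<eta> + 1 * t))"
          by (intro Bochner_Integration.integral_add integrable_mult_right int_ind int_k')
        also have "(LBINT t. 2 * ?k (- \<eta> + 1 * t)) = 2 * c0_apply (V n) x"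
          unfolding integral_mult_right_zero k_V' ..
        finally show ?thesis
          using \<eta>(1) by simp
      qed
      have g_int: "?g integrable_on UNIV" "integral UNIV ?g = 2 * norm u * \<eta> + 2 * c0_apply (V n) x"
        using integrable_on_lborel[OF int_g] integral_lborel[OF int_g] LBINT_g by auto
      have g_int': "?g integrable_on {0..T}"
        using integrable_on_subcbox[OF g_int(1), of 0 T] by simp
      have g_nonneg: "0 \<le> ?g t" for t
        using k_nonneg[of "- \<eta> + 1 * t"] by simp
      have f_int: "?f integrable_on {0..T}" "integral {0..T} ?f = St T u x"
      proof -
        have "set_integrable lborel {0..T} ?f"
          using set_integrable_Pt[OF borel_measurable_c0_apply abs_c0_apply_le_norm, of u x]
          by (rule set_integrable_subset) auto
        from set_borel_integral_eq_integral[OF this] show "?f integrable_on {0..T}" "integral {0..T} ?f = St T u x"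
          by (simp_all add: St_def)
      qed
      have "norm ((\<Sum>(s, K)\<in>D. measure lborel K *\<^sub>R ?f s) - integral {0..T} ?f) \<le> integral {0..T} ?g"
      proof (rule riemann_sum_error[OF f_int(1) g_int'])
        fix s t assume st: "s \<in> {0..T}" "t \<in> {0..T}" "\<bar>s - t\<bar> < \<eta>"
        show "norm (?f s - ?f t) \<le> ?g t"
        proof (cases "t < \<eta>")
          case True
          then show ?thesis
            using abs_Pt_diff_le[of s u x t] st k_nonneg[of "- \<eta> + 1 * t"] by (simp add: indicator_def)
        next
          case False
          have t: "\<bar>Pt (t - \<eta> + \<eta>) (c0_apply u) x - Pt (t - \<eta>) (Pt 0 (c0_apply u)) x\<bar> \<le> Pt (t - \<eta>) ?o x"
            using False \<eta> by (intro Pt_modulus) auto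
          \<comment> \<open>The offset s - t + \<eta> lies strictly between 0 and 2 \<eta>, for s
            before t as well as after it.\<close>
          have s: "\<bar>Pt (t - \<eta> + (s - t + \<eta>)) (c0_apply u) x - Pt (t - \<eta>) (Pt 0 (c0_apply u)) x\<bar> \<le> Pt (t - \<eta>) ?o x"
            using False \<eta>(2)[symmetric] st(3) by (intro Pt_modulus) auto
          have "\<bar>?f s - ?f t\<bar> \<le> 2 * Pt (t - \<eta>) ?o x"
            using t s by simp
          also have "\<dots> \<le> ?g t"
            using False by (simp add: indicator_def)
          finally show ?thesis by simp
        qed
      qed (use D in auto)
      also have "\<dots> \<le> integral UNIV ?g"
        using g_int(1) g_int' g_nonneg by (intro integral_subset_le) auto
      also have "\<dots> \<le> norm u * inverse (real (Suc n)) + 2 * norm (V n)"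
        unfolding g_int(2) \<eta>(3) using abs_c0_apply_le_norm[of "V n" x] by simp
      finally show ?thesis
        by (simp add: f_int(2))
    qed
    then have "sup_norm (\<lambda>x. (\<Sum>(s, K)\<in>D. measure lborel K * Pt s (c0_apply u) x) - St T u x) \<le>
        norm u * inverse (real (Suc n)) + 2 * norm (V n)"
      unfolding sup_norm_def by (intro cSUP_least) auto
    then show "sup_norm (\<lambda>x. (\<Sum>(s, K)\<in>D. measure lborel K * Pt s (c0_apply u) x) - St T u x) < e"
      using n by simp
  qed
qed

section \<open>The generator as a linear relation and its m-dissipativity\<close>

lemma resolvent_add: "0 \<le> \<alpha> \<Longrightarrow> resolvent \<alpha> (u + v) = resolvent \<alpha> u + resolvent \<alpha> v"
  by (rule c0_apply_eqI) (simp add: c0_apply_resolvent Res_c0_add)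

lemma resolvent_diff: "0 \<le> \<alpha> \<Longrightarrow> resolvent \<alpha> (u - v) = resolvent \<alpha> u - resolvent \<alpha> v"
  by (rule c0_apply_eqI) (simp add: c0_apply_resolvent Res_c0_diff)

lemma resolvent_scaleR: "0 \<le> \<alpha> \<Longrightarrow> resolvent \<alpha> (a *\<^sub>R u) = a *\<^sub>R resolvent \<alpha> u"
  by (rule c0_apply_eqI) (simp add: c0_apply_resolvent Res_c0_scaleR)

lemma norm_resolvent_le:
  assumes \<alpha>: "0 < \<alpha>"
  shows "norm (resolvent \<alpha> u) \<le> norm u / \<alpha>"
proof (rule norm_c0_le)
  fix x
  have int: "set_integrable lborel {0..} (\<lambda>t. exp (- \<alpha> * t) * Pt t (c0_apply u) x)"
    using \<alpha> by (intro set_integrable_exp_Pt[OF borel_measurable_c0_apply abs_c0_apply_le_norm]) simp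
  have "\<bar>Res \<alpha> (c0_apply u) x\<bar> \<le> (LBINT t. \<bar>indicat_real {0..} t *\<^sub>R (exp (- \<alpha> * t) * Pt t (c0_apply u) x)\<bar>)"
    unfolding Res_def set_lebesgue_integral_def by (rule integral_abs_bound)
  also have "\<dots> \<le> (LBINT t. norm u * (indicat_real {0..} t *\<^sub>R exp (- \<alpha> * t)))"
  proof (rule integral_mono)
    fix t
    show "\<bar>indicat_real {0..} t *\<^sub>R (exp (- \<alpha> * t) * Pt t (c0_apply u) x)\<bar> \<le> norm u * (indicat_real {0..} t *\<^sub>R exp (- \<alpha> * t))"
      using mult_right_mono[OF abs_Pt_c0_le[of t u x], of "exp (- \<alpha> * t)"]
      by (auto simp: indicator_def abs_mult mult.commute)
  next
    show "integrable lborel (\<lambda>t. \<bar>indicat_real {0..} t *\<^sub>R (exp (- \<alpha> * t) * Pt t (c0_apply u) x)\<bar>)"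
      using int unfolding set_integrable_def by (rule integrable_abs)
    show "integrable lborel (\<lambda>t. norm u * (indicat_real {0..} t *\<^sub>R exp (- \<alpha> * t)))"
      using set_integrable_exp(1)[OF \<alpha>, of 0] unfolding set_integrable_def by (rule integrable_mult_right)
  qed
  also have "\<dots> = norm u / \<alpha>"
    using set_integrable_exp(2)[OF \<alpha>, of 0] by (simp add: set_lebesgue_integral_def)
  finally show "\<bar>c0_apply (resolvent \<alpha> u) x\<bar> \<le> norm u / \<alpha>"
    using \<alpha> by (simp add: c0_apply_resolvent)
qed

lemma resolvent_identity:
  assumes "0 \<le> \<alpha>" "\<alpha> < \<beta>"
  shows "resolvent \<beta> u = resolvent \<alpha> u - (\<beta> - \<alpha>) *\<^sub>R resolvent \<beta> (resolvent \<alpha> u)"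
  by (rule c0_apply_eqI)
    (use assms resolvent_equation[OF c0_Feller[OF assms(1)] assms c0_apply_resolvent[OF assms(1)]]
      in \<open>simp add: c0_apply_resolvent\<close>)

text \<open>One direction is the resolvent identity. For the other, w = R_\<alpha>(v + \<alpha> u) -
  u satisfies w = (\<beta> - \<alpha>) R_\<beta> w, and the factor (\<beta> - \<alpha>) / \<beta> is
  below 1, so w = 0. Injectivity of the resolvents is not invoked.\<close>

lemma resolvent_fixed_point:
  assumes "0 < \<alpha>" "\<alpha> < \<beta>"
  shows "resolvent \<alpha> (v + \<alpha> *\<^sub>R u) = u \<longleftrightarrow> resolvent \<beta> (v + \<beta> *\<^sub>R u) = u"
proof -
  have split: "resolvent \<beta> (v + \<beta> *\<^sub>R u) = resolvent \<beta> (v + \<alpha> *\<^sub>R u) + (\<beta> - \<alpha>) *\<^sub>R resolvent \<beta> u"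
    using assms by (simp add: resolvent_add resolvent_scaleR scaleR_left_diff_distrib)
  let ?z = "resolvent \<alpha> (v + \<alpha> *\<^sub>R u)"
  have id: "resolvent \<beta> (v + \<alpha> *\<^sub>R u) = ?z - (\<beta> - \<alpha>) *\<^sub>R resolvent \<beta> ?z"
    using assms by (intro resolvent_identity) auto
  show ?thesis
  proof
    assume "?z = u"
    then show "resolvent \<beta> (v + \<beta> *\<^sub>R u) = u"
      using id split by simp
  next
    assume "resolvent \<beta> (v + \<beta> *\<^sub>R u) = u"
    then have "?z - u = (\<beta> - \<alpha>) *\<^sub>R resolvent \<beta> (?z - u)"
      using id split assms by (simp add: resolvent_diff scaleR_right_diff_distrib algebra_simps)
    then have "norm (?z - u) = (\<beta> - \<alpha>) * norm (resolvent \<beta> (?z - u))"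
      using assms by (metis abs_of_pos diff_gt_0_iff_gt norm_scaleR)
    also have "\<dots> \<le> (\<beta> - \<alpha>) * (norm (?z - u) / \<beta>)"
      using assms by (intro mult_left_mono norm_resolvent_le) auto
    finally have "norm (?z - u) * \<beta> \<le> (\<beta> - \<alpha>) * norm (?z - u)"
      using assms by (simp add: field_simps)
    then have "\<alpha> * norm (?z - u) \<le> 0"
      by (simp add: algebra_simps)
    then have "norm (?z - u) \<le> 0"
      using assms(1) by (simp add: mult_le_0_iff)
    then show "?z = u"
      by simp
  qed
qed

text \<open>The relation is defined with one parameter \<beta>, but membership can be tested with
  any \<alpha> > 0; dissipativity and the Laplace formula need all of them.\<close>

lemma mem_L_check_rel:
  assumes "0 < \<alpha>" "0 < \<beta>"
  shows "(u, v) \<in> L_check_rel X P A \<beta> \<longleftrightarrow> resolvent \<alpha> (v + \<alpha> *\<^sub>R u) = u"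
proof -
  have "R_check X P A \<beta> (c0_apply (v + \<beta> *\<^sub>R u)) = c0_apply (resolvent \<beta> (v + \<beta> *\<^sub>R u))"
    by (rule ext) (simp only: c0_apply_resolvent[OF less_imp_le[OF assms(2)]]
        R_check_eq_Res[OF borel_measurable_c0_apply abs_c0_apply_le_norm assms(2)])
  then have L: "(u, v) \<in> L_check_rel X P A \<beta> \<longleftrightarrow> resolvent \<beta> (v + \<beta> *\<^sub>R u) = u"
    unfolding L_check_rel_def mem_Collect_eq prod.case by (metis c0_apply_eqI)
  show ?thesis
  proof (cases \<alpha> \<beta> rule: linorder_cases)
    case less
    show ?thesis
      unfolding L by (rule resolvent_fixed_point[OF assms(1) less, symmetric])
  next
    case equal
    show ?thesis
      unfolding L equal ..
  next
    case greater
    show ?thesis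
      unfolding L by (rule resolvent_fixed_point[OF assms(2) greater])
  qed
qed

lemma mem_neg_L_check_rel:
  assumes "0 < \<alpha>" "0 < \<beta>"
  shows "(u, v) \<in> neg_relation (L_check_rel X P A \<beta>) \<longleftrightarrow> resolvent \<alpha> (\<alpha> *\<^sub>R u - v) = u"
proof -
  have "(u, v) \<in> neg_relation (L_check_rel X P A \<beta>) \<longleftrightarrow> (u, - v) \<in> L_check_rel X P A \<beta>"
    unfolding neg_relation_def by force
  then show ?thesis
    using mem_L_check_rel[OF assms, of u "- v"] by simp
qed

lemma linear_relation_L_check:
  assumes \<beta>: "0 < \<beta>"
  shows "linear_relation (neg_relation (L_check_rel X P A \<beta>))"
  unfolding linear_relation_def
proof (rule subspaceI)
  note mem = mem_neg_L_check_rel[OF \<beta> \<beta>]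
  have zero: "resolvent \<beta> 0 = 0"
    using resolvent_scaleR[of \<beta> 0 0] \<beta> by simp
  then show "0 \<in> neg_relation (L_check_rel X P A \<beta>)"
    by (simp add: zero_prod_def mem)
  show "z + w \<in> neg_relation (L_check_rel X P A \<beta>)"
    if z: "z \<in> neg_relation (L_check_rel X P A \<beta>)" and w: "w \<in> neg_relation (L_check_rel X P A \<beta>)" for z w
  proof -
    obtain a b c d where zw: "z = (a, b)" "w = (c, d)"
      by fastforce
    have "\<beta> *\<^sub>R (a + c) - (b + d) = (\<beta> *\<^sub>R a - b) + (\<beta> *\<^sub>R c - d)"
      by (simp add: scaleR_right_distrib)
    then show ?thesis
      using z w \<beta> by (simp only: zw mem add_Pair resolvent_add[OF less_imp_le])
  qed
  show "k *\<^sub>R z \<in> neg_relation (L_check_rel X P A \<beta>)"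
    if z: "z \<in> neg_relation (L_check_rel X P A \<beta>)" for k z
  proof -
    obtain a b where ab: "z = (a, b)"
      by fastforce
    have "\<beta> *\<^sub>R (k *\<^sub>R a) - k *\<^sub>R b = k *\<^sub>R (\<beta> *\<^sub>R a - b)"
      by (simp add: scaleR_right_diff_distrib)
    then show ?thesis
      using z \<beta> by (simp only: ab mem scaleR_Pair resolvent_scaleR[OF less_imp_le])
  qed
qed

text \<open>Dissipativity for the step s is contractivity of \<alpha> R_\<alpha> at \<alpha> = 1 /
  s. The range condition is checked at the step 1 / \<beta>.\<close>

lemma m_dissipative_L_check:
  assumes \<beta>: "0 < \<beta>"
  shows "m_dissipative (neg_relation (L_check_rel X P A \<beta>))"
  unfolding m_dissipative_def dissipative_def
proof (intro conjI ballI, clarify)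
  fix u v and s :: real assume uv: "(u, v) \<in> neg_relation (L_check_rel X P A \<beta>)" and s: "0 < s"
  have "0 < 1 / s"
    using s by simp
  then have "resolvent (1 / s) ((1 / s) *\<^sub>R u - v) = u"
    using uv mem_neg_L_check_rel[OF _ \<beta>] by blast
  then have "norm u \<le> norm ((1 / s) *\<^sub>R u - v) / (1 / s)"
    using norm_resolvent_le[OF \<open>0 < 1 / s\<close>, of "(1 / s) *\<^sub>R u - v"] by simp
  also have "\<dots> = norm (s *\<^sub>R ((1 / s) *\<^sub>R u - v))"
    using s by (simp add: mult.commute)
  also have "s *\<^sub>R ((1 / s) *\<^sub>R u - v) = u - s *\<^sub>R v"
    using s by (simp add: scaleR_right_diff_distrib)
  finally show "norm u \<le> norm (u - s *\<^sub>R v)" .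
next
  show "\<exists>s>0. \<forall>z. \<exists>(x, y)\<in>neg_relation (L_check_rel X P A \<beta>). z = x - s *\<^sub>R y"
  proof (intro exI[of _ "1 / \<beta>"] conjI allI)
    fix z
    \<comment> \<open>Solving z = x - y / \<beta> for y gives y = \<beta> (x - z); then \<beta> x -
      y = \<beta> z, so membership says x = R_\<beta>(\<beta> z).\<close>
    let ?x = "resolvent \<beta> (\<beta> *\<^sub>R z)"
    let ?y = "\<beta> *\<^sub>R (?x - z)"
    have "(?x, ?y) \<in> neg_relation (L_check_rel X P A \<beta>)"
      unfolding mem_neg_L_check_rel[OF \<beta> \<beta>] by (simp add: scaleR_right_diff_distrib)
    moreover have "z = ?x - (1 / \<beta>) *\<^sub>R ?y"
      using \<beta> by simp
    ultimately show "\<exists>(x, y)\<in>neg_relation (L_check_rel X P A \<beta>). z = x - (1 / \<beta>) *\<^sub>R y"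
      by blast
  qed (use \<beta> in simp)
qed

section \<open>The integrated semigroup as bounded operators, and its Laplace transform\<close>

definition S_check :: "real \<Rightarrow> 'x c0 \<Rightarrow>\<^sub>L 'x c0" where
  "S_check t = Blinfun (\<lambda>u. SOME v. c0_apply v = St t u)"

text \<open>\<open>Blinfun\<close> is meaningful only for bounded linear maps; linearity comes from
  the integral, and ||G^\<mu>1|| is a bound for all t.\<close>

lemma c0_apply_S_check: "c0_apply (blinfun_apply (S_check t) u) = St t u"
proof -
  let ?S = "\<lambda>u. SOME v. c0_apply v = St t u"
  have S: "c0_apply (?S u) = St t u" for u
    using St_c0[of t u] by (metis (mono_tags) image_iff someI)
  have Icc: "set_integrable lborel {0..t} (\<lambda>r. Pt r (c0_apply u) x)" for u x
    using set_integrable_Pt[OF borel_measurable_c0_apply abs_c0_apply_le_norm, of u x]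
    by (rule set_integrable_subset) auto
  have "bounded_linear ?S"
  proof (rule bounded_linear_intro)
    show "?S (u + v) = ?S u + ?S v" for u v
      by (rule c0_apply_eqI) (simp add: S St_def Pt_c0_add set_integral_add(2)[OF Icc Icc])
    show "?S (a *\<^sub>R u) = a *\<^sub>R ?S u" for a u
      by (rule c0_apply_eqI) (simp add: S St_def Pt_c0_scaleR)
    show "norm (?S u) \<le> norm u * norm kato_function" for u
      by (rule norm_c0_le) (simp add: S abs_St_le)
  qed
  then show ?thesis
    by (simp add: S_check_def bounded_linear_Blinfun_apply S)
qed

lemma continuous_on_S_check: "continuous_on B (\<lambda>t. blinfun_apply (S_check t) u)"
proof (rule lipschitz_on_continuous_on[OF lipschitz_onI])
  fix s t
  show "dist (S_check s u) (S_check t u) \<le> norm u * dist s t"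
    unfolding dist_norm
  proof (rule norm_c0_le)
    show "\<bar>c0_apply (S_check s u - S_check t u) x\<bar> \<le> norm u * norm (s - t)" for x
      using St_lipschitz[of s t u x] St_lipschitz[of t s u x]
      by (cases "s \<le> t") (auto simp: c0_apply_S_check)
  qed
qed simp

text \<open>The integrand is norm continuous, so its integral over [0, T] is a Riemann integral in
  C_0. Evaluation at x reduces the limit to a scalar tail, which is at most ||u|| ||G^\<mu>1||
  exp(-\<alpha> T) / \<alpha> uniformly in x.\<close>

lemma laplace_S_check:
  assumes \<alpha>: "0 < \<alpha>"
  shows "has_improper_riemann_integral (\<lambda>t. exp (- \<alpha> * t) *\<^sub>R blinfun_apply (S_check t) u)
    ((1 / \<alpha>) *\<^sub>R resolvent \<alpha> u)"
  unfolding has_improper_riemann_integral_def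
proof (intro exI conjI allI impI)
  let ?f = "\<lambda>t. exp (- \<alpha> * t) *\<^sub>R blinfun_apply (S_check t) u"
  let ?I = "(1 / \<alpha>) *\<^sub>R resolvent \<alpha> u"
  let ?c = "norm u * norm kato_function"
  have cont: "continuous_on B ?f" for B
    by (intro continuous_intros continuous_on_S_check)
  show "has_riemann_integral ?f (integral {0..T} ?f) 0 T" if "0 \<le> T" for T
    by (rule has_riemann_integral_continuous[OF cont that])
  have bound: "norm (integral {0..T} ?f - ?I) \<le> ?c * (exp (- \<alpha> * T) / \<alpha>)" if T: "0 \<le> T" for T
  proof (rule norm_c0_le)
    fix x
    let ?h = "\<lambda>t. exp (- \<alpha> * t) * St t u x"
    have int: "set_integrable lborel {0..} ?h"
      by (rule set_integrable_exp_mult[OF \<alpha> measurable_St abs_St_le])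
    have int_T: "set_integrable lborel {0..T} ?h"
      by (rule set_integrable_subset[OF int]) auto
    have "c0_apply (integral {0..T} ?f) x = integral {0..T} ((\<lambda>v. c0_apply v x) \<circ> ?f)"
      by (rule integral_linear[OF integrable_continuous_real[OF cont] bounded_linear_c0_apply, symmetric])
    also have "\<dots> = (LBINT t:{0..T}. ?h t)"
      using set_borel_integral_eq_integral(2)[OF int_T] by (simp add: comp_def c0_apply_S_check)
    finally have J: "c0_apply (integral {0..T} ?f) x = (LBINT t:{0..T}. ?h t)" .
    have "\<alpha> * (LBINT t:{0..}. ?h t) = Res \<alpha> (c0_apply u) x"
      unfolding Res_def St_def
      by (rule laplace_integral[OF \<alpha> measurable_Pt[OF borel_measurable_c0_apply] abs_Pt_c0_le])
    then have I: "c0_apply ?I x = (LBINT t:{0..}. ?h t)"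
      using \<alpha> by (simp add: c0_apply_resolvent field_simps)
    have "(LBINT t. indicat_real {0..T} t *\<^sub>R ?h t - indicat_real {0..} t *\<^sub>R ?h t) =
        (LBINT t. indicat_real {0..T} t *\<^sub>R ?h t) - (LBINT t. indicat_real {0..} t *\<^sub>R ?h t)"
      using int int_T unfolding set_integrable_def by (intro Bochner_Integration.integral_diff)
    then have "\<bar>c0_apply (integral {0..T} ?f - ?I) x\<bar> =
        \<bar>LBINT t. indicat_real {0..T} t *\<^sub>R ?h t - indicat_real {0..} t *\<^sub>R ?h t\<bar>"
      unfolding c0_apply_simps(4) J I set_lebesgue_integral_def by simp
    also have "\<dots> \<le> (LBINT t. \<bar>indicat_real {0..T} t *\<^sub>R ?h t - indicat_real {0..} t *\<^sub>R ?h t\<bar>)"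
      by (rule integral_abs_bound)
    also have "\<dots> \<le> (LBINT t. ?c * (indicat_real {T..} t *\<^sub>R exp (- \<alpha> * t)))"
    proof (rule integral_mono)
      show "integrable lborel (\<lambda>t. \<bar>indicat_real {0..T} t *\<^sub>R ?h t - indicat_real {0..} t *\<^sub>R ?h t\<bar>)"
        using int int_T unfolding set_integrable_def by (intro integrable_abs Bochner_Integration.integrable_diff)
      show "integrable lborel (\<lambda>t. ?c * (indicat_real {T..} t *\<^sub>R exp (- \<alpha> * t)))"
        using set_integrable_exp(1)[OF \<alpha>, of T] unfolding set_integrable_def by (rule integrable_mult_right)
      fix t
      show "\<bar>indicat_real {0..T} t *\<^sub>R ?h t - indicat_real {0..} t *\<^sub>R ?h t\<bar> \<le> ?c * (indicat_real {T..} t *\<^sub>R exp (- \<alpha> * t))"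
        using mult_right_mono[OF abs_St_le[of t u x], of "exp (- \<alpha> * t)"] T
        by (auto simp: indicator_def abs_mult mult.commute)
    qed
    also have "\<dots> = ?c * (exp (- \<alpha> * T) / \<alpha>)"
      using set_integrable_exp(2)[OF \<alpha>, of T] by (simp add: set_lebesgue_integral_def)
    finally show "\<bar>c0_apply (integral {0..T} ?f - ?I) x\<bar> \<le> ?c * (exp (- \<alpha> * T) / \<alpha>)" .
  qed
  have "((\<lambda>T. integral {0..T} ?f - ?I) \<longlongrightarrow> 0) at_top"
  proof (rule Lim_null_comparison)
    show "eventually (\<lambda>T. norm (integral {0..T} ?f - ?I) \<le> ?c * (exp (- \<alpha> * T) / \<alpha>)) at_top"
      using eventually_ge_at_top[of 0] by eventually_elim (rule bound)
    have "filterlim (\<lambda>T. - \<alpha> * T) at_bot at_top"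
      by (rule filterlim_tendsto_neg_mult_at_bot[OF tendsto_const _ filterlim_ident]) (use \<alpha> in simp)
    then have "((\<lambda>T. exp (- \<alpha> * T)) \<longlongrightarrow> 0) at_top"
      by (rule filterlim_compose[OF exp_at_bot])
    then have "((\<lambda>T. ?c * (exp (- \<alpha> * T) / \<alpha>)) \<longlongrightarrow> ?c * (0 / \<alpha>)) at_top"
      using \<alpha> by (intro tendsto_intros) auto
    then show "((\<lambda>T. ?c * (exp (- \<alpha> * T) / \<alpha>)) \<longlongrightarrow> 0) at_top"
      by simp
  qed
  then show "((\<lambda>T. integral {0..T} ?f) \<longlongrightarrow> ?I) at_top"
    by (rule LIM_zero_cancel)
qed

text \<open>x belongs to the image of z under (\<alpha> - A)^{-1} exactly if (x, \<alpha> x - z) is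
  in A, and this is the condition R_\<alpha> z = x; so the relation is the graph of
  R_\<alpha>.\<close>

lemma generates_integrated_semigroup_S_check:
  assumes \<beta>: "0 < \<beta>"
  shows "generates_integrated_semigroup (neg_relation (L_check_rel X P A \<beta>)) S_check 0"
  unfolding generates_integrated_semigroup_def
proof (intro conjI allI impI continuous_on_S_check)
  fix \<alpha> :: real and z assume \<alpha>: "0 < \<alpha>"
  have "{x. (z, x) \<in> resolvent_relation (neg_relation (L_check_rel X P A \<beta>)) \<alpha>} = {resolvent \<alpha> z}"
  proof (rule set_eqI)
    fix x
    have "(z, x) \<in> resolvent_relation (neg_relation (L_check_rel X P A \<beta>)) \<alpha> \<longleftrightarrow>
        (x, \<alpha> *\<^sub>R x - z) \<in> neg_relation (L_check_rel X P A \<beta>)"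
      unfolding resolvent_relation_def by force
    also have "\<dots> \<longleftrightarrow> resolvent \<alpha> z = x"
      unfolding mem_neg_L_check_rel[OF \<alpha> \<beta>] by simp
    finally show "x \<in> {x. (z, x) \<in> resolvent_relation (neg_relation (L_check_rel X P A \<beta>)) \<alpha>} \<longleftrightarrow> x \<in> {resolvent \<alpha> z}"
      by auto
  qed
  then show "\<exists>I. has_improper_riemann_integral (\<lambda>t. exp (- \<alpha> * t) *\<^sub>R blinfun_apply (S_check t) z) I \<and>
      {x. (z, x) \<in> resolvent_relation (neg_relation (L_check_rel X P A \<beta>)) \<alpha>} = {\<alpha> *\<^sub>R I}"
    using laplace_S_check[OF \<alpha>, of z] \<alpha> by (intro exI[of _ "(1 / \<alpha>) *\<^sub>R resolvent \<alpha> z"]) simp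
qed

end

theorem proposition2p7:
  fixes m \<mu> :: "'x :: {metric_space, second_countable_topology} measure"
    and M :: "'w measure" and F :: "ennreal \<Rightarrow> 'w measure"
    and X :: "ennreal \<Rightarrow> 'w \<Rightarrow> 'x option" and \<theta> :: "ennreal \<Rightarrow> 'w \<Rightarrow> 'w"
    and P :: "'x option \<Rightarrow> 'w measure"
    and M' :: "'v measure" and F' :: "ennreal \<Rightarrow> 'v measure"
    and X' :: "ennreal \<Rightarrow> 'v \<Rightarrow> 'x option" and \<theta>' :: "ennreal \<Rightarrow> 'v \<Rightarrow> 'v"
    and P' :: "'x option \<Rightarrow> 'v measure"
    and p :: "real \<Rightarrow> 'x \<Rightarrow> 'x \<Rightarrow> ennreal"
    and A :: "real \<Rightarrow> 'w \<Rightarrow> real"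
    and \<beta> :: real
  assumes "locally_compact_space (euclidean :: 'x topology)"
    and "radon_measure m" and "full_support m"
    and "standard_process M F X \<theta> P" and "transient X P"
    and "standard_process M' F' X' \<theta>' P'" and "transient X' P'"
    and "in_duality m X P X' P'"
    and "transition_density m X P p" and "\<forall>t>0. \<forall>x y. 0 < p t x y"
    and "\<exists>x y. green p 0 x y \<noteq> \<infinity>"
    and "lower_semicontinuous (\<lambda>(x, y). green p 0 x y)"
    and "kato_measure p \<mu>"
    and "pcaf X \<theta> P A" and "revuz_measure m X P A \<mu>" and "revuz_potential_formula X P p A \<mu>"
    and "0 < \<beta>"
  shows "linear_relation (neg_relation (L_check_rel X P A \<beta>)) \<and>
    m_dissipative (neg_relation (L_check_rel X P A \<beta>)) \<and>
    (\<exists>S :: real \<Rightarrow> 'x c0 \<Rightarrow>\<^sub>L 'x c0.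
      generates_integrated_semigroup (neg_relation (L_check_rel X P A \<beta>)) S 0 \<and>
      (\<forall>\<alpha>>0. \<forall>u. \<exists>I.
        has_improper_riemann_integral (\<lambda>t. exp (- \<alpha> * t) *\<^sub>R blinfun_apply (S t) u) I \<and>
        R_check X P A \<alpha> (c0_apply u) = c0_apply (\<alpha> *\<^sub>R I)) \<and>
      (\<forall>t\<ge>0. \<forall>u. has_uniform_riemann_integral
        (\<lambda>s. P_check X P A s (c0_apply u)) (c0_apply (blinfun_apply (S t) u)) 0 t))"
proof -
  interpret standard_process M F X \<theta> P by fact
  interpret kato_time_change M F X \<theta> P A p \<mu>
    by unfold_locales (fact assms)+
  show ?thesis
  proof (intro conjI exI[of _ S_check] allI impI)
    show "linear_relation (neg_relation (L_check_rel X P A \<beta>))"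
      "m_dissipative (neg_relation (L_check_rel X P A \<beta>))"
      "generates_integrated_semigroup (neg_relation (L_check_rel X P A \<beta>)) S_check 0"
      by (intro linear_relation_L_check m_dissipative_L_check generates_integrated_semigroup_S_check assms)+
    show "has_uniform_riemann_integral (\<lambda>s. P_check X P A s (c0_apply u)) (c0_apply (blinfun_apply (S_check t) u)) 0 t"
      if "0 \<le> t" for t u
      unfolding c0_apply_S_check by (rule Pt_uniform_riemann_integral[OF that])
    fix \<alpha> :: real and u :: "'x c0" assume \<alpha>: "0 < \<alpha>"
    have "R_check X P A \<alpha> (c0_apply u) = c0_apply (\<alpha> *\<^sub>R (1 / \<alpha>) *\<^sub>R resolvent \<alpha> u)"
      using \<alpha> R_check_eq_Res[OF borel_measurable_c0_apply abs_c0_apply_le_norm \<alpha>]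
      by (simp add: c0_apply_resolvent fun_eq_iff)
    then show "\<exists>I. has_improper_riemann_integral (\<lambda>t. exp (- \<alpha> * t) *\<^sub>R blinfun_apply (S_check t) u) I \<and>
        R_check X P A \<alpha> (c0_apply u) = c0_apply (\<alpha> *\<^sub>R I)"
      using laplace_S_check[OF \<alpha>] by blast
  qed
qed

end
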